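(* Let $A\in\mathfrak{gl}_n(\mathbb C)$ and let $(G_A,J_A)$ be the simply-connected almost-abelian complex Lie group determined by $A$. Then $(G_A,J_A)$ admits at most one left-invariant $\mathrm{HCF}_+$ soliton up to homotheties (i.e. up to scaling and pullback by biholomorphic Lie group automorphisms). Moreover, $(G_A,J_A)$ admits a left-invariant $\mathrm{HCF}_+$ soliton if and only if $A$ is semi-simple (diagonalizable over $\mathbb C$) or nilpotent.
   Context: For $A\in\mathfrak{gl}_n(\mathbb C)$, let $\mu_A$ be the complex Lie bracket on $\mathbb C^{n+1}$ with basis $Z_0,Z_1,\dots,Z_n$ defined by $\mu_A(Z_0,Z_i)=AZ_i$ for $i\ge1$ (viewing $A$ as acting on $\mathrm{span}\{Z_1,\dots,Z_n\}\cong\mathbb C^n$) and $\mu_A(Z_i,Z_j)=0$ for $i,j\ge1$; $(G_A,J_A)$ is the simply-connected complex Lie group with Lie algebra $(\mathbb C^{n+1},\mu_A)$. Every simply-connected almost-abelian complex Lie group (one whose Lie algebra has a complex codimension-one abelian ideal) is of this form. For a left-invariant Hermitian metric $g$ on a complex Lie group with Lie algebra $\mathfrak g$, bracket $\mu$, the torsion-twisted Chern–Ricci tensor is given, for any left-invariant holomorphic frame $Z_1,\dots,Z_m$ of $\mathfrak g^{1,0}$, by $\Theta(g)(Z_i,\bar Z_j)=\tfrac12 g^{k\bar l}g^{r\bar s}\,g(Z_i,\mu(\bar Z_l,\bar Z_s))\,g(\mu(Z_k,Z_r),\bar Z_j)$ (summation convention). A left-invariant $\mathrm{HCF}_+$ soliton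 is a left-invariant Hermitian metric with $\Theta(g)=\lambda g+\mathcal L_Zg$ for some $\lambda\in\mathbb R$ and holomorphic vector field $Z$. *)

theory Defs
  imports "HOL-Analysis.Analysis"
begin

text \<open>Coordinates: the Lie algebra and the group G_A are both modelled on
  complex^('n option); index None is Z_0, index Some i is Z_i.\<close>

definition mpow :: "complex^'k^'k \<Rightarrow> nat \<Rightarrow> complex^'k^'k" where
  "mpow M k = ((\<lambda>X. X ** M) ^^ k) (mat 1)"

definition mexp :: "complex^'k^'k \<Rightarrow> complex^'k^'k" where
  "mexp M = (\<Sum>k. (1 / fact k) *\<^sub>R mpow M k)"

definition cmat_scale :: "complex \<Rightarrow> complex^'k^'k \<Rightarrow> complex^'k^'k" where
  "cmat_scale c M = (\<chi> i j. c * M$i$j)"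

definition extA :: "complex^'n^'n \<Rightarrow> complex^('n option)^('n option)" where
  "extA A = (\<chi> i j. case i of None \<Rightarrow> 0 | Some a \<Rightarrow> (case j of None \<Rightarrow> 0 | Some b \<Rightarrow> A$a$b))"

text \<open>The bracket mu_A: mu(Z_0,Z_i) = A Z_i, mu(Z_i,Z_j)=0.\<close>
definition muA :: "complex^'n^'n \<Rightarrow> complex^('n option) \<Rightarrow> complex^('n option) \<Rightarrow> complex^('n option)" where
  "muA A u v = (u$None) *s (extA A *v v) - (v$None) *s (extA A *v u)"

text \<open>Simply connected group G_A = C \<ltimes>_{exp(tA)} C^n in global holomorphic
  coordinates: (z0,z)(w0,w) = (z0+w0, z + exp(z0 A) w). Identity is 0.\<close>
definition gmul :: "complex^'n^'n \<Rightarrow> complex^('n option) \<Rightarrow> complex^('n option) \<Rightarrow> complex^('n option)" where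
  "gmul A p q = p + mexp (cmat_scale (p$None) (extA A)) *v q"

definition holo :: "(complex^'m \<Rightarrow> complex^'m) \<Rightarrow> bool" where
  "holo f \<longleftrightarrow> (\<forall>p. f differentiable (at p) \<and>
      (\<forall>c u. frechet_derivative f (at p) (c *s u) = c *s frechet_derivative f (at p) u))"

text \<open>Hermitian inner product H(u,v) = g(u, conj v) on (1,0)-vectors (complex-linear in the first slot).\<close>
definition herm_form :: "(complex^'m \<Rightarrow> complex^'m \<Rightarrow> complex) \<Rightarrow> bool" where
  "herm_form H \<longleftrightarrow> (\<forall>u v w. H (u + v) w = H u w + H v w) \<and>
     (\<forall>c u v. H (c *s u) v = c * H u v) \<and>
     (\<forall>u v. H v u = cnj (H u v)) \<and>
     (\<forall>u. u \<noteq> 0 \<longrightarrow> Re (H u u) > 0)"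

definition left_inv_metric :: "complex^'n^'n \<Rightarrow> (complex^('n option) \<Rightarrow> complex^('n option) \<Rightarrow> complex^('n option) \<Rightarrow> complex) \<Rightarrow> bool" where
  "left_inv_metric A g \<longleftrightarrow> (\<forall>p. herm_form (g p)) \<and>
     (\<forall>p q u v. g (gmul A p q) (frechet_derivative (gmul A p) (at q) u)
                              (frechet_derivative (gmul A p) (at q) v) = g q u v)"

definition dL :: "complex^'n^'n \<Rightarrow> complex^('n option) \<Rightarrow> complex^('n option) \<Rightarrow> complex^('n option)" where
  "dL A p = frechet_derivative (gmul A p) (at 0)"

text \<open>Standard (left-invariant holomorphic) frame Z_i = axis i 1 at the identity.\<close>
definition gram :: "(complex^'m \<Rightarrow> complex^'m \<Rightarrow> complex) \<Rightarrow> complex^'m^'m" where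
  "gram H = (\<chi> k l. H (axis k 1) (axis l 1))"

text \<open>g^{k lbar}: g^{k lbar} g_{m lbar} = delta.\<close>
definition gram_inv :: "(complex^'m \<Rightarrow> complex^'m \<Rightarrow> complex) \<Rightarrow> complex^'m^'m" where
  "gram_inv H = matrix_inv (transpose (gram H))"

text \<open>Torsion-twisted Chern-Ricci form at the identity, Theta(Z_i, Zbar_j), for metric H at e.\<close>
definition ThetaE_frame :: "complex^'n^'n \<Rightarrow> (complex^('n option) \<Rightarrow> complex^('n option) \<Rightarrow> complex)
     \<Rightarrow> 'n option \<Rightarrow> 'n option \<Rightarrow> complex" where
  "ThetaE_frame A H i j = (1/2) * (\<Sum>k\<in>UNIV. \<Sum>l\<in>UNIV. \<Sum>r\<in>UNIV. \<Sum>s\<in>UNIV.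
      gram_inv H $ k $ l * gram_inv H $ r $ s *
      H (axis i 1) (muA A (axis l 1) (axis s 1)) * H (muA A (axis k 1) (axis r 1)) (axis j 1))"

definition ThetaE :: "complex^'n^'n \<Rightarrow> (complex^('n option) \<Rightarrow> complex^('n option) \<Rightarrow> complex)
     \<Rightarrow> complex^('n option) \<Rightarrow> complex^('n option) \<Rightarrow> complex" where
  "ThetaE A H u v = (\<Sum>i\<in>UNIV. \<Sum>j\<in>UNIV. u$i * cnj (v$j) * ThetaE_frame A H i j)"

text \<open>Lie derivative (L_Z g)(X^{1,0}, conj Y^{1,0}) of a Hermitian metric along the
  (real) holomorphic vector field with coordinate expression Z.\<close>
definition lie_deriv :: "(complex^'m \<Rightarrow> complex^'m) \<Rightarrow> (complex^'m \<Rightarrow> complex^'m \<Rightarrow> complex^'m \<Rightarrow> complex)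
     \<Rightarrow> complex^'m \<Rightarrow> complex^'m \<Rightarrow> complex^'m \<Rightarrow> complex" where
  "lie_deriv Z g p u v = vector_derivative (\<lambda>t::real. g (p + t *\<^sub>R Z p) u v) (at 0)
      + g p (frechet_derivative Z (at p) u) v + g p u (frechet_derivative Z (at p) v)"

text \<open>Left-invariant HCF_+ soliton: Theta(g) = lambda g + L_Z g. Theta(g) is the left-invariant
  tensor with Theta(g)_p(dL_p u, dL_p v) = ThetaE(g_e)(u,v); since dL_p is bijective this is the
  pointwise equation.\<close>
definition hcf_soliton :: "complex^'n^'n \<Rightarrow> (complex^('n option) \<Rightarrow> complex^('n option) \<Rightarrow> complex^('n option) \<Rightarrow> complex) \<Rightarrow> bool" where
  "hcf_soliton A g \<longleftrightarrow> left_inv_metric A g \<and>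
     (\<exists>(lam::real) Z. holo Z \<and>
        (\<forall>p u v. ThetaE A (g 0) u v =
            of_real lam * g p (dL A p u) (dL A p v) + lie_deriv Z g p (dL A p u) (dL A p v)))"

definition biholo_aut :: "complex^'n^'n \<Rightarrow> (complex^('n option) \<Rightarrow> complex^('n option)) \<Rightarrow> bool" where
  "biholo_aut A \<phi> \<longleftrightarrow> bij \<phi> \<and> holo \<phi> \<and> holo (inv \<phi>) \<and>
     (\<forall>p q. \<phi> (gmul A p q) = gmul A (\<phi> p) (\<phi> q))"

definition semisimple_mat :: "complex^'n^'n \<Rightarrow> bool" where
  "semisimple_mat A \<longleftrightarrow> (\<exists>(P::complex^'n^'n) (D::complex^'n^'n). invertible P \<and> (\<forall>i j. i \<noteq> j \<longrightarrow> D$i$j = 0) \<and> A = P ** D ** matrix_inv P)"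

definition nilpotent_mat :: "complex^'n^'n \<Rightarrow> bool" where
  "nilpotent_mat A \<longleftrightarrow> (\<exists>k. mpow A k = 0)"

end

theory Submission
  imports Defs "HOL-Complex_Analysis.Complex_Analysis"
begin

text \<open>
  Pull the vector field of a soliton back to the identity by left translations. The endomorphism \<open>u \<mapsto> - [Z, u]\<close> of
  the Lie algebra obtained in this way depends holomorphically on the point and has constant Hermitian part, so
  it is a constant derivation. In a unitary frame adapted to the abelian ideal the soliton equation becomes
  \<open>N a a\<^sup>* = E + E\<^sup>* - 2 Re d\<close> and \<open>[E, a] = d a\<close>, where \<open>a\<close> is conjugate to \<open>A\<close>. Taking traces,
  \<open>4 N\<^sup>-\<^sup>1 Re d \<parallel>a\<parallel>\<^sup>2 = \<parallel>[a, a\<^sup>*]\<parallel>\<^sup>2\<close>: either \<open>a\<close> is normal, or \<open>d \<noteq> 0\<close> and \<open>a\<close> is nilpotent.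

  In the nilpotent case the equation is linear in the inverse metric, and a maximum principle shows that it
  has only the solution \<open>\<Sum> a\<^sup>j P a\<^sup>*\<^sup>j / (\<kappa>\<^sup>j j!)\<close> with \<open>P\<close> the projection onto \<open>ker a\<^sup>*\<close>. This forces
  \<open>[a a\<^sup>*, a] = \<kappa> a\<close>, which determines \<open>a\<close> up to scaling and unitary equivalence by its Jordan type. For normal \<open>a\<close>
  the same follows from Fuglede's theorem. Unitary equivalence of the matrices integrates to an automorphism of
  the group. Conversely, an eigenbasis or a suitably rescaled Jordan basis of \<open>A\<close> declared unitary gives a
  soliton with a linear vector field.
\<close>

unbundle no fps_syntax

section \<open>The Banach algebra of complex matrices\<close>

text \<open>The vector field of a soliton is an arbitrary global holomorphic field, not assumed
  complete or generated by automorphisms, so the algebraic equation cannot be read off from a flow;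
  it has to come from the rigidity of entire functions on complex lines.

  The delicate half of uniqueness is the nilpotent one. Equal Jordan type only yields an invertible
  \<open>T\<close> with \<open>a * T = T * b\<close>, which says nothing about adjoints.
  \<open>T\<close> is improved twice by discarding off-diagonal blocks: first along the eigenspaces
  of \<open>a * star a\<close>, then along the flag of the kernels of the powers of
  \<open>a\<close>. Triangularity keeps the diagonal part invertible, and since \<open>a\<close>
  shifts each grading by one step, the diagonal part still intertwines. At the end the adjoints are
  intertwined as well, and the unitary polar factor is the wanted equivalence.

  \<open>N\<close> is the inverse squared length of the direction orthogonal to the ideal; it is
  absorbed by passing from \<open>a\<close> to \<open>sqrt N *\<^sub>R a\<close>. Matrices get their
  own type so that the product, powers and \<open>exp\<close> are those of matrices.\<close>

typedef 'n cmat = "UNIV :: (complex^'n^'n) set" morphisms mat_of Cmat ..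

lemma mat_of_Cmat [simp]: "mat_of (Cmat M) = M"
  by (simp add: Cmat_inverse)

lemma Cmat_mat_of [simp]: "Cmat (mat_of x) = x"
  by (simp add: mat_of_inverse)

definition app :: "'n::finite cmat \<Rightarrow> complex^'n \<Rightarrow> complex^'n" where
  "app x v = mat_of x *v v"

lemma cmat_eqI: "(\<And>v. app x v = app y v) \<Longrightarrow> x = y"
  by (metis app_def mat_of_inject matrix_eq)

lemma app_Cmat: "app (Cmat M) v = M *v v"
  by (simp add: app_def)

lemma app_add_right: "app x (u + v) = app x u + app x v"
  by (simp add: app_def matrix_vector_right_distrib)

lemma app_vscale: "app x (c *s v) = c *s app x v"
  by (simp add: app_def matrix_vector_mult_def vec_eq_iff sum_distrib_left mult_ac)

lemma vscale_real: "complex_of_real r *s v = r *\<^sub>R v"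
  unfolding vec_eq_iff vector_scaleR_component vector_smult_component
  by (simp add: scaleR_conv_of_real)

lemma app_scaleR_right: "app x (r *\<^sub>R v) = r *\<^sub>R app x v"
  by (metis app_vscale vscale_real)

lemma bounded_linear_app: "bounded_linear (app x)"
  by (intro linear_conv_bounded_linear[THEN iffD1] linearI)
    (simp_all add: app_add_right app_scaleR_right)

lemma app_0_right [simp]: "app x 0 = 0"
  by (simp add: app_def)

lemma app_diff_right: "app x (u - v) = app x u - app x v"
  by (rule linear_diff[OF bounded_linear.linear[OF bounded_linear_app]])

lemma app_minus_right: "app x (- v) = - app x v"
  by (rule linear_neg[OF bounded_linear.linear[OF bounded_linear_app]])

lemma app_sum_right: "app x (sum f I) = (\<Sum>i\<in>I. app x (f i))"
  by (rule linear_sum[OF bounded_linear.linear[OF bounded_linear_app]])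

instantiation cmat :: (finite) ring_1
begin
definition "0 = Cmat 0"
definition "1 = Cmat (mat 1)"
definition "x + y = Cmat (mat_of x + mat_of y)"
definition "x - y = Cmat (mat_of x - mat_of y)"
definition "- x = Cmat (- mat_of x)"
definition "x * y = Cmat (mat_of x ** mat_of y)"
lemma app_0 [simp]: "app 0 v = 0"
  by (simp add: zero_cmat_def app_Cmat)
lemma app_1 [simp]: "app 1 v = v"
  by (simp add: one_cmat_def app_Cmat)
lemma app_add: "app (x + y) v = app x v + app y v"
  by (simp add: plus_cmat_def app_def matrix_vector_mult_add_rdistrib)
lemma app_diff: "app (x - y) v = app x v - app y v"
  by (simp add: minus_cmat_def app_def matrix_vector_mult_diff_rdistrib)
lemma app_minus: "app (- x) v = - app x v"
  by (simp add: uminus_cmat_def app_def matrix_vector_mult_def vec_eq_iff sum_negf)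
lemma app_mult: "app (x * y) v = app x (app y v)"
  by (simp add: times_cmat_def app_def matrix_vector_mul_assoc)
instance
proof
  fix x y z :: "'a cmat"
  show "x + y + z = x + (y + z)" "x + y = y + x" "0 + x = x" "- x + x = 0" "x - y = x + - y"
    "x * y * z = x * (y * z)" "1 * x = x" "x * 1 = x" "(x + y) * z = x * z + y * z"
    "x * (y + z) = x * y + x * z"
    by (rule cmat_eqI; simp add: app_add app_minus app_mult app_add_right app_diff)+
  show "(0::'a cmat) \<noteq> 1"
  proof
    assume "(0::'a cmat) = 1"
    then have "app (0::'a cmat) (\<chi> i. 1) = app 1 (\<chi> i. 1)"
      by simp
    then show False
      by (simp add: vec_eq_iff)
  qed
qed
end

instantiation cmat :: (finite) real_algebra_1
begin
definition scaleR_cmat :: "real \<Rightarrow> 'a cmat \<Rightarrow> 'a cmat"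
  where "scaleR_cmat r x = Cmat (r *\<^sub>R mat_of x)"
lemma app_scaleR: "app (r *\<^sub>R x) v = r *\<^sub>R app x v"
  by (simp add: scaleR_cmat_def app_def matrix_vector_mult_def vec_eq_iff scaleR_sum_right)
instance
proof
  fix x y :: "'a cmat" and r s :: real
  show "r *\<^sub>R (x + y) = r *\<^sub>R x + r *\<^sub>R y" "(r + s) *\<^sub>R x = r *\<^sub>R x + s *\<^sub>R x"
    "r *\<^sub>R s *\<^sub>R x = (r * s) *\<^sub>R x" "1 *\<^sub>R x = x" "r *\<^sub>R x * y = r *\<^sub>R (x * y)" "x * r *\<^sub>R y = r *\<^sub>R (x * y)"
    by (rule cmat_eqI; simp add: app_add app_scaleR app_mult app_scaleR_right algebra_simps)+
qed
end

section \<open>Operator norm and completeness\<close>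

instantiation cmat :: (finite) real_normed_algebra_1
begin
definition norm_cmat :: "'a cmat \<Rightarrow> real"
  where "norm_cmat x = onorm (app x)"
definition sgn_cmat :: "'a cmat \<Rightarrow> 'a cmat"
  where "sgn_cmat x = x /\<^sub>R norm x"
definition dist_cmat :: "'a cmat \<Rightarrow> 'a cmat \<Rightarrow> real"
  where "dist_cmat x y = norm (x - y)"
definition uniformity_cmat :: "('a cmat \<times> 'a cmat) filter"
  where "uniformity_cmat = (INF e\<in>{0 <..}. principal {(x, y). dist x y < e})"
definition open_cmat :: "'a cmat set \<Rightarrow> bool"
  where "open_cmat S = (\<forall>x\<in>S. \<forall>\<^sub>F (x', y) in uniformity. x' = x \<longrightarrow> y \<in> S)"
instance
proof
  fix x y :: "'a cmat" and r :: real
  show "dist x y = norm (x - y)" by (simp add: dist_cmat_def)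
  show "sgn x = x /\<^sub>R norm x" by (simp add: sgn_cmat_def)
  show "uniformity = (INF e\<in>{0 <..}. principal {(x, y). dist (x::'a cmat) y < e})"
    by (simp add: uniformity_cmat_def)
  show "open U = (\<forall>x\<in>U. \<forall>\<^sub>F (x', y) in uniformity. x' = x \<longrightarrow> y \<in> U)" for U :: "'a cmat set"
    by (simp add: open_cmat_def)
  show "norm x = 0 \<longleftrightarrow> x = 0"
    unfolding norm_cmat_def onorm_eq_0[OF bounded_linear_app]
    by (metis app_0 cmat_eqI)
  show "norm (x + y) \<le> norm x + norm y"
    unfolding norm_cmat_def app_add
    by (rule onorm_triangle[OF bounded_linear_app bounded_linear_app])
  show "norm (r *\<^sub>R x) = \<bar>r\<bar> * norm x"
    unfolding norm_cmat_def app_scaleR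
    by (rule onorm_scaleR[OF bounded_linear_app])
  show "norm (x * y) \<le> norm x * norm y"
    unfolding norm_cmat_def app_mult
    using onorm_compose[OF bounded_linear_app bounded_linear_app, of x y] by (simp add: o_def)
  have "app (1::'a cmat) = (\<lambda>v. v)" by auto
  then show "norm (1::'a cmat) = 1"
    unfolding norm_cmat_def
    by (simp add: onorm_id)
qed
end

lemma norm_app_le: "norm (app x v) \<le> norm x * norm v"
  unfolding norm_cmat_def by (rule onorm[OF bounded_linear_app])

lemma norm_cmat_leI: "(\<And>v. norm (app x v) \<le> b * norm v) \<Longrightarrow> norm x \<le> b"
  unfolding norm_cmat_def by (rule onorm_le)

lemma bounded_bilinear_app: "bounded_bilinear app"
  by (rule bounded_bilinear.intro, simp_all add: app_add app_add_right app_scaleR app_scaleR_right)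
    (metis mult.right_neutral norm_app_le)

lemma app_axis: "app x (axis j 1) $ i = mat_of x $ i $ j"
  by (simp add: app_def matrix_vector_mult_def axis_def if_distrib cong: if_cong)

lemma app_expand: "app x v $ i = (\<Sum>j\<in>UNIV. mat_of x $ i $ j * v $ j)"
  by (simp add: app_def matrix_vector_mult_def)

lemma app_cong_axis: "(\<And>i j. app x (axis j 1) $ i = app y (axis j 1) $ i) \<Longrightarrow> x = y"
  by (simp add: app_axis mat_of_inject[symmetric] vec_eq_iff)

lemma bounded_linear_entry: "bounded_linear (\<lambda>x. mat_of x $ i $ j)"
proof -
  have "bounded_linear (\<lambda>x. app x (axis j 1) $ i)"
    by (rule bounded_linear_compose[OF bounded_linear_vec_nth])
      (rule bounded_bilinear.bounded_linear_left[OF bounded_bilinear_app])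
  then show ?thesis by (simp add: app_axis)
qed

lemma norm_vec_le_sum: "norm (v::complex^'n) \<le> (\<Sum>i\<in>UNIV. norm (v $ i))"
  unfolding norm_vec_def by (rule L2_set_le_sum) simp

lemma norm_cmat_le_sum: "norm x \<le> (\<Sum>i\<in>UNIV. \<Sum>j\<in>UNIV. norm (mat_of x $ i $ j))"
proof (rule norm_cmat_leI)
  fix v
  have "norm (app x v) \<le> (\<Sum>i\<in>UNIV. norm (app x v $ i))"
    by (rule norm_vec_le_sum)
  also have "\<dots> \<le> (\<Sum>i\<in>UNIV. \<Sum>j\<in>UNIV. norm (mat_of x $ i $ j) * norm v)"
    unfolding app_expand
    by (intro sum_mono order_trans[OF norm_sum] )
      (simp add: norm_mult mult_left_mono component_le_norm_cart Finite_Cartesian_Product.norm_nth_le)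
  finally show "norm (app x v) \<le> (\<Sum>i\<in>UNIV. \<Sum>j\<in>UNIV. norm (mat_of x $ i $ j)) * norm v"
    by (simp add: sum_distrib_right)
qed

lemma tendsto_cmatI:
  assumes "\<And>i j. ((\<lambda>n. mat_of (X n) $ i $ j) \<longlongrightarrow> mat_of L $ i $ j) F"
  shows "(X \<longlongrightarrow> L) F"
proof -
  have "((\<lambda>n. \<Sum>i\<in>UNIV. \<Sum>j\<in>UNIV. norm (mat_of (X n) $ i $ j - mat_of L $ i $ j)) \<longlongrightarrow> 0) F"
    using assms by (auto intro!: tendsto_null_sum simp: LIM_zero tendsto_norm_zero_iff)
  moreover have "\<forall>\<^sub>F n in F. norm (X n - L) \<le> (\<Sum>i\<in>UNIV. \<Sum>j\<in>UNIV. norm (mat_of (X n) $ i $ j - mat_of L $ i $ j))"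
    using norm_cmat_le_sum[of "X _ - L"] by (simp add: minus_cmat_def)
  ultimately have "((\<lambda>n. X n - L) \<longlongrightarrow> 0) F"
    by (rule Lim_null_comparison[rotated])
  then show ?thesis by (simp add: LIM_zero_iff)
qed

instance cmat :: (finite) banach
proof
  fix X :: "nat \<Rightarrow> 'a cmat"
  assume X: "Cauchy X"
  have "convergent (\<lambda>n. mat_of (X n) $ i $ j)" for i j
    by (intro Cauchy_convergent bounded_linear.Cauchy[OF bounded_linear_entry X])
  then have "\<exists>l. (\<lambda>n. mat_of (X n) $ i $ j) \<longlonglongrightarrow> l" for i j
    by (simp add: convergent_def)
  then obtain l where "\<And>i j. (\<lambda>n. mat_of (X n) $ i $ j) \<longlonglongrightarrow> l i j"
    by metis
  then have "X \<longlonglongrightarrow> Cmat (\<chi> i j. l i j)"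
    by (intro tendsto_cmatI) simp
  then show "convergent X" by (rule convergentI)
qed

subsection \<open>Complex scalars, adjoints and traces\<close>

text \<open>The type is a real Banach algebra, which is what \<open>exp\<close> asks for; the
  parameter of the group is complex, so complex multiples are added as a separate operation.\<close>

definition csc :: "complex \<Rightarrow> 'n::finite cmat \<Rightarrow> 'n cmat" where
  "csc c x = Cmat (cmat_scale c (mat_of x))"

lemma app_csc: "app (csc c x) v = c *s app x v"
  by (simp add: csc_def app_def cmat_scale_def matrix_vector_mult_def vec_eq_iff sum_distrib_left mult_ac)

lemma csc_mult_left [simp]: "csc c x * y = csc c (x * y)"
  by (rule cmat_eqI) (simp add: app_csc app_mult)

lemma csc_mult_right [simp]: "x * csc c y = csc c (x * y)"
  by (rule cmat_eqI) (simp add: app_csc app_mult app_vscale)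

lemma csc_csc [simp]: "csc c (csc d x) = csc (c * d) x"
  by (rule cmat_eqI) (simp add: app_csc)

lemma csc_add_left: "csc (c + d) x = csc c x + csc d x"
  by (rule cmat_eqI) (simp add: app_csc app_add vec_eq_iff algebra_simps)

lemma csc_add_right: "csc c (x + y) = csc c x + csc c y"
  by (rule cmat_eqI) (simp add: app_csc app_add vec_eq_iff algebra_simps)

lemma csc_diff_right: "csc c (x - y) = csc c x - csc c y"
  by (rule cmat_eqI) (simp add: app_csc app_diff vec_eq_iff algebra_simps)

lemma csc_minus_right: "csc c (- x) = - csc c x"
  by (rule cmat_eqI) (simp add: app_csc app_minus vec_eq_iff)

lemma csc_of_real: "csc (complex_of_real r) x = r *\<^sub>R x"
  by (rule cmat_eqI) (simp add: app_csc app_scaleR vscale_real)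

lemma csc_0 [simp]: "csc 0 x = 0" "csc c 0 = 0"
  by (rule cmat_eqI, simp add: app_csc)+

lemma csc_1 [simp]: "csc 1 x = x"
  by (rule cmat_eqI) (simp add: app_csc)

lemma norm_vscale: "norm (c *s (v::complex^'n)) = cmod c * norm v"
  by (simp add: norm_vec_def norm_mult L2_set_right_distrib)

lemma norm_csc: "norm (csc c x) = cmod c * norm x"
proof -
  have "norm (csc c x) = onorm (\<lambda>v. cmod c *\<^sub>R app x v)"
    unfolding norm_cmat_def app_csc onorm_def by (simp add: norm_vscale)
  also have "\<dots> = cmod c * norm x"
    unfolding norm_cmat_def by (simp add: onorm_scaleR[OF bounded_linear_app])
  finally show ?thesis .
qed

section \<open>Adjoints and the Hermitian inner product\<close>

definition star :: "'n::finite cmat \<Rightarrow> 'n cmat" where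
  "star x = Cmat (\<chi> i j. cnj (mat_of x $ j $ i))"

definition cin :: "complex^'n \<Rightarrow> complex^'n \<Rightarrow> complex" where
  "cin u v = (\<Sum>i\<in>UNIV. u $ i * cnj (v $ i))"

lemma cin_app: "cin (app x u) v = cin u (app (star x) v)"
  unfolding cin_def app_expand star_def mat_of_Cmat
  by (simp add: sum_distrib_left sum_distrib_right mult_ac, subst sum.swap) simp

lemma cin_add_left: "cin (u + v) w = cin u w + cin v w"
  and cin_add_right: "cin w (u + v) = cin w u + cin w v"
  and cin_diff_left: "cin (u - v) w = cin u w - cin v w"
  and cin_diff_right: "cin w (u - v) = cin w u - cin w v"
  by (simp_all add: cin_def algebra_simps sum.distrib sum_subtractf)

lemma cin_vscale_left: "cin (c *s u) v = c * cin u v"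
  and cin_vscale_right: "cin u (c *s v) = cnj c * cin u v"
  by (simp_all add: cin_def sum_distrib_left mult_ac)

lemma cin_scaleR_left: "cin (r *\<^sub>R u) v = of_real r * cin u v"
  and cin_scaleR_right: "cin u (r *\<^sub>R v) = of_real r * cin u v"
  by (metis cin_vscale_left vscale_real, metis cin_vscale_right complex_cnj_complex_of_real vscale_real)

lemma cin_0 [simp]: "cin 0 v = 0" "cin v 0 = 0"
  by (simp_all add: cin_def)

lemma cin_commute: "cnj (cin u v) = cin v u"
  by (simp add: cin_def mult_ac)

lemma cin_self: "cin v v = of_real ((norm v)\<^sup>2)"
  unfolding cin_def norm_vec_def L2_set_def
  by (simp add: sum_nonneg complex_norm_square del: of_real_power)

lemma Re_cin: "Re (cin u v) = inner u v"
  by (simp add: cin_def inner_vec_def inner_complex_def)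

lemma cin_axis: "cin v (axis i 1) = v $ i"
  unfolding cin_def axis_def by (simp add: if_distrib if_distribR cong: if_cong)

lemma cin_ext: "(\<And>v. cin x v = cin y v) \<Longrightarrow> x = y"
  by (metis cin_axis vec_eq_iff)

lemma cin_ext_right: "(\<And>v. cin v x = cin v y) \<Longrightarrow> x = y"
  by (metis cin_ext cin_commute)

lemma cin_app_right: "cin u (app x v) = cin (app (star x) u) v"
  by (metis cin_app cin_commute)

lemma star_eqI: "(\<And>u v. cin (app x u) v = cin u (app y v)) \<Longrightarrow> star x = y"
  by (rule cmat_eqI, rule cin_ext_right) (simp add: cin_app[symmetric])

lemma star_star [simp]: "star (star x) = x"
  by (simp add: star_def)

lemma star_mult [simp]: "star (x * y) = star y * star x"
  by (rule star_eqI) (simp add: app_mult cin_app)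

lemma star_add [simp]: "star (x + y) = star x + star y"
  by (rule star_eqI) (simp add: app_add cin_add_left cin_add_right cin_app)

lemma star_diff [simp]: "star (x - y) = star x - star y"
  by (rule star_eqI) (simp add: app_diff cin_diff_left cin_diff_right cin_app)

lemma star_csc [simp]: "star (csc c x) = csc (cnj c) (star x)"
  by (rule star_eqI) (simp add: app_csc cin_vscale_left cin_vscale_right cin_app)

lemma star_scaleR [simp]: "star (r *\<^sub>R x) = r *\<^sub>R star x"
  by (metis csc_of_real complex_cnj_complex_of_real star_csc)

lemma star_0 [simp]: "star 0 = 0" and star_1 [simp]: "star 1 = 1"
  by (rule star_eqI, simp)+

lemma star_sum [simp]: "star (sum f I) = (\<Sum>i\<in>I. star (f i))"
  by (induction I rule: infinite_finite_induct) auto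

lemma star_power [simp]: "star (x ^ k) = star x ^ k"
  by (induction k) (simp_all add: power_commutes)

lemma norm_star_le: "norm (star x) \<le> norm x"
proof (rule norm_cmat_leI)
  fix v
  let ?w = "app (star x) v"
  have "(norm ?w)\<^sup>2 = Re (cin ?w ?w)" by (simp add: cin_self)
  also have "\<dots> = inner v (app x ?w)" by (metis Re_cin cin_app_right cin_commute complex_cnj Re_complex_of_real star_star cnj.simps(1))
  also have "\<dots> \<le> norm v * norm (app x ?w)" by (rule norm_cauchy_schwarz)
  also have "\<dots> \<le> norm v * (norm x * norm ?w)" by (intro mult_left_mono norm_app_le) simp
  finally have "norm ?w * norm ?w \<le> (norm x * norm v) * norm ?w"
    by (simp add: power2_eq_square mult_ac)
  then show "norm ?w \<le> norm x * norm v"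
    by (metis mult_right_le_imp_le norm_ge_zero zero_less_norm_iff norm_zero mult_nonneg_nonneg)
qed

lemma bounded_linear_star: "bounded_linear star"
  by (rule bounded_linear_intro[where K = 1]) (simp_all add: norm_star_le)

section \<open>Traces and the Frobenius norm\<close>

definition tr :: "'n::finite cmat \<Rightarrow> complex" where
  "tr x = (\<Sum>i\<in>UNIV. mat_of x $ i $ i)"

lemma tr_add: "tr (x + y) = tr x + tr y"
  and tr_diff: "tr (x - y) = tr x - tr y"
  and tr_csc: "tr (csc c x) = c * tr x"
  and tr_star: "tr (star x) = cnj (tr x)"
  by (simp_all add: tr_def plus_cmat_def minus_cmat_def csc_def cmat_scale_def scaleR_cmat_def star_def
      sum.distrib sum_subtractf sum_distrib_left)

lemma tr_scaleR: "tr (r *\<^sub>R x) = of_real r * tr x"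
  by (metis csc_of_real tr_csc)

lemma tr_0 [simp]: "tr 0 = 0"
  using tr_csc[of 0 0] by simp

lemma tr_sum: "tr (sum f I) = (\<Sum>i\<in>I. tr (f i))"
  by (induction I rule: infinite_finite_induct) (auto simp: tr_add)

lemma tr_commute: "tr (x * y) = tr (y * x)"
  unfolding tr_def times_cmat_def mat_of_Cmat matrix_matrix_mult_def
  by (simp, subst sum.swap) (simp add: mult_ac)

lemma tr_mult_star: "tr (x * star x) = of_real (\<Sum>i\<in>UNIV. \<Sum>j\<in>UNIV. (cmod (mat_of x $ i $ j))\<^sup>2)"
  unfolding tr_def times_cmat_def mat_of_Cmat matrix_matrix_mult_def star_def
  by (simp add: complex_norm_square del: of_real_power)

lemma tr_mult_star_nonneg: "Re (tr (x * star x)) \<ge> 0"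
  by (simp add: tr_mult_star sum_nonneg)

text \<open>The trace is the squared Frobenius norm of \<open>x\<close>. This is how trace
  identities become matrix identities later.\<close>

lemma tr_mult_star_eq_0: "Re (tr (x * star x)) = 0 \<Longrightarrow> x = 0"
  by (simp add: tr_mult_star sum_nonneg sum_nonneg_eq_0_iff mat_of_inject[symmetric] vec_eq_iff zero_cmat_def)

lemma mult_star_eq_0: "x * star x = 0 \<Longrightarrow> x = 0"
  by (rule tr_mult_star_eq_0) simp

section \<open>Hermitian linear algebra\<close>

lemma cmat_inverse_commute: "x * y = 1 \<Longrightarrow> y * x = (1::'n::finite cmat)"
  by (metis Cmat_mat_of mat_of_Cmat matrix_left_right_inverse one_cmat_def times_cmat_def)

lemma Cmat_of_linear:
  assumes "\<And>u v. f (u + v) = f u + f v" "\<And>c v. f (c *s v) = c *s f v"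
  obtains x where "\<And>v. app x v = f v"
proof -
  have "Vector_Spaces.linear (*s) (*s) f"
    using assms by unfold_locales auto
  then have "app (Cmat (matrix f)) v = f v" for v
    by (simp add: app_Cmat matrix_works)
  then show ?thesis using that by blast
qed

text \<open>The real inner product is only the real part of \<open>cin\<close>; testing against
  \<open>\<i> *s w\<close> recovers the imaginary part. So real orthogonality to a complex subspace
  is Hermitian orthogonality.\<close>

lemma cin_eq_0_of_inner:
  assumes "\<And>c. inner z (c *s w) = 0"
  shows "cin z w = 0"
proof -
  have "Re (cin z w) = 0" using assms[of 1] by (simp add: Re_cin)
  moreover have "Im (cin z w) = 0" using assms[of \<i>] by (simp add: Re_cin[symmetric] cin_vscale_right)
  ultimately show ?thesis by (simp add: complex_eq_iff)
qed

text \<open>The projection is chosen pointwise from a real orthogonal decomposition. Its complex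
  linearity comes from uniqueness of the decomposition, the kernel being closed under complex
  multiples.\<close>

lemma kernel_projection:
  fixes x :: "'n::finite cmat"
  obtains P where "star P = P" "P * P = P" "x * P = 0" "\<And>v. app x v = 0 \<Longrightarrow> app P v = v"
proof -
  define S where "S = {v. app x v = 0}"
  have sub: "subspace S"
    by (auto simp: S_def subspace_def app_add_right app_scaleR_right)
  have Sc: "c *s v \<in> S" if "v \<in> S" for c v
    using that by (simp add: S_def app_vscale)
  have Sadd: "u + v \<in> S" if "u \<in> S" "v \<in> S" for u v
    using that by (simp add: S_def app_add_right)
  have Sdiff: "u - v \<in> S" if "u \<in> S" "v \<in> S" for u v
    using that by (simp add: S_def app_diff_right)
  have "\<exists>y\<in>S. \<forall>w\<in>S. cin (v - y) w = 0" for v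
  proof -
    obtain y z where yz: "y \<in> span S" "\<And>w. w \<in> span S \<Longrightarrow> orthogonal z w" "v = y + z"
      using orthogonal_subspace_decomp_exists by blast
    have sp: "span S = S" using sub by (simp add: span_eq_iff)
    have "cin z w = 0" if "w \<in> S" for w
      by (rule cin_eq_0_of_inner) (use yz(2) Sc[OF that] sp in \<open>simp add: orthogonal_def\<close>)
    then show ?thesis using yz sp by (intro bexI[of _ y]) auto
  qed
  then obtain p where p: "\<And>v. p v \<in> S" "\<And>v w. w \<in> S \<Longrightarrow> cin (v - p v) w = 0"
    by metis
  have uniq: "p v = y" if "y \<in> S" "\<And>w. w \<in> S \<Longrightarrow> cin (v - y) w = 0" for v y
  proof -
    have "p v - y \<in> S" using p that Sdiff by blast
    moreover have "cin (p v - y) w = 0" if "w \<in> S" for w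
      using p(2)[OF that, of v] \<open>\<And>w. w \<in> S \<Longrightarrow> cin (v - y) w = 0\<close>[OF that] by (simp add: cin_diff_left)
    ultimately have "cin (p v - y) (p v - y) = 0" by blast
    then show ?thesis by (simp add: cin_self)
  qed
  have padd: "p (u + v) = p u + p v" for u v
  proof (rule uniq)
    show "p u + p v \<in> S" using p Sadd by blast
    show "cin (u + v - (p u + p v)) w = 0" if "w \<in> S" for w
      using p(2)[OF that, of u] p(2)[OF that, of v] by (simp add: cin_diff_left cin_add_left)
  qed
  have psc: "p (c *s v) = c *s p v" for c v
  proof (rule uniq)
    show "c *s p v \<in> S" using p Sc by blast
    show "cin (c *s v - c *s p v) w = 0" if "w \<in> S" for w
      using p(2)[OF that, of v] by (simp add: cin_diff_left cin_vscale_left)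
  qed
  obtain P where P: "\<And>v. app P v = p v"
    using Cmat_of_linear[of p] padd psc by blast
  have pid: "p v = v" if "v \<in> S" for v
    using that by (intro uniq) auto
  have "star P = P"
  proof (rule star_eqI)
    fix u v
    have "cin (p u) v = cin (p u) (p v)"
      using p(2)[OF p(1)[of u], of v] by (metis cin_commute cin_diff_right complex_cnj_zero eq_iff_diff_eq_0)
    moreover have "cin u (p v) = cin (p u) (p v)"
      using p(2)[OF p(1)[of v], of u] by (simp add: cin_diff_left)
    ultimately show "cin (app P u) v = cin u (app P v)" by (simp add: P)
  qed
  moreover have "P * P = P"
    by (rule cmat_eqI) (simp add: app_mult P pid p)
  moreover have "x * P = 0"
    by (rule cmat_eqI) (use p(1) in \<open>simp add: app_mult P S_def\<close>)
  ultimately show ?thesis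
    using that[of P] P pid by (simp add: S_def)
qed

lemma kernel_projection_mult:
  assumes "\<And>v. app x v = 0 \<Longrightarrow> app P v = v" "x * y = 0"
  shows "P * y = y"
proof (rule cmat_eqI)
  fix v
  have "app x (app y v) = 0" using assms(2) by (metis app_0 app_mult)
  then show "app (P * y) v = app y v" using assms(1) by (simp add: app_mult)
qed

section \<open>Quadratic forms, positivity and square roots\<close>

definition qf :: "'n::finite cmat \<Rightarrow> complex^'n \<Rightarrow> real" where
  "qf g v = Re (cin (app g v) v)"

lemma qf_simps: "qf (x + y) v = qf x v + qf y v" "qf (x - y) v = qf x v - qf y v"
  "qf (- x) v = - qf x v" "qf (r *\<^sub>R x) v = r * qf x v" "qf 1 v = (norm v)\<^sup>2" "qf x (r *\<^sub>R v) = r\<^sup>2 * qf x v"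
proof -
  show "qf (x + y) v = qf x v + qf y v" "qf (x - y) v = qf x v - qf y v"
    "qf (r *\<^sub>R x) v = r * qf x v" "qf 1 v = (norm v)\<^sup>2" "qf x (r *\<^sub>R v) = r\<^sup>2 * qf x v"
    by (simp_all add: qf_def app_add app_diff cin_add_left cin_diff_left app_scaleR app_scaleR_right
        cin_scaleR_left cin_scaleR_right cin_self power2_eq_square)
  show "qf (- x) v = - qf x v"
    by (simp add: qf_def app_minus cin_def sum_negf)
qed

lemma qf_le_norm: "qf g v \<le> norm g * (norm v)\<^sup>2"
proof -
  have "qf g v \<le> norm (app g v) * norm v"
    unfolding qf_def Re_cin by (rule norm_cauchy_schwarz)
  also have "\<dots> \<le> norm g * norm v * norm v"
    by (intro mult_right_mono norm_app_le) simp
  finally show ?thesis by (simp add: power2_eq_square mult_ac)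
qed

lemma qf_minimum:
  fixes g :: "'n::finite cmat"
  obtains v where "norm v = 1" "\<And>w. qf g w \<ge> qf g v * (norm w)\<^sup>2"
proof -
  have "compact (sphere (0::complex^'n) 1)" by simp
  moreover have "sphere (0::complex^'n) 1 \<noteq> {}"
    by simp
  moreover have "continuous_on (sphere (0::complex^'n) 1) (qf g)"
    unfolding qf_def Re_cin
    by (intro continuous_intros linear_continuous_on bounded_linear_app)
  ultimately obtain v where v: "v \<in> sphere 0 1" "\<And>w. w \<in> sphere 0 1 \<Longrightarrow> qf g v \<le> qf g w"
    by (metis continuous_attains_inf)
  have "qf g v * (norm w)\<^sup>2 \<le> qf g w" for w
  proof (cases "w = 0")
    case False
    have "qf g v \<le> qf g (inverse (norm w) *\<^sub>R w)"
      using False by (intro v) simp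
    then show ?thesis
      using False by (simp add: qf_simps power_inverse field_simps)
  qed (simp add: qf_def)
  then show ?thesis using that v(1) by simp
qed

text \<open>If the form vanishes at \<open>x\<close>, moving slightly in the direction
  \<open>- app g x\<close> makes it negative to first order unless \<open>app g x = 0\<close>. The
  invariant real subspace \<open>W\<close> makes the lemma usable for finding eigenvectors inside
  invariant subspaces.\<close>

lemma qf_psd_null_on:
  assumes h: "star g = g" and W: "subspace W" "\<And>v. v \<in> W \<Longrightarrow> app g v \<in> W"
    and psd: "\<And>v. v \<in> W \<Longrightarrow> qf g v \<ge> 0" and x: "x \<in> W" "qf g x = 0"
  shows "app g x = 0"
proof (rule ccontr)
  assume n: "app g x \<noteq> 0"
  define w where "w = app g x"
  \<comment> \<open>The \<open>+ 1\<close> keeps the denominator positive when the form also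
    vanishes at \<open>w\<close>.\<close>
  define t where "t = (norm w)\<^sup>2 / (qf g w + 1)"
  have wW: "w \<in> W" unfolding w_def by (rule W(2)[OF x(1)])
  have K: "qf g w + 1 > 0" using psd[OF wW] by linarith
  have wpos: "(norm w)\<^sup>2 > 0" using n by (simp add: w_def)
  have t: "t > 0" using wpos K by (simp add: t_def)
  have "cin (app g w) x = cin w w" by (simp add: cin_app h w_def)
  then have "qf g (x - t *\<^sub>R w) = qf g x - 2 * t * (norm w)\<^sup>2 + t\<^sup>2 * qf g w"
    unfolding qf_def app_diff_right app_scaleR_right cin_diff_left cin_diff_right cin_scaleR_left cin_scaleR_right
    by (simp add: w_def[symmetric] cin_self power2_eq_square algebra_simps)
  moreover have "x - t *\<^sub>R w \<in> W" using x(1) wW W(1) by (intro subspace_diff subspace_scale)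
  ultimately have "0 \<le> t * (t * qf g w - 2 * (norm w)\<^sup>2)"
    using psd[of "x - t *\<^sub>R w"] x(2) by (simp add: power2_eq_square algebra_simps)
  then have "2 * (norm w)\<^sup>2 \<le> t * qf g w"
    using t by (simp add: zero_le_mult_iff)
  also have "\<dots> \<le> t * (qf g w + 1)" using t by simp
  also have "\<dots> = (norm w)\<^sup>2" using K by (simp add: t_def)
  finally show False using wpos by simp
qed

lemma qf_psd_null:
  assumes "star g = g" "\<And>v. qf g v \<ge> 0" "qf g x = 0"
  shows "app g x = 0"
  using qf_psd_null_on[OF assms(1) subspace_UNIV] assms(2,3) by blast

text \<open>Nonnegativity at the single vector \<open>v - app x v / r\<close> already bounds the
  squared length of \<open>app x v\<close> by \<open>r\<^sup>2\<close> times that of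
  \<open>v\<close>.\<close>

lemma norm_psd_le:
  assumes h: "star x = x" and psd: "\<And>v. qf x v \<ge> 0" and le: "\<And>v. qf x v \<le> r * (norm v)\<^sup>2" and r: "r > 0"
  shows "norm x \<le> r"
proof (rule norm_cmat_leI)
  fix v
  define w where "w = app x v"
  have "cin (app x w) v = cin w w" by (simp add: cin_app h w_def)
  then have "qf x (v - t *\<^sub>R w) = qf x v - 2 * t * (norm w)\<^sup>2 + t\<^sup>2 * qf x w" for t
    unfolding qf_def app_diff_right app_scaleR_right cin_diff_left cin_diff_right cin_scaleR_left cin_scaleR_right
    by (simp add: w_def[symmetric] cin_self power2_eq_square algebra_simps)
  then have "qf x (v - inverse r *\<^sub>R w) = qf x v - 2 * inverse r * (norm w)\<^sup>2 + (inverse r)\<^sup>2 * qf x w" .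
  also have "\<dots> \<le> r * (norm v)\<^sup>2 - 2 * inverse r * (norm w)\<^sup>2 + (inverse r)\<^sup>2 * (r * (norm w)\<^sup>2)"
    using le[of v] le[of w] r by (intro add_mono diff_mono mult_left_mono) auto
  also have "\<dots> = r * (norm v)\<^sup>2 - inverse r * (norm w)\<^sup>2"
    using r by (simp add: power2_eq_square field_simps)
  finally have "0 \<le> r * (norm v)\<^sup>2 - inverse r * (norm w)\<^sup>2"
    using psd[of "v - inverse r *\<^sub>R w"] by linarith
  then have "(norm w)\<^sup>2 \<le> (r * norm v)\<^sup>2"
    using r by (simp add: power_mult_distrib power2_eq_square field_simps)
  then show "norm (app x v) \<le> r * norm v"
    unfolding w_def using r by (simp add: power2_le_iff_abs_le)
qed

text \<open>The root is \<open>1 - y\<close> for the fixed point \<open>y\<close> of \<open>y \<mapsto> (x + y\<^sup>2) / 2\<close>, where \<open>p\<close> is scaled to \<open>1 - x\<close> with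
  \<open>\<parallel>x\<parallel> < 1\<close>; the iteration stays in the bicommutant of \<open>p\<close>.\<close>

lemma positive_sqrt:
  fixes p :: "'n::finite cmat"
  assumes h: "star p = p" and pos: "\<And>v. v \<noteq> 0 \<Longrightarrow> qf p v > 0"
  obtains R S where "star R = R" "R * R = p" "R * S = 1" "S * R = 1" "\<And>x. x * p = p * x \<Longrightarrow> x * R = R * x"
proof -
  obtain v0 where v0: "norm v0 = 1" "\<And>w. qf p w \<ge> qf p v0 * (norm w)\<^sup>2"
    using qf_minimum[of p] by blast
  define m where "m = qf p v0"
  have m: "m > 0" unfolding m_def by (rule pos) (use v0 in auto)
  define b where "b = norm p"
  have mb: "m \<le> b" using qf_le_norm[of p v0] v0 by (simp add: m_def b_def)
  then have b: "b > 0" using m by simp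
  define x where "x = 1 - (1 / b) *\<^sub>R p"
  \<comment> \<open>The factor 2 keeps \<open>r\<close> positive when \<open>p\<close> is a multiple
    of the identity, where \<open>m = b\<close>.\<close>
  define r where "r = 1 - m / (2 * b)"
  have r: "0 < r" "r < 1" using m mb b by (auto simp: r_def field_simps)
  have xs: "star x = x" by (simp add: x_def h)
  have "norm x \<le> r"
  proof (rule norm_psd_le[OF xs _ _ r(1)])
    fix v
    have "qf p v \<le> b * (norm v)\<^sup>2" unfolding b_def by (rule qf_le_norm)
    then show "0 \<le> qf x v" using b by (simp add: x_def qf_simps field_simps)
    have "m * (norm v)\<^sup>2 \<le> qf p v" using v0(2) by (simp add: m_def)
    then have "m * (norm v)\<^sup>2 / 2 \<le> qf p v"
      using pos[of v] by (cases "v = 0") (auto simp: qf_def)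
    then show "qf x v \<le> r * (norm v)\<^sup>2"
      using b by (simp add: x_def r_def qf_simps field_simps)
  qed
  define Y where "Y = {y. norm y \<le> r} \<inter> {y. star y = y} \<inter> (\<Inter>z\<in>{z. z * p = p * z}. {y. z * y = y * z})"
  define f where "f y = (1/2) *\<^sub>R (x + y * y)" for y
  have "closed Y"
    unfolding Y_def
    by (intro closed_Int closed_INT ballI closed_Collect_le closed_Collect_eq continuous_intros
        linear_continuous_on bounded_linear_star)
  then have "complete Y" by (simp add: complete_eq_closed)
  moreover have "0 \<in> Y" using r by (simp add: Y_def)
  then have "Y \<noteq> {}" by blast
  moreover have "f ` Y \<subseteq> Y"
  proof clarify
    fix y assume y: "y \<in> Y"
    have ny: "norm y \<le> r" and sy: "star y = y" using y by (simp_all add: Y_def)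
    have "norm (x + y * y) \<le> r + r * r"
      by (intro norm_triangle_mono order_trans[OF norm_mult_ineq] mult_mono \<open>norm x \<le> r\<close> ny) (use r in auto)
    also have "\<dots> \<le> r + 1 * r" using r by (intro add_left_mono mult_right_mono) auto
    finally have "norm (f y) \<le> r" by (simp add: f_def)
    moreover have "star (f y) = f y" by (simp add: f_def sy xs)
    moreover have "z * f y = f y * z" if "z * p = p * z" for z
    proof -
      have "z * y = y * z" using y that by (auto simp: Y_def)
      then have "z * (y * y) = y * y * z" by (metis mult.assoc)
      moreover have "z * x = x * z" using that by (simp add: x_def algebra_simps)
      ultimately show ?thesis by (simp add: f_def algebra_simps)
    qed
    ultimately show "f y \<in> Y" by (simp add: Y_def)
  qed
  moreover have "dist (f y) (f z) \<le> r * dist y z" if "y \<in> Y" "z \<in> Y" for y z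
  proof -
    have "f y - f z = (1/2) *\<^sub>R (y * (y - z) + (y - z) * z)"
      by (simp add: f_def algebra_simps)
    moreover have "norm (y * (y - z) + (y - z) * z) \<le> r * norm (y - z) + norm (y - z) * r"
      using that r by (intro norm_triangle_mono order_trans[OF norm_mult_ineq] mult_mono) (auto simp: Y_def)
    ultimately show ?thesis by (simp add: dist_norm)
  qed
  ultimately have "\<exists>!y. y \<in> Y \<and> f y = y"
    using r by (intro Banach_fix[of Y r f]) auto
  then obtain y where y: "y \<in> Y" "f y = y" by blast
  have yy: "y * y = 2 *\<^sub>R y - x"
    using arg_cong[OF y(2), of "\<lambda>u. 2 *\<^sub>R u"] by (simp add: f_def algebra_simps)
  have "(1 - y) * (1 - y) = (1 / b) *\<^sub>R p"
    by (simp add: right_diff_distrib left_diff_distrib yy x_def scaleR_2)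
  then have RR: "(sqrt b *\<^sub>R (1 - y)) * (sqrt b *\<^sub>R (1 - y)) = p"
    using b by simp
  let ?R = "sqrt b *\<^sub>R (1 - y)"
  have inj: "v = 0" if "app ?R v = 0" for v
  proof -
    have "app p v = 0" using that by (metis RR app_0_right app_mult)
    then show ?thesis using pos[of v] by (force simp: qf_def)
  qed
  have "inj ((*v) (mat_of ?R))"
  proof (rule injI)
    fix u v assume "mat_of ?R *v u = mat_of ?R *v v"
    then have "app ?R (u - v) = 0" by (simp add: app_diff_right) (simp add: app_def)
    then show "u = v" using inj by force
  qed
  then obtain M where "M ** mat_of ?R = mat 1"
    using matrix_left_invertible_injective by blast
  then have "Cmat M * ?R = 1" by (simp add: times_cmat_def one_cmat_def)
  moreover from this have "?R * Cmat M = 1" by (rule cmat_inverse_commute)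
  moreover have "star ?R = ?R" using y(1) by (simp add: Y_def)
  moreover have "z * ?R = ?R * z" if "z * p = p * z" for z
  proof -
    have "z * y = y * z" using y(1) that by (auto simp: Y_def)
    then show ?thesis by (simp add: right_diff_distrib left_diff_distrib)
  qed
  ultimately show ?thesis using that[of ?R "Cmat M"] RR by blast
qed

section \<open>The soliton equation\<close>

text \<open>Pair the soliton equation with the commutator \<open>k\<close> of \<open>a\<close> and
  \<open>star a\<close>. The identity term drops out since \<open>tr k = 0\<close>; cyclicity moves
  the commutator from \<open>k\<close> to \<open>E\<close>, where it becomes \<open>d\<close>; and
  \<open>tr (k * k)\<close> is twice the pairing of \<open>k\<close> with
  \<open>a * star a\<close>.\<close>

lemma soliton_trace:
  fixes a E :: "'n::finite cmat"
  assumes eq: "a * star a = E + star E - (2 * Re d) *\<^sub>R 1" and comm: "E * a - a * E = csc d a"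
  shows "tr ((a * star a - star a * a) * star (a * star a - star a * a)) = of_real (4 * Re d) * tr (a * star a)"
proof -
  define b where "b = star a"
  define k where "k = a * b - b * a"
  have real: "cnj (tr (a * b)) = tr (a * b)"
    using tr_star[of "a * b"] by (simp add: b_def)
  have "tr (E * k) = tr ((E * a - a * E) * b)"
  proof -
    have "tr (E * (b * a)) = tr (a * E * b)" by (metis mult.assoc tr_commute)
    then show ?thesis by (simp add: k_def right_diff_distrib left_diff_distrib tr_diff mult.assoc)
  qed
  then have 1: "tr (E * k) = d * tr (a * b)" by (simp add: comm tr_csc)
  have "star (E * k) = k * star E" by (simp add: k_def b_def)
  then have "tr (k * star E) = cnj d * tr (a * b)"
    using 1 real by (metis complex_cnj_mult tr_star)
  then have "tr (star E * k) = cnj d * tr (a * b)" by (simp add: tr_commute)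
  with 1 have "tr ((E + star E) * k) = (d + cnj d) * tr (a * b)"
    by (simp add: distrib_right tr_add)
  then have "tr ((E + star E) * k) = of_real (2 * Re d) * tr (a * b)"
    by (simp only: complex_add_cnj)
  moreover have "E + star E = a * b + (2 * Re d) *\<^sub>R 1" using eq by (simp add: b_def)
  moreover have "tr k = 0" by (simp add: k_def tr_diff tr_commute)
  ultimately have "tr (a * b * k) = of_real (2 * Re d) * tr (a * b)"
    by (simp add: distrib_right tr_add tr_scaleR)
  moreover have "tr (k * k) = 2 * tr (a * b * k)"
  proof -
    have "tr (b * a * (b * a)) = tr (a * b * (a * b))" by (metis mult.assoc tr_commute)
    moreover have "tr (b * a * (a * b)) = tr (a * b * (b * a))" by (rule tr_commute)
    ultimately show ?thesis by (simp add: k_def algebra_simps tr_diff tr_add)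
  qed
  moreover have "star k = k" by (simp add: k_def b_def)
  ultimately show ?thesis by (simp add: k_def b_def)
qed

lemma commutator_power:
  assumes "E * a - a * E = csc d a"
  shows "E * a ^ k = a ^ k * E + csc (of_nat k * d) (a ^ k)"
proof (induction k)
  case (Suc k)
  have "E * a = a * E + csc d a" using assms by (simp add: algebra_simps)
  then have "E * a ^ Suc k = a * (E * a ^ k) + csc d (a ^ Suc k)"
    by (simp add: mult.assoc[symmetric] distrib_right)
  also have "\<dots> = a ^ Suc k * E + csc (of_nat (Suc k) * d) (a ^ Suc k)"
    unfolding Suc by (simp add: algebra_simps csc_add_left)
  finally show ?case .
qed simp

text \<open>The powers of \<open>a\<close> are eigenvectors of the bounded operator \<open>ad E\<close> with unbounded eigenvalues, so some
  power vanishes.\<close>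

lemma commutator_imp_nilpotent:
  fixes a :: "'n::finite cmat"
  assumes "E * a - a * E = csc d a" "d \<noteq> 0"
  shows "\<exists>k. a ^ k = 0"
proof -
  obtain k :: nat where k: "of_nat k * cmod d > 2 * norm E"
    using assms(2) by (metis ex_less_of_nat_mult zero_less_norm_iff)
  have "csc (of_nat k * d) (a ^ k) = E * a ^ k - a ^ k * E"
    using commutator_power[OF assms(1), of k] by simp
  then have "cmod (of_nat k * d) * norm (a ^ k) = norm (E * a ^ k - a ^ k * E)"
    by (metis norm_csc)
  also have "\<dots> \<le> norm E * norm (a ^ k) + norm (a ^ k) * norm E"
    by (intro order_trans[OF norm_triangle_ineq4] add_mono norm_mult_ineq)
  finally have "(of_nat k * cmod d) * norm (a ^ k) \<le> (2 * norm E) * norm (a ^ k)"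
    by (simp add: norm_mult)
  then have "a ^ k = 0"
    using k by (cases "a ^ k = 0") auto
  then show ?thesis by blast
qed

lemma soliton_normal_or_nilpotent:
  fixes a E :: "'n::finite cmat"
  assumes eq: "a * star a = E + star E - (2 * Re d) *\<^sub>R 1" and comm: "E * a - a * E = csc d a"
  shows "a * star a = star a * a \<or> Re d > 0 \<and> (\<exists>k. a ^ k = 0)"
proof (cases "a * star a = star a * a")
  case False
  define k where "k = a * star a - star a * a"
  have "k \<noteq> 0" using False by (simp add: k_def)
  then have "Re (tr (k * star k)) > 0"
    using tr_mult_star_eq_0[of k] tr_mult_star_nonneg[of k] by linarith
  then have "Re d * Re (tr (a * star a)) > 0"
    using arg_cong[OF soliton_trace[OF assms], of Re] by (simp add: k_def)
  then have "Re d > 0"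
    using tr_mult_star_nonneg[of a] by (simp add: zero_less_mult_iff)
  moreover from this have "d \<noteq> 0" by auto
  ultimately show ?thesis using commutator_imp_nilpotent[OF comm] by blast
qed simp

section \<open>Nilpotent solitons\<close>

text \<open>The grading \<open>e 0, \<dots>, e (m - 1)\<close> consists of the spectral projections of \<open>a a\<^sup>*\<close>.\<close>

definition graded :: "real \<Rightarrow> nat \<Rightarrow> 'n::finite cmat \<Rightarrow> (nat \<Rightarrow> 'n cmat) \<Rightarrow> bool" where
  "graded \<kappa> m a e \<longleftrightarrow> \<kappa> > 0 \<and> a ^ m = 0 \<and> (\<forall>j. star (e j) = e j) \<and> (\<forall>i j. e i * e j = (if i = j then e i else 0)) \<and>
     (\<forall>j\<ge>m. e j = 0) \<and> (\<Sum>j<m. e j) = 1 \<and> (\<forall>j. a * star a * e j = (\<kappa> * real j) *\<^sub>R e j) \<and>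
     (\<forall>j. \<exists>y. e j = a ^ j * y) \<and> a * star a * a - a * (a * star a) = \<kappa> *\<^sub>R a"

lemma graded_scale:
  assumes "graded \<kappa> m a e" "t > 0"
  shows "graded (t\<^sup>2 * \<kappa>) m (t *\<^sub>R a) e"
proof -
  have "\<exists>y. e j = (t *\<^sub>R a) ^ j * y" for j
  proof -
    obtain y where "e j = a ^ j * y" using assms unfolding graded_def by blast
    then have "e j = (t *\<^sub>R a) ^ j * ((1 / t ^ j) *\<^sub>R y)" using assms(2) by (simp add: scaleR_power)
    then show ?thesis by blast
  qed
  moreover have "(t *\<^sub>R a) * star (t *\<^sub>R a) * e j = (t\<^sup>2 * \<kappa> * real j) *\<^sub>R e j" for j
    using assms by (simp add: graded_def power2_eq_square mult.assoc)
  moreover have "(t *\<^sub>R a) * star (t *\<^sub>R a) * (t *\<^sub>R a) - (t *\<^sub>R a) * ((t *\<^sub>R a) * star (t *\<^sub>R a)) = (t\<^sup>2 * \<kappa>) *\<^sub>R (t *\<^sub>R a)"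
  proof -
    have "(t *\<^sub>R a) * star (t *\<^sub>R a) * (t *\<^sub>R a) - (t *\<^sub>R a) * ((t *\<^sub>R a) * star (t *\<^sub>R a))
      = (t * t * t) *\<^sub>R (a * star a * a - a * (a * star a))"
      by (simp add: algebra_simps)
    then show ?thesis using assms by (simp add: graded_def power2_eq_square mult_ac)
  qed
  ultimately show ?thesis using assms unfolding graded_def by (simp add: scaleR_power)
qed

text \<open>The equation \<open>E X + X E\<^sup>* = \<kappa> X + a X a\<^sup>*\<close> is the soliton equation for the inverse metric \<open>X\<close>; it is linear.
  If \<open>X \<ge> 0\<close> solves it, then \<open>a\<^sup>*\<close> preserves the null space of \<open>X\<close>, so that null space meets \<open>ker a\<^sup>*\<close>.\<close>

lemma inverse_metric_definite:
  fixes a E P X :: "'n::finite cmat"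
  assumes nil: "a ^ m = 0" and Ps: "star P = P" and Pker: "\<And>v. app (star a) v = 0 \<Longrightarrow> app P v = v"
    and X: "star X = X" "\<And>v. qf X v \<ge> 0" "E * X + X * star E = \<kappa> *\<^sub>R X + a * X * star a"
    and PX: "P * X * P = \<epsilon> *\<^sub>R P" "\<epsilon> > 0" and x: "qf X x = 0"
  shows "x = 0"
proof (rule ccontr)
  assume "x \<noteq> 0"
  define b where "b = star a"
  have step: "app X (app b x) = 0" if "app X x = 0" for x
  proof -
    have "cin (app (E * X + X * star E) x) x = 0"
      using that X(1) by (simp add: app_add app_mult cin_add_left cin_app)
    moreover have "cin (app (\<kappa> *\<^sub>R X + a * X * b) x) x = cin (app X (app b x)) (app b x)"
      using that by (simp add: app_add app_mult app_scaleR cin_app[of a] b_def)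
    ultimately have "qf X (app b x) = 0"
      using X(3) by (simp add: qf_def b_def)
    then show ?thesis by (rule qf_psd_null[OF X(1,2)])
  qed
  have all: "app X (app (b ^ k) x) = 0" for k
    by (induction k) (use qf_psd_null[OF X(1,2) x] step in \<open>auto simp: app_mult\<close>)
  have "b ^ m = 0" using nil by (metis b_def star_0 star_power)
  then have "app (b ^ m) x = 0" by simp
  then have "\<exists>k. app (b ^ Suc k) x = 0 \<and> app (b ^ k) x \<noteq> 0"
  proof (induction m)
    case (Suc m)
    then show ?case by (cases "app (b ^ m) x = 0") auto
  qed (use \<open>x \<noteq> 0\<close> in simp)
  then obtain k where k: "app (b ^ Suc k) x = 0" "app (b ^ k) x \<noteq> 0"
    by blast
  define y where "y = app (b ^ k) x"
  have "app P y = y" using k by (intro Pker) (simp add: y_def b_def app_mult)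
  then have "cin (app X y) y = cin (app (P * X * P) y) y"
    by (simp add: app_mult cin_app[of P] Ps)
  also have "\<dots> = \<epsilon> * cin y y" by (simp add: PX app_scaleR cin_scaleR_left \<open>app P y = y\<close>)
  finally have "cin y y = 0" using all[of k] PX(2) by (simp add: y_def)
  then show False using k(2) by (simp add: cin_self y_def)
qed

text \<open>The candidate \<open>G\<close> and the identity solve the same linear equation and have
  the same compression to the kernel of \<open>star a\<close>, so they agree by comparison of
  extremal values. The summands \<open>g j\<close> of \<open>G = 1\<close> are at first only known
  to be Hermitian; a trace computation makes them eigenprojections of
  \<open>C = a * star a\<close>.\<close>

lemma nilpotent_soliton_graded:
  fixes a E :: "'n::finite cmat"
  assumes eq: "a * star a = E + star E - (2 * Re d) *\<^sub>R 1" and comm: "E * a - a * E = csc d a"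
    and dpos: "Re d > 0" and nil: "a ^ m = 0"
  obtains e where "graded (2 * Re d) m a e"
proof -
  define b where "b = star a"
  define \<kappa> where "\<kappa> = 2 * Re d"
  have \<kappa>: "\<kappa> > 0" using dpos by (simp add: \<kappa>_def)
  define C where "C = a * b"
  have Cs: "star C = C" by (simp add: C_def b_def)
  have EE: "E + star E = C + \<kappa> *\<^sub>R 1" using eq by (simp add: C_def b_def \<kappa>_def)
  obtain P where P: "star P = P" "P * P = P" "b * P = 0" "\<And>v. app b v = 0 \<Longrightarrow> app P v = v"
    using kernel_projection[of b] by blast
  have PP: "P * y = y" if "b * y = 0" for y using kernel_projection_mult[OF P(4) that] .
  have Pa: "P * a = 0" using arg_cong[OF P(3), of star] P(1) by (simp add: b_def)
  have starcomm: "b * star E = star E * b + csc (cnj d) b"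
    using arg_cong[OF comm, of star] by (simp add: b_def algebra_simps)
  \<comment> \<open>The commutator relation shows that \<open>star E\<close> preserves the kernel of
    \<open>b\<close>. On this kernel \<open>E + star E\<close> is \<open>\<kappa>\<close>, so
    \<open>E\<close> preserves it too, and both commute with \<open>P\<close>.\<close>
  have "b * (star E * P) = 0"
    by (simp add: mult.assoc[symmetric] starcomm distrib_right) (simp add: mult.assoc P(3))
  then have 1: "P * (star E * P) = star E * P" by (rule PP)
  have 2: "P * E * P = P * E" using arg_cong[OF 1, of star] P(1) by (simp add: mult.assoc)
  have CP: "C * P = 0" by (simp add: C_def mult.assoc P(3))
  have EEP: "E * P + star E * P = \<kappa> *\<^sub>R P"
    using arg_cong[OF EE, of "\<lambda>u. u * P"] CP by (simp add: distrib_right)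
  then have "E * P = \<kappa> *\<^sub>R P - star E * P" by (simp add: algebra_simps)
  then have "b * (E * P) = 0" using \<open>b * (star E * P) = 0\<close> P(3) by (simp add: right_diff_distrib)
  then have "P * (E * P) = E * P" by (rule PP)
  then have EP: "E * P = P * E" using 2 by (simp add: mult.assoc)
  have EsP: "star E * P = P * star E" using arg_cong[OF EP, of star] P(1) by simp
  have m: "m > 0" using nil by (cases m) auto
  \<comment> \<open>With these coefficients \<open>a * g j * b\<close> is
    \<open>\<kappa> * Suc j\<close> times \<open>g (Suc j)\<close>, which matches the eigenvalues
    found in \<open>L1\<close>, so that the sum \<open>G\<close> solves the equation of the inverse
    metric.\<close>
  define g where "g j = (1 / (\<kappa> ^ j * fact j)) *\<^sub>R (a ^ j * P * b ^ j)" for j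
  have gs: "star (g j) = g j" for j by (simp add: g_def b_def P(1) mult.assoc)
  have gz: "g j = 0" if "j \<ge> m" for j
  proof -
    have "a ^ j = 0" using that nil by (metis le_add_diff_inverse mult_zero_left power_add)
    then show ?thesis by (simp add: g_def)
  qed
  have L1: "E * g j + g j * star E = (\<kappa> * (real j + 1)) *\<^sub>R g j" for j
  proof -
    have s: "b ^ j * star E = star E * b ^ j + csc (of_nat j * cnj d) (b ^ j)"
      using arg_cong[OF commutator_power[OF comm, of j], of star] by (simp add: b_def)
    have "E * (a ^ j * P * b ^ j) + a ^ j * P * b ^ j * star E
       = E * a ^ j * P * b ^ j + a ^ j * P * (b ^ j * star E)"
      by (simp add: mult.assoc)
    also have "\<dots> = a ^ j * (E * P + star E * P) * b ^ j + csc (of_nat j * d + of_nat j * cnj d) (a ^ j * P * b ^ j)"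
      unfolding s commutator_power[OF comm] EsP
      by (simp add: algebra_simps csc_add_left)
    also have "of_nat j * d + of_nat j * cnj d = complex_of_real (\<kappa> * real j)"
      by (simp add: \<kappa>_def complex_eq_iff)
    also have "a ^ j * (E * P + star E * P) * b ^ j + csc (complex_of_real (\<kappa> * real j)) (a ^ j * P * b ^ j)
      = (\<kappa> * (real j + 1)) *\<^sub>R (a ^ j * P * b ^ j)"
      unfolding csc_of_real EEP by (simp add: algebra_simps)
    finally have "E * (a ^ j * P * b ^ j) + a ^ j * P * b ^ j * star E = (\<kappa> * (real j + 1)) *\<^sub>R (a ^ j * P * b ^ j)" .
    from arg_cong[OF this, of "\<lambda>u. (1 / (\<kappa> ^ j * fact j)) *\<^sub>R u"] show ?thesis
      unfolding g_def by (simp add: scaleR_add_right)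
  qed
  have agb: "a * g j * b = (\<kappa> * real (Suc j)) *\<^sub>R g (Suc j)" for j
  proof -
    have "a * (a ^ j * P * b ^ j) * b = a ^ Suc j * P * b ^ Suc j"
      by (simp add: mult.assoc power_commutes)
    moreover have "1 / (\<kappa> ^ j * fact j) = (\<kappa> * real (Suc j)) * (1 / (\<kappa> ^ Suc j * fact (Suc j)))"
      using \<kappa> by (simp add: field_simps del: of_nat_Suc)
    ultimately show ?thesis unfolding g_def by (simp del: of_nat_Suc power_Suc fact_Suc)
  qed
  define G where "G = (\<Sum>j<m. g j)"
  have aGb: "a * G * b = (\<Sum>j<m. (\<kappa> * real j) *\<^sub>R g j)"
  proof -
    have "a * G * b = (\<Sum>j<m. (\<kappa> * real (Suc j)) *\<^sub>R g (Suc j))"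
      by (simp add: G_def sum_distrib_left sum_distrib_right agb del: of_nat_Suc)
    also have "\<dots> = (\<Sum>j<Suc m. (\<kappa> * real j) *\<^sub>R g j)"
      by (subst sum.lessThan_Suc_shift) simp
    finally show ?thesis by (simp add: gz)
  qed
  have LG: "E * G + G * star E = \<kappa> *\<^sub>R G + a * G * star a"
  proof -
    have "E * G + G * star E = (\<Sum>j<m. (\<kappa> * (real j + 1)) *\<^sub>R g j)"
      by (simp add: G_def sum_distrib_left sum_distrib_right L1 flip: sum.distrib)
    also have "\<dots> = \<kappa> *\<^sub>R G + a * G * b"
      unfolding aGb by (simp add: G_def scaleR_sum_right algebra_simps sum.distrib)
    finally show ?thesis by (simp add: b_def)
  qed
  have Gs: "star G = G" by (simp add: G_def gs)
  have PG: "P * G * P = P"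
  proof -
    have pg: "P * g j = (if j = 0 then P else 0)" for j
    proof (cases j)
      case (Suc i)
      have "P * (a ^ Suc i * P * b ^ Suc i) = (P * a) * (a ^ i * P * b ^ Suc i)"
        by (simp add: mult.assoc)
      then show ?thesis using Suc Pa by (simp add: g_def del: power_Suc)
    qed (simp add: g_def P(2))
    have "P * G = P" unfolding G_def sum_distrib_left pg using m by simp
    then show ?thesis using P(2) by simp
  qed
  have L1': "E * 1 + 1 * star E = \<kappa> *\<^sub>R 1 + a * 1 * star a"
    using EE by (simp add: C_def b_def add.commute)
  have Pker: "\<And>v. app (star a) v = 0 \<Longrightarrow> app P v = v" using P(4) by (simp add: b_def)
  \<comment> \<open>Here \<open>s\<close> is the least (\<open>t = 1\<close>) or the greatest
    (\<open>t = - 1\<close>) value of the form of \<open>G\<close> on the unit sphere. If it lay on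
    the wrong side of 1, the semidefinite solution \<open>Y\<close> would have a null vector
    although it is positive on the kernel of \<open>b\<close>.\<close>
  have extremal: False
    if v0: "norm v0 = 1" "qf G v0 = s" and ext: "\<And>v. t * (qf G v - s * (norm v)\<^sup>2) \<ge> 0" and t: "t * (1 - s) > 0" for v0 s t
  proof -
    define Y where "Y = t *\<^sub>R (G - s *\<^sub>R 1)"
    have "v0 = 0"
    proof (rule inverse_metric_definite[OF nil P(1) Pker, where X = Y])
      show "star Y = Y" by (simp add: Y_def Gs)
      show "0 \<le> qf Y v" for v using ext[of v] by (simp add: Y_def qf_simps)
      show "qf Y v0 = 0" by (simp add: Y_def qf_simps v0)
      show "P * Y * P = (t * (1 - s)) *\<^sub>R P" by (simp add: Y_def algebra_simps PG[unfolded mult.assoc] P(2))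
      show "0 < t * (1 - s)" by (fact t)
      have "E * Y + Y * star E = t *\<^sub>R ((E * G + G * star E) - s *\<^sub>R (E * 1 + 1 * star E))"
        by (simp add: Y_def algebra_simps)
      also have "\<dots> = \<kappa> *\<^sub>R Y + a * Y * star a"
        unfolding LG L1' by (simp add: Y_def algebra_simps)
      finally show "E * Y + Y * star E = \<kappa> *\<^sub>R Y + a * Y * star a" .
    qed
    then show False using v0(1) by simp
  qed
  have ge: "qf G v \<ge> (norm v)\<^sup>2" for v
  proof -
    obtain v0 where v0: "norm v0 = 1" "\<And>w. qf G w \<ge> qf G v0 * (norm w)\<^sup>2"
      using qf_minimum[of G] by blast
    have "qf G v0 \<ge> 1" using extremal[of v0 "qf G v0" 1] v0 by fastforce
    then have "1 * (norm v)\<^sup>2 \<le> qf G v0 * (norm v)\<^sup>2" by (rule mult_right_mono) simp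
    then show ?thesis using v0(2)[of v] by simp
  qed
  have le: "qf G v \<le> (norm v)\<^sup>2" for v
  proof -
    obtain v0 where v0: "norm v0 = 1" "\<And>w. qf (- G) w \<ge> qf (- G) v0 * (norm w)\<^sup>2"
      using qf_minimum[of "- G"] by blast
    have up: "qf G w \<le> qf G v0 * (norm w)\<^sup>2" for w
      using v0(2)[of w] by (simp add: qf_simps)
    have "qf G v0 \<le> 1" using extremal[of v0 "qf G v0" "-1"] v0(1) up by fastforce
    then have "qf G v0 * (norm v)\<^sup>2 \<le> 1 * (norm v)\<^sup>2" by (rule mult_right_mono) simp
    then show ?thesis using up[of v] by simp
  qed
  have "app (G - 1) v = 0" for v
    by (rule qf_psd_null) (use ge le in \<open>auto simp: Gs qf_simps intro: antisym\<close>)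
  then have "G - 1 = 0" by (intro cmat_eqI) simp
  then have G1: "(\<Sum>j<m. g j) = 1" by (simp add: G_def)
  have CG: "C = (\<Sum>j<m. (\<kappa> * real j) *\<^sub>R g j)"
    using aGb G1 by (simp add: C_def G_def)
  \<comment> \<open>The defect of the columns of \<open>a ^ j * P\<close> from being eigenvectors of
    \<open>C\<close> with eigenvalue \<open>\<kappa> * j\<close>.\<close>
  define h where "h j = C * (a ^ j * P) - (\<kappa> * real j) *\<^sub>R (a ^ j * P)" for j
  \<comment> \<open>Compare two evaluations of \<open>tr ((E + star E) * C)\<close>: by the soliton
    equation, and by the eigenvalues in \<open>L1\<close>.\<close>
  have trCC: "tr (C * C) = (\<Sum>j<m. of_real ((\<kappa> * real j)\<^sup>2) * tr (g j))"
  proof -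
    have "E * C + C * star E = (\<Sum>j<m. (\<kappa> * real j * (\<kappa> * (real j + 1))) *\<^sub>R g j)"
      by (simp add: CG sum_distrib_left sum_distrib_right L1 flip: sum.distrib scaleR_add_right)
    then have "tr (E * C + C * star E) = (\<Sum>j<m. of_real (\<kappa> * real j * (\<kappa> * (real j + 1))) * tr (g j))"
      by (simp only: tr_sum tr_scaleR)
    also have "\<dots> = (\<Sum>j<m. of_real ((\<kappa> * real j)\<^sup>2) * tr (g j)) + \<kappa> * (\<Sum>j<m. of_real (\<kappa> * real j) * tr (g j))"
      by (simp add: power2_eq_square algebra_simps sum.distrib sum_distrib_left)
    also have "(\<Sum>j<m. of_real (\<kappa> * real j) * tr (g j)) = tr C"
      by (simp only: CG tr_sum tr_scaleR)
    finally have "tr (E * C + C * star E) = (\<Sum>j<m. of_real ((\<kappa> * real j)\<^sup>2) * tr (g j)) + \<kappa> * tr C" .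
    moreover have "tr (E * C + C * star E) = tr ((E + star E) * C)"
      by (simp add: distrib_right tr_add tr_commute)
    ultimately show ?thesis unfolding EE by (simp add: distrib_right tr_add tr_scaleR)
  qed
  have hh: "h j * star (h j) = (\<kappa> ^ j * fact j) *\<^sub>R (C * g j * C - (\<kappa> * real j) *\<^sub>R (C * g j) - (\<kappa> * real j) *\<^sub>R (g j * C)
       + ((\<kappa> * real j)\<^sup>2) *\<^sub>R g j)" for j
  proof -
    have g': "a ^ j * P * b ^ j = (\<kappa> ^ j * fact j) *\<^sub>R g j" using \<kappa> by (simp add: g_def)
    have PP': "a ^ j * P * (P * b ^ j) = a ^ j * P * b ^ j" by (metis P(2) mult.assoc)
    have "star (a ^ j * P) = P * b ^ j" by (simp add: P(1) b_def)
    then have "h j * star (h j) = (C * (a ^ j * P) - (\<kappa> * real j) *\<^sub>R (a ^ j * P)) * (P * b ^ j * C - (\<kappa> * real j) *\<^sub>R (P * b ^ j))"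
      by (simp add: h_def Cs)
    also have "\<dots> = C * (a ^ j * P * (P * b ^ j)) * C - (\<kappa> * real j) *\<^sub>R (C * (a ^ j * P * (P * b ^ j)))
        - (\<kappa> * real j) *\<^sub>R (a ^ j * P * (P * b ^ j) * C) + ((\<kappa> * real j)\<^sup>2) *\<^sub>R (a ^ j * P * (P * b ^ j))"
      by (simp add: algebra_simps power2_eq_square)
    finally show ?thesis unfolding PP' g' by (simp add: algebra_simps)
  qed
  \<comment> \<open>A variance: the weighted squared norms of the \<open>h j\<close> add up to
    \<open>tr (C * C) - 2 * tr (C * C)\<close> plus the sum that \<open>trCC\<close> identifies with
    \<open>tr (C * C)\<close>. Hence each \<open>h j\<close> vanishes.\<close>
  have "(\<Sum>j<m. tr (C * g j * C - (\<kappa> * real j) *\<^sub>R (C * g j) - (\<kappa> * real j) *\<^sub>R (g j * C) + ((\<kappa> * real j)\<^sup>2) *\<^sub>R g j)) = 0"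
  proof -
    have "(\<Sum>j<m. C * g j * C) = C * C"
      using G1 by (simp add: flip: sum_distrib_left sum_distrib_right)
    moreover have "(\<Sum>j<m. (\<kappa> * real j) *\<^sub>R (C * g j)) = C * C"
      by (subst (3) CG) (simp add: sum_distrib_left)
    moreover have "(\<Sum>j<m. (\<kappa> * real j) *\<^sub>R (g j * C)) = C * C"
      by (subst (2) CG) (simp add: sum_distrib_right)
    ultimately show ?thesis
      using trCC by (simp add: tr_add tr_diff sum.distrib sum_subtractf tr_sum[symmetric])
        (simp add: tr_sum tr_scaleR)
  qed
  then have "(\<Sum>j<m. Re (tr (h j * star (h j))) / (\<kappa> ^ j * fact j)) = 0"
    using \<kappa> by (simp add: hh tr_scaleR flip: Re_sum)
  then have "\<forall>j\<in>{..<m}. Re (tr (h j * star (h j))) / (\<kappa> ^ j * fact j) = 0"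
    using \<kappa> by (subst (asm) sum_nonneg_eq_0_iff) (auto intro!: divide_nonneg_pos tr_mult_star_nonneg)
  then have h0: "h j = 0" if "j < m" for j
    using that \<kappa> by (intro tr_mult_star_eq_0) auto
  have "a ^ j = 0" if "j \<ge> m" for j
    using that nil by (metis le_add_diff_inverse mult_zero_left power_add)
  then have h0': "h j = 0" for j
    using h0 by (cases "j < m") (auto simp: h_def)
  then have Ca: "C * (a ^ j * P) = (\<kappa> * real j) *\<^sub>R (a ^ j * P)" for j
    by (simp add: h_def)
  have Cg: "C * g j = (\<kappa> * real j) *\<^sub>R g j" for j
    using arg_cong[OF Ca[of j], of "\<lambda>u. u * b ^ j"] by (simp add: g_def mult.assoc)
  have gC: "g j * C = (\<kappa> * real j) *\<^sub>R g j" for j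
    using arg_cong[OF Cg[of j], of star] by (simp add: Cs gs)
  have orth: "g i * g j = 0" if "i \<noteq> j" for i j
  proof -
    have "g i * C * g j = (\<kappa> * real i) *\<^sub>R (g i * g j)" by (simp add: gC)
    moreover have "g i * C * g j = (\<kappa> * real j) *\<^sub>R (g i * g j)" by (simp add: Cg mult.assoc)
    ultimately show ?thesis using that \<kappa> by simp
  qed
  have idem: "g j * g j = g j" for j
  proof (cases "j < m")
    case True
    have "g j = (\<Sum>i<m. g j * g i)" using G1 by (simp flip: sum_distrib_left)
    also have "\<dots> = (\<Sum>i<m. if i = j then g j * g j else 0)" by (rule sum.cong) (auto simp: orth)
    finally show ?thesis using True by simp
  qed (simp add: gz)
  \<comment> \<open>The ranges of the \<open>a ^ j * P\<close> span everything because the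
    \<open>g j\<close> add up to 1, so the relation may be tested there.\<close>
  have "C * a - a * C - \<kappa> *\<^sub>R a = (C * a - a * C - \<kappa> *\<^sub>R a) * (\<Sum>j<m. g j)" using G1 by simp
  also have "\<dots> = 0"
  proof -
    have "(C * a - a * C - \<kappa> *\<^sub>R a) * (a ^ j * P) = 0" for j
    proof -
      have "(C * a - a * C - \<kappa> *\<^sub>R a) * (a ^ j * P) = C * (a ^ Suc j * P) - a * (C * (a ^ j * P)) - \<kappa> *\<^sub>R (a ^ Suc j * P)"
        by (simp add: algebra_simps)
      then show ?thesis unfolding Ca by (simp add: algebra_simps)
    qed
    then have "(C * a - a * C - \<kappa> *\<^sub>R a) * g j = 0" for j
      by (simp add: g_def mult.assoc[symmetric])
    then show ?thesis by (simp add: sum_distrib_left)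
  qed
  finally have Caa: "C * a - a * C = \<kappa> *\<^sub>R a" by simp
  have ay: "\<exists>y. g j = a ^ j * y" for j
    by (rule exI[of _ "(1 / (\<kappa> ^ j * fact j)) *\<^sub>R (P * b ^ j)"]) (simp add: g_def mult.assoc)
  have "graded \<kappa> m a g"
    unfolding graded_def using \<kappa> nil gs orth idem gz G1 Cg Caa ay
    by (auto simp: C_def b_def)
  then show ?thesis using that by (simp add: \<kappa>_def)
qed

section \<open>Unitary equivalence of solitons\<close>

text \<open>The diagonal part of a product of triangular matrices is the product of the diagonal
  parts. The disjunction in \<open>tri\<close> says that no off-diagonal block of \<open>T\<close>
  meets a block of \<open>S\<close> leading back, which covers upper and lower triangularity
  alike.\<close>

lemma block_diagonal_inverse:
  fixes T S :: "'n::finite cmat" and e f :: "nat \<Rightarrow> 'n cmat"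
  assumes e: "\<And>i j. e i * e j = (if i = j then e i else 0)" "(\<Sum>j<m. e j) = 1"
    and f: "\<And>i j. f i * f j = (if i = j then f i else 0)" "(\<Sum>j<m. f j) = 1"
    and TS: "T * S = 1" and tri: "\<And>i j. i \<noteq> j \<Longrightarrow> e j * T * f i = 0 \<or> f i * S * e j = 0"
  shows "(\<Sum>j<m. e j * T * f j) * (\<Sum>j<m. f j * S * e j) = 1"
proof -
  have diag: "e j * T * f j * S * e j = e j" if "j < m" for j
  proof -
    have "e j = e j * T * (\<Sum>i<m. f i) * S * e j"
      using e(1)[of j j] f(2) TS by (simp add: mult.assoc)
    also have "\<dots> = (\<Sum>i<m. e j * T * f i * S * e j)"
      by (simp add: sum_distrib_left sum_distrib_right)
    also have "\<dots> = (\<Sum>i<m. if i = j then e j * T * f j * S * e j else 0)"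
    proof (rule sum.cong)
      fix i
      show "e j * T * f i * S * e j = (if i = j then e j * T * f j * S * e j else 0)"
      proof (cases "i = j")
        case False
        from tri[OF this] have "e j * T * f i * S * e j = 0"
        proof
          assume "f i * S * e j = 0"
          then have "e j * T * (f i * S * e j) = 0" by simp
          then show ?thesis by (simp add: mult.assoc)
        qed simp
        with False show ?thesis by simp
      qed simp
    qed simp
    finally show ?thesis using that by simp
  qed
  have "(\<Sum>j<m. e j * T * f j) * (\<Sum>j<m. f j * S * e j) = (\<Sum>j<m. \<Sum>i<m. e j * T * (f j * f i) * S * e i)"
    by (simp add: sum_product mult.assoc)
  also have "\<dots> = (\<Sum>j<m. e j * T * f j * S * e j)"
  proof (rule sum.cong)
    fix j assume "j \<in> {..<m}"
    have "(\<Sum>i<m. e j * T * (f j * f i) * S * e i) = (\<Sum>i<m. if i = j then e j * T * f j * S * e j else 0)"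
      by (rule sum.cong) (auto simp: f(1))
    then show "(\<Sum>i<m. e j * T * (f j * f i) * S * e i) = e j * T * f j * S * e j"
      using \<open>j \<in> {..<m}\<close> by simp
  qed simp
  also have "\<dots> = 1" using diag e(2) by simp
  finally show ?thesis .
qed

text \<open>The relation \<open>C * a - a * C = \<kappa> *\<^sub>R a\<close> makes \<open>a\<close>
  raise eigenvalues of \<open>C = a * star a\<close> by \<open>\<kappa>\<close>, so every block of
  \<open>a\<close> vanishes except those from degree \<open>j\<close> to \<open>Suc j\<close>;
  nothing lands in degree 0.\<close>

lemma graded_shift:
  assumes "graded \<kappa> m a e"
  shows "a * e j = e (Suc j) * a" and "e 0 * a = 0"
proof -
  have C: "a * star a * e j = (\<kappa> * real j) *\<^sub>R e j" for j using assms by (simp add: graded_def)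
  have C': "e j * (a * star a) = (\<kappa> * real j) *\<^sub>R e j" for j
    using arg_cong[OF C[of j], of star] assms by (simp add: graded_def mult.assoc)
  have Ca: "a * star a * a = a * (a * star a) + \<kappa> *\<^sub>R a"
    using assms by (simp add: graded_def algebra_simps)
  have z: "e i * a * e j = 0" if "i \<noteq> Suc j" for i j
  proof -
    have "(\<kappa> * real i) *\<^sub>R (e i * a * e j) = e i * (a * star a * a) * e j"
      by (simp add: C' mult.assoc[symmetric]) (simp add: mult.assoc C'[simplified mult.assoc])
    also have "\<dots> = e i * a * (a * star a * e j) + \<kappa> *\<^sub>R (e i * a * e j)"
      unfolding Ca by (simp add: algebra_simps)
    also have "\<dots> = (\<kappa> * real (Suc j)) *\<^sub>R (e i * a * e j)"
      unfolding C by (simp add: algebra_simps)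
    finally have "\<kappa> * real i = \<kappa> * real (Suc j) \<or> e i * a * e j = 0"
      by (metis scaleR_cancel_right)
    then show ?thesis using that assms by (auto simp: graded_def)
  qed
  have sum1: "(\<Sum>j<m. e j) = 1" and big: "\<And>j. j \<ge> m \<Longrightarrow> e j = 0" using assms by (auto simp: graded_def)
  have left: "a * e j = e (Suc j) * a * e j" for j
  proof -
    have "a * e j = (\<Sum>i<m. e i * a * e j)" using sum1 by (simp flip: sum_distrib_right)
    also have "\<dots> = (\<Sum>i<m. if i = Suc j then e (Suc j) * a * e j else 0)"
      by (rule sum.cong) (auto simp: z)
    also have "\<dots> = e (Suc j) * a * e j" using big[of "Suc j"] by simp
    finally show ?thesis .
  qed
  have right: "e (Suc j) * a = e (Suc j) * a * e j" for j
  proof -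
    have "e (Suc j) * a = (\<Sum>i<m. e (Suc j) * a * e i)" using sum1 by (simp flip: sum_distrib_left)
    also have "\<dots> = (\<Sum>i<m. if i = j then e (Suc j) * a * e j else 0)"
      by (rule sum.cong) (auto simp: z)
    also have "\<dots> = e (Suc j) * a * e j" using big[of j] by simp
    finally show ?thesis .
  qed
  show "a * e j = e (Suc j) * a" using left right by metis
  have "e 0 * a = (\<Sum>i<m. e 0 * a * e i)" using sum1 by (simp flip: sum_distrib_left)
  then show "e 0 * a = 0" by (simp add: z)
qed

lemma graded_power_lower:
  assumes "graded \<kappa> m a e" "i < j"
  shows "e i * a ^ j = 0"
  using assms(2)
proof (induction j arbitrary: i)
  case (Suc j)
  show ?case
  proof (cases i)
    case 0
    then show ?thesis using graded_shift(2)[OF assms(1)] by (simp add: mult.assoc[symmetric])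
  next
    case (Suc k)
    have "e i * a ^ Suc j = a * (e k * a ^ j)"
      using graded_shift(1)[OF assms(1), of k] Suc by (simp add: mult.assoc[symmetric])
    then show ?thesis using Suc.IH[of k] Suc.prems Suc by simp
  qed
qed simp

lemma intertwine_power: "a * T = T * b \<Longrightarrow> a ^ k * T = T * b ^ k" for a b T :: "'n::finite cmat"
  by (induction k) (simp_all add: mult.assoc, metis mult.assoc power_commutes)

text \<open>The range of \<open>f j\<close> lies in that of \<open>b ^ j\<close>, so
  \<open>T\<close> sends it into the range of \<open>a ^ j\<close>, where the degrees below
  \<open>j\<close> vanish. Thus \<open>T\<close>, and likewise \<open>S\<close>, is triangular. The
  diagonal part is invertible, still intertwines because \<open>a\<close> and \<open>b\<close> both
  raise the degree by one, and now respects \<open>a * star a\<close>.\<close>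

lemma graded_intertwiner:
  fixes a b T S :: "'n::finite cmat"
  assumes a: "graded \<kappa> m a e" and b: "graded \<kappa> m b f" and T: "a * T = T * b" "T * S = 1" "S * T = 1"
  obtains T' S' where "a * T' = T' * b" "a * star a * T' = T' * (b * star b)" "T' * S' = 1" "S' * T' = 1"
proof -
  have S: "b * S = S * a" by (metis T mult.assoc mult_1 mult_1_right)
  have tri: "e i * X * f j = 0" if ij: "i < j" and X: "a * X = X * b" and ga: "graded \<kappa> m a e" and gb: "graded \<kappa> m b f"
    for i j X e f and a b :: "'n cmat"
  proof -
    obtain y where "f j = b ^ j * y" using gb unfolding graded_def by blast
    then have "e i * X * f j = (e i * a ^ j) * X * y"
      using intertwine_power[OF X, of j] by (metis mult.assoc)
    then show ?thesis by (simp add: graded_power_lower[OF ga ij])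
  qed
  define T' where "T' = (\<Sum>j<m. e j * T * f j)"
  define S' where "S' = (\<Sum>j<m. f j * S * e j)"
  have "T' * S' = 1"
    unfolding T'_def S'_def
  proof (rule block_diagonal_inverse)
    show "e j * T * f i = 0 \<or> f i * S * e j = 0" if "i \<noteq> j" for i j
      using that tri[OF _ T(1) a b, of j i] tri[OF _ S b a, of i j] by (cases "i < j") auto
  qed (use a b T in \<open>simp_all add: graded_def\<close>)
  moreover from this have "S' * T' = 1" by (rule cmat_inverse_commute)
  moreover have "a * T' = T' * b"
  proof -
    have "a * (e j * T * f j) = e (Suc j) * T * f (Suc j) * b" for j
    proof -
      have "a * (e j * T * f j) = e (Suc j) * (a * T) * f j"
        by (simp add: mult.assoc[symmetric] graded_shift(1)[OF a])
      also have "\<dots> = e (Suc j) * T * (b * f j)" unfolding T(1) by (simp add: mult.assoc)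
      finally show ?thesis unfolding graded_shift(1)[OF b] by (simp add: mult.assoc)
    qed
    then have "a * T' = (\<Sum>j<m. e (Suc j) * T * f (Suc j) * b)" by (simp add: T'_def sum_distrib_left)
    also have "\<dots> = (\<Sum>j<Suc m. e j * T * f j * b)"
      using graded_shift(2)[OF b] by (subst sum.lessThan_Suc_shift) (simp add: mult.assoc)
    also have "\<dots> = T' * b" using a by (simp add: T'_def sum_distrib_right graded_def)
    finally show ?thesis .
  qed
  moreover have "a * star a * T' = T' * (b * star b)"
  proof -
    have "star (f j) = f j" "star (b * star b * f j) = (\<kappa> * real j) *\<^sub>R f j" for j
      using b by (simp_all add: graded_def)
    then have 1: "f j * (b * star b) = (\<kappa> * real j) *\<^sub>R f j" for j by simp
    have 2: "a * star a * e j = (\<kappa> * real j) *\<^sub>R e j" for j using a by (simp add: graded_def)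
    have "a * star a * (e j * T * f j) = e j * T * f j * (b * star b)" for j
    proof -
      have "a * star a * (e j * T * f j) = (a * star a * e j) * T * f j" by (simp add: mult.assoc)
      also have "\<dots> = e j * T * (f j * (b * star b))" unfolding 1 2 by simp
      finally show ?thesis by (simp add: mult.assoc)
    qed
    then show ?thesis by (simp add: T'_def sum_distrib_left sum_distrib_right)
  qed
  ultimately show ?thesis using that by blast
qed

text \<open>Commuting \<open>C = a * star a\<close> past \<open>a ^ k\<close> only adds a multiple
  of \<open>a ^ k\<close>, so \<open>C\<close> preserves the kernel of \<open>a ^ k\<close>.
  Therefore \<open>star a\<close> maps this kernel into that of \<open>a ^ Suc k\<close>; together
  with the opposite inclusion for \<open>a\<close> this gives the exact shift
  \<open>a * \<pi> (Suc k) = \<pi> k * a\<close>.\<close>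

lemma kernel_flag:
  fixes a :: "'n::finite cmat"
  assumes nil: "a ^ m = 0" and Ca: "a * star a * a - a * (a * star a) = \<kappa> *\<^sub>R a"
  obtains \<pi> where "\<And>k. star (\<pi> k) = \<pi> k" "\<And>k. a ^ k * \<pi> k = 0" "\<And>k y. a ^ k * y = 0 \<Longrightarrow> \<pi> k * y = y"
    "\<And>k. a * \<pi> (Suc k) = \<pi> k * a" "\<And>k. a * star a * \<pi> k = \<pi> k * (a * star a)"
    "\<pi> 0 = 0" "\<And>k. k \<ge> m \<Longrightarrow> \<pi> k = 1" "\<And>j k. j \<le> k \<Longrightarrow> \<pi> j * \<pi> k = \<pi> j" "\<And>j k. j \<le> k \<Longrightarrow> \<pi> k * \<pi> j = \<pi> j"
proof -
  have "\<exists>P. star P = P \<and> P * P = P \<and> a ^ k * P = 0 \<and> (\<forall>v. app (a ^ k) v = 0 \<longrightarrow> app P v = v)" for k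
    using kernel_projection[of "a ^ k"] by metis
  then obtain \<pi> where \<pi>: "\<And>k. star (\<pi> k) = \<pi> k" "\<And>k. \<pi> k * \<pi> k = \<pi> k" "\<And>k. a ^ k * \<pi> k = 0"
    "\<And>k v. app (a ^ k) v = 0 \<Longrightarrow> app (\<pi> k) v = v" by metis
  have ker: "\<pi> k * y = y" if "a ^ k * y = 0" for k y
    using kernel_projection_mult[OF \<pi>(4) that] .
  define C where "C = a * star a"
  have Cs: "star C = C" by (simp add: C_def)
  have Ca': "C * a = a * C + \<kappa> *\<^sub>R a" using Ca by (simp add: C_def algebra_simps)
  have aC: "a ^ k * C = C * a ^ k - (\<kappa> * real k) *\<^sub>R a ^ k" for k
  proof (induction k)
    case (Suc k)
    have "a ^ Suc k * C = a * (a ^ k * C)" by (simp add: mult.assoc)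
    also have "\<dots> = a * C * a ^ k - (\<kappa> * real k) *\<^sub>R a ^ Suc k" unfolding Suc by (simp add: algebra_simps)
    also have "a * C = C * a - \<kappa> *\<^sub>R a" using Ca' by simp
    finally show ?case by (simp add: algebra_simps)
  qed simp
  have Cker: "a ^ k * (C * \<pi> k) = 0" for k
  proof -
    have "a ^ k * (C * \<pi> k) = C * (a ^ k * \<pi> k) - (\<kappa> * real k) *\<^sub>R (a ^ k * \<pi> k)"
      by (simp add: aC mult.assoc[symmetric] left_diff_distrib)
    then show ?thesis by (simp add: \<pi>(3))
  qed
  have 1: "\<pi> k * (C * \<pi> k) = C * \<pi> k" for k by (rule ker[OF Cker])
  have C\<pi>: "C * \<pi> k = \<pi> k * C" for k
  proof -
    have "\<pi> k * C * \<pi> k = \<pi> k * C" using arg_cong[OF 1[of k], of star] by (simp add: Cs \<pi>(1) mult.assoc)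
    then show ?thesis using 1[of k] by (simp add: mult.assoc)
  qed
  have shift: "a * \<pi> (Suc k) = \<pi> k * a" for k
  proof -
    have "a ^ k * (a * \<pi> (Suc k)) = 0"
      using \<pi>(3)[of "Suc k"] by (simp add: mult.assoc[symmetric] power_commutes)
    then have 2: "\<pi> k * (a * \<pi> (Suc k)) = a * \<pi> (Suc k)" by (rule ker)
    have "a ^ Suc k * (star a * \<pi> k) = a ^ k * (C * \<pi> k)"
      by (simp add: C_def mult.assoc power_Suc2 del: power_Suc)
    then have "a ^ Suc k * (star a * \<pi> k) = 0" by (simp add: Cker)
    then have 3: "\<pi> (Suc k) * (star a * \<pi> k) = star a * \<pi> k" by (rule ker)
    have "\<pi> k * a * \<pi> (Suc k) = \<pi> k * a" using arg_cong[OF 3, of star] by (simp add: \<pi>(1) mult.assoc)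
    then show ?thesis using 2 by (simp add: mult.assoc)
  qed
  have \<pi>0: "\<pi> 0 = 0" using \<pi>(3)[of 0] by simp
  have \<pi>m: "\<pi> k = 1" if "k \<ge> m" for k
  proof -
    have "a ^ k = 0" using that nil by (metis le_add_diff_inverse mult_zero_left power_add)
    then show ?thesis using ker[of k 1] by simp
  qed
  have le: "\<pi> k * \<pi> j = \<pi> j" if "j \<le> k" for j k
  proof (rule ker)
    have "a ^ k * \<pi> j = a ^ (k - j) * (a ^ j * \<pi> j)" using that by (simp add: mult.assoc[symmetric] flip: power_add)
    then show "a ^ k * \<pi> j = 0" by (simp add: \<pi>(3))
  qed
  have le': "\<pi> j * \<pi> k = \<pi> j" if "j \<le> k" for j k
    using arg_cong[OF le[OF that], of star] by (simp add: \<pi>(1))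
  show ?thesis
    by (rule that[of \<pi>]) (use \<pi>(1,3) ker shift C\<pi> \<pi>0 \<pi>m le le' in \<open>simp_all add: C_def\<close>)
qed

text \<open>Any intertwiner respects the kernels of powers, so \<open>T\<close> and \<open>S\<close>
  are triangular for the layers between successive kernels. Passing to the diagonal part keeps both
  given relations and forces the relation for adjoints.\<close>

lemma nilpotent_star_intertwiner:
  fixes a b T S :: "'n::finite cmat"
  assumes a: "a ^ m = 0" "a * star a * a - a * (a * star a) = \<kappa> *\<^sub>R a"
    and b: "b ^ m = 0" "b * star b * b - b * (b * star b) = \<kappa> *\<^sub>R b"
    and T: "a * T = T * b" "a * star a * T = T * (b * star b)" "T * S = 1" "S * T = 1"
  obtains T' S' where "a * T' = T' * b" "star a * T' = T' * star b" "T' * S' = 1" "S' * T' = 1"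
proof -
  have S: "b * S = S * a" by (metis T(1,3,4) mult.assoc mult_1 mult_1_right)
  obtain \<pi> where \<pi>: "\<And>k. star (\<pi> k) = \<pi> k" "\<And>k. a ^ k * \<pi> k = 0" "\<And>k y. a ^ k * y = 0 \<Longrightarrow> \<pi> k * y = y"
    "\<And>k. a * \<pi> (Suc k) = \<pi> k * a" "\<And>k. a * star a * \<pi> k = \<pi> k * (a * star a)"
    "\<pi> 0 = 0" "\<And>k. k \<ge> m \<Longrightarrow> \<pi> k = 1" "\<And>j k. j \<le> k \<Longrightarrow> \<pi> j * \<pi> k = \<pi> j" "\<And>j k. j \<le> k \<Longrightarrow> \<pi> k * \<pi> j = \<pi> j"
    using kernel_flag[OF a] by blast
  obtain \<rho> where \<rho>: "\<And>k. star (\<rho> k) = \<rho> k" "\<And>k. b ^ k * \<rho> k = 0" "\<And>k y. b ^ k * y = 0 \<Longrightarrow> \<rho> k * y = y"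
    "\<And>k. b * \<rho> (Suc k) = \<rho> k * b" "\<And>k. b * star b * \<rho> k = \<rho> k * (b * star b)"
    "\<rho> 0 = 0" "\<And>k. k \<ge> m \<Longrightarrow> \<rho> k = 1" "\<And>j k. j \<le> k \<Longrightarrow> \<rho> j * \<rho> k = \<rho> j" "\<And>j k. j \<le> k \<Longrightarrow> \<rho> k * \<rho> j = \<rho> j"
    using kernel_flag[OF b] by blast
  define r where "r k = \<pi> (Suc k) - \<pi> k" for k
  define s where "s k = \<rho> (Suc k) - \<rho> k" for k
  have tri: "(\<pi> (Suc i) - \<pi> i) * T * (\<rho> (Suc j) - \<rho> j) = 0"
    if ij: "j < i" and T: "a * T = T * b" and \<pi>: "\<And>k y. a ^ k * y = 0 \<Longrightarrow> \<pi> k * y = y" "\<And>j k. j \<le> k \<Longrightarrow> \<pi> k * \<pi> j = \<pi> j"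
      and \<rho>: "\<And>k. b ^ k * \<rho> k = 0" for i j T \<pi> \<rho> and a b :: "'n cmat"
  proof -
    let ?X = "T * (\<rho> (Suc j) - \<rho> j)"
    have "b ^ Suc j * \<rho> j = 0" using \<rho>[of j] by (simp add: mult.assoc)
    then have "a ^ Suc j * ?X = 0"
      using intertwine_power[OF T, of "Suc j"] \<rho>[of "Suc j"]
      by (simp add: mult.assoc[symmetric] del: power_Suc) (simp add: mult.assoc right_diff_distrib del: power_Suc)
    then have "?X = \<pi> (Suc j) * ?X" using \<pi>(1) by metis
    moreover have "(\<pi> (Suc i) - \<pi> i) * \<pi> (Suc j) = 0" using ij by (simp add: left_diff_distrib \<pi>(2))
    ultimately show ?thesis by (metis mult.assoc mult_zero_left)
  qed
  have tri\<pi>: "r i * T * s j = 0" if "j < i" for i j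
    unfolding r_def s_def by (rule tri[OF that T(1) \<pi>(3,9) \<rho>(2)])
  have tri\<rho>: "s i * S * r j = 0" if "j < i" for i j
    unfolding r_def s_def by (rule tri[OF that S \<rho>(3,9) \<pi>(2)])
  have rr: "r i * r j = (if i = j then r i else 0)" for i j
  proof (cases i j rule: linorder_cases)
    case less
    then show ?thesis by (simp add: r_def algebra_simps \<pi>(8))
  next
    case greater
    then show ?thesis by (simp add: r_def algebra_simps \<pi>(9))
  qed (simp add: r_def algebra_simps \<pi>(8,9))
  have ss: "s i * s j = (if i = j then s i else 0)" for i j
  proof (cases i j rule: linorder_cases)
    case less
    then show ?thesis by (simp add: s_def algebra_simps \<rho>(8))
  next
    case greater
    then show ?thesis by (simp add: s_def algebra_simps \<rho>(9))
  qed (simp add: s_def algebra_simps \<rho>(8,9))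
  have rsum: "(\<Sum>k<m. r k) = 1" and ssum: "(\<Sum>k<m. s k) = 1"
    unfolding r_def s_def sum_lessThan_telescope using \<pi>(6,7) \<rho>(6,7) by simp_all
  define T' where "T' = (\<Sum>j<m. r j * T * s j)"
  define S' where "S' = (\<Sum>j<m. s j * S * r j)"
  have inv: "T' * S' = 1"
    unfolding T'_def S'_def
    by (rule block_diagonal_inverse[OF rr rsum ss ssum T(3)]) (meson tri\<pi> tri\<rho> linorder_neqE_nat)
  have ar: "a * r (Suc k) = r k * a" for k by (simp add: r_def algebra_simps \<pi>(4))
  have bs: "b * s (Suc k) = s k * b" for k by (simp add: s_def algebra_simps \<rho>(4))
  have m: "m > 0" using a(1) by (cases m) auto
  have a1: "a * \<pi> (Suc 0) = 0" using \<pi>(4)[of 0] \<pi>(6) by simp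
  have b1: "b * \<rho> (Suc 0) = 0" using \<rho>(4)[of 0] \<rho>(6) by simp
  have r0: "r 0 = \<pi> (Suc 0)" by (simp add: r_def \<pi>(6))
  have s0: "s 0 = \<rho> (Suc 0)" by (simp add: s_def \<rho>(6))
  have aT: "a * T' = T' * b"
  proof -
    obtain n where n: "m = Suc n" using m by (cases m) auto
    \<comment> \<open>Since \<open>b ^ n * b = 0\<close>, the range of \<open>b\<close> misses the
      top layer, and shifting the index in the sum loses no term.\<close>
    have "s n * b = 0"
      using \<rho>(4)[of "Suc n"] \<rho>(4)[of n] \<rho>(7)[of "Suc n"] \<rho>(7)[of "Suc (Suc n)"] n by (simp add: s_def left_diff_distrib)
    have step: "a * (r (Suc j) * T * s (Suc j)) = r j * T * s j * b" for j
    proof -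
      have "a * (r (Suc j) * T * s (Suc j)) = r j * (a * T) * s (Suc j)"
        by (simp add: mult.assoc[symmetric] ar)
      also have "\<dots> = r j * T * (b * s (Suc j))" unfolding T(1) by (simp add: mult.assoc)
      finally show ?thesis unfolding bs by (simp add: mult.assoc)
    qed
    have "a * T' = a * (r 0 * T * s 0) + (\<Sum>j<n. a * (r (Suc j) * T * s (Suc j)))"
      unfolding T'_def n by (subst sum.lessThan_Suc_shift) (simp add: distrib_left sum_distrib_left)
    also have "\<dots> = (\<Sum>j<n. r j * T * s j * b)"
    proof -
      have "a * (r 0 * T * s 0) = 0" using a1 by (simp add: r0 mult.assoc[symmetric])
      then show ?thesis by (simp only: step add_0)
    qed
    also have "\<dots> = T' * b"
      unfolding T'_def n using \<open>s n * b = 0\<close> by (simp add: distrib_right sum_distrib_right mult.assoc)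
    finally show ?thesis .
  qed
  have CT: "a * star a * T' = T' * (b * star b)"
  proof -
    have "a * star a * (r j * T * s j) = r j * T * s j * (b * star b)" for j
    proof -
      have ra: "a * star a * r j = r j * (a * star a)" by (simp add: r_def algebra_simps \<pi>(5)[simplified mult.assoc])
      have sb: "s j * (b * star b) = b * star b * s j" by (simp add: s_def algebra_simps \<rho>(5)[simplified mult.assoc])
      have "a * star a * (r j * T * s j) = (a * star a * r j) * T * s j" by (simp add: mult.assoc)
      also have "\<dots> = r j * (a * star a * T) * s j" unfolding ra by (simp add: mult.assoc)
      also have "\<dots> = r j * T * (b * star b * s j)" unfolding T(2) by (simp add: mult.assoc)
      finally show ?thesis unfolding sb[symmetric] by (simp add: mult.assoc)
    qed
    then show ?thesis by (simp add: T'_def sum_distrib_left sum_distrib_right)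
  qed
  \<comment> \<open>By the two relations for \<open>T'\<close>, the range of \<open>X\<close> lies
    in the kernel of \<open>a\<close>. Its component there vanishes: the ranges of
    \<open>star a\<close> and \<open>star b\<close> are orthogonal to the bottom layers, and
    \<open>T'\<close> matches these layers.\<close>
  define X where "X = star a * T' - T' * star b"
  have "a * X = a * star a * T' - (a * T') * star b" by (simp add: X_def algebra_simps)
  also have "\<dots> = 0" unfolding CT aT by (simp add: mult.assoc)
  finally have "\<pi> (Suc 0) * X = X" using \<pi>(3)[of "Suc 0" X] by simp
  moreover have "\<pi> (Suc 0) * X = 0"
  proof -
    have "\<pi> (Suc 0) * star a = 0" using arg_cong[OF a1, of star] by (simp add: \<pi>(1))
    moreover have "\<rho> (Suc 0) * star b = 0" using arg_cong[OF b1, of star] by (simp add: \<rho>(1))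
    moreover have "r 0 * T' = r 0 * T * s 0"
    proof -
      have "r 0 * T' = (\<Sum>j<m. (r 0 * r j) * T * s j)" by (simp add: T'_def sum_distrib_left mult.assoc)
      also have "\<dots> = (\<Sum>j<m. if j = 0 then r 0 * T * s 0 else 0)" by (rule sum.cong) (auto simp: rr)
      finally show ?thesis using m by simp
    qed
    moreover have "\<pi> (Suc 0) * X = \<pi> (Suc 0) * star a * T' - r 0 * T' * star b"
      by (simp add: X_def r0 algebra_simps)
    ultimately show ?thesis by (simp add: s0 mult.assoc)
  qed
  ultimately have "star a * T' = T' * star b" by (simp add: X_def)
  then show ?thesis using that[OF aT _ inv cmat_inverse_commute[OF inv]] by blast
qed

text \<open>The Fuglede-Putnam theorem in finite dimension: for normal \<open>a\<close> and
  \<open>b\<close> the matrices \<open>M\<close> and \<open>N\<close> have equal Frobenius norm, by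
  cyclicity of the trace.\<close>

lemma normal_star_intertwiner:
  fixes a b T :: "'n::finite cmat"
  assumes a: "a * star a = star a * a" and b: "b * star b = star b * b" and T: "a * T = T * b"
  shows "star a * T = T * star b"
proof -
  define M where "M = star a * T - T * star b"
  define N where "N = a * T - T * b"
  let ?T = "star T"
  have 1: "tr (star a * T * (?T * a)) = tr (a * T * (?T * star a))"
  proof -
    have "tr (star a * T * (?T * a)) = tr (a * star a * (T * ?T))" by (metis mult.assoc tr_commute)
    also have "\<dots> = tr (star a * a * (T * ?T))" by (simp add: a)
    also have "\<dots> = tr (a * T * (?T * star a))" by (metis mult.assoc tr_commute)
    finally show ?thesis .
  qed
  have 2: "tr (T * star b * (b * ?T)) = tr (T * b * (star b * ?T))"
    by (metis b mult.assoc)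
  have 3: "tr (star a * T * (b * ?T)) = tr (T * b * (?T * star a))" by (metis mult.assoc tr_commute)
  have 4: "tr (T * star b * (?T * a)) = tr (a * T * (star b * ?T))" by (metis mult.assoc tr_commute)
  have "tr (M * star M) = tr (N * star N)"
    using 1 2 3 4 by (simp add: M_def N_def right_diff_distrib left_diff_distrib tr_diff mult.assoc)
  also have "\<dots> = 0" by (simp add: N_def T)
  finally have "M = 0" by (intro tr_mult_star_eq_0) simp
  then show ?thesis by (simp add: M_def)
qed

text \<open>Since \<open>T\<close> intertwines the adjoints too, \<open>star T * T\<close> commutes
  with \<open>b\<close>. So does its square root \<open>R\<close>, by the commutant clause of
  \<open>positive_sqrt\<close>, and hence \<open>T\<close> times the inverse of \<open>R\<close>
  still intertwines.\<close>

lemma polar_intertwiner: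
  fixes a b T S :: "'n::finite cmat"
  assumes T: "a * T = T * b" "star a * T = T * star b" "S * T = 1"
  obtains U where "star U * U = 1" "U * star U = 1" "a * U = U * b"
proof -
  define p where "p = star T * T"
  have qfp: "qf p v = (norm (app T v))\<^sup>2" for v
    by (simp add: qf_def p_def app_mult cin_app[of "star T"] cin_self)
  have "qf p v > 0" if "v \<noteq> 0" for v
  proof -
    have "app S (app T v) = v" using T(3) by (metis app_1 app_mult)
    then have "app T v \<noteq> 0" using that by auto
    then show ?thesis by (simp add: qfp)
  qed
  moreover have "star p = p" by (simp add: p_def)
  ultimately obtain R Q where R: "star R = R" "R * R = p" "R * Q = 1" "Q * R = 1" "\<And>x. x * p = p * x \<Longrightarrow> x * R = R * x"
    using positive_sqrt by metis
  have Qs: "star Q = Q"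
  proof -
    have "star Q * R = 1" using arg_cong[OF R(3), of star] R(1) by simp
    then show ?thesis by (metis R(3) mult.assoc mult_1 mult_1_right)
  qed
  have "b * star T = star T * a" using arg_cong[OF T(2), of star] by simp
  then have "b * p = p * b" by (metis T(1) mult.assoc p_def)
  then have "b * R = R * b" by (rule R(5))
  then have bQ: "b * Q = Q * b" by (metis R(3,4) mult.assoc mult_1 mult_1_right)
  define U where "U = T * Q"
  have "star U * U = Q * p * Q" by (simp add: U_def Qs p_def mult.assoc)
  also have "\<dots> = 1" unfolding R(2)[symmetric] by (metis R(3,4) mult.assoc mult_1)
  finally have "star U * U = 1" .
  moreover have "a * U = U * b" using T(1) bQ by (metis U_def mult.assoc)
  ultimately show ?thesis using that cmat_inverse_commute by blast
qed

text \<open>Descent on the exponent: for \<open>k > 0\<close> the matrix \<open>x = a ^ k\<close> is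
  normal with \<open>x * x = 0\<close>, which forces \<open>star x * x = 0\<close> and then
  \<open>x = 0\<close>.\<close>

lemma normal_nilpotent_eq_0:
  fixes a :: "'n::finite cmat"
  assumes "a * star a = star a * a" "a ^ k = 0"
  shows "a = 0"
  using assms(2)
proof (induction k)
  case (Suc k)
  show ?case
  proof (cases "k = 0")
    case False
    define x where "x = a ^ k"
    have "a ^ k * star a = star a * a ^ k" by (rule intertwine_power[OF assms(1)])
    then have n: "star x * x = x * star x"
      unfolding x_def star_power by (metis intertwine_power)
    have "x * x = a ^ Suc k * a ^ (k - 1)"
      using False unfolding x_def power_add[symmetric] by (intro arg_cong[of _ _ "(^) a"]) simp
    then have "x * x = 0" by (simp only: Suc.prems mult_zero_left)
    then have "star x * x * star (star x * x) = 0" by (metis mult.assoc mult_zero_right n star_mult star_star)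
    then have "star x * star (star x) = 0" using mult_star_eq_0 by force
    then have "star x = 0" by (rule mult_star_eq_0)
    then have "a ^ k = 0" by (metis star_0 star_star x_def)
    then show ?thesis by (rule Suc.IH)
  qed (use Suc in simp)
qed simp

text \<open>\<open>s\<close> acts as \<open>t ^ j\<close> in degree \<open>j\<close>, and
  \<open>a\<close> has degree one. Its purpose is to make \<open>a\<close> similar to its positive
  multiples, so that rescaling \<open>a\<close> does not destroy the similarity with
  \<open>b\<close>.\<close>

lemma graded_rescale:
  assumes g: "graded \<kappa> m a e" and t: "t > 0"
  obtains s s' where "s * s' = 1" "s' * s = 1" "s * a = t *\<^sub>R (a * s)"
proof -
  define s where "s = (\<Sum>j<m. (t ^ j) *\<^sub>R e j)"
  define s' where "s' = (\<Sum>j<m. (1 / t ^ j) *\<^sub>R e j)"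
  have ee: "e i * e j = (if i = j then e i else 0)" for i j using g by (simp add: graded_def)
  have "s * s' = (\<Sum>j<m. \<Sum>i<m. if i = j then e j else 0)"
    unfolding s_def s'_def sum_product using t by (intro sum.cong refl) (simp add: ee)
  also have "\<dots> = (\<Sum>j<m. e j)" by simp
  finally have "s * s' = 1" using g by (simp add: graded_def)
  moreover have "s * a = t *\<^sub>R (a * s)"
  proof -
    have "s * a = (\<Sum>j<Suc m. (t ^ j) *\<^sub>R (e j * a))"
      using g by (simp add: s_def sum_distrib_right graded_def)
    also have "\<dots> = (\<Sum>j<m. (t ^ Suc j) *\<^sub>R (e (Suc j) * a))"
      by (subst sum.lessThan_Suc_shift) (simp add: graded_shift(2)[OF g])
    also have "\<dots> = t *\<^sub>R (a * s)"
      by (simp add: s_def sum_distrib_left scaleR_sum_right graded_shift(1)[OF g])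
    finally show ?thesis .
  qed
  ultimately show ?thesis using that cmat_inverse_commute by blast
qed

section \<open>Normal or graded: comparing two solitons\<close>

lemma soliton_scaled:
  fixes a E :: "'n::finite cmat"
  assumes "N > 0" "N *\<^sub>R (a * star a) = E + star E - (2 * Re d) *\<^sub>R 1" "E * a - a * E = csc d a"
  shows "(sqrt N *\<^sub>R a) * star (sqrt N *\<^sub>R a) = E + star E - (2 * Re d) *\<^sub>R 1"
    and "E * (sqrt N *\<^sub>R a) - (sqrt N *\<^sub>R a) * E = csc d (sqrt N *\<^sub>R a)"
proof -
  show "(sqrt N *\<^sub>R a) * star (sqrt N *\<^sub>R a) = E + star E - (2 * Re d) *\<^sub>R 1" using assms by simp
  have "E * (sqrt N *\<^sub>R a) - (sqrt N *\<^sub>R a) * E = sqrt N *\<^sub>R (E * a - a * E)" by (simp add: algebra_simps)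
  also have "\<dots> = csc d (sqrt N *\<^sub>R a)" unfolding assms(3) by (simp add: csc_of_real[symmetric] mult_ac)
  finally show "E * (sqrt N *\<^sub>R a) - (sqrt N *\<^sub>R a) * E = csc d (sqrt N *\<^sub>R a)" .
qed

text \<open>The quantifier over all \<open>k\<close> allows two similar solitons to be graded with a
  common exponent.\<close>

lemma soliton_normal_or_graded:
  fixes a E :: "'n::finite cmat"
  assumes "N > 0" "N *\<^sub>R (a * star a) = E + star E - (2 * Re d) *\<^sub>R 1" "E * a - a * E = csc d a"
  shows "a * star a = star a * a \<or> (\<exists>k. a ^ k = 0) \<and> (\<forall>k. a ^ k = 0 \<longrightarrow> (\<exists>\<kappa> e. graded \<kappa> k a e))"
  using soliton_normal_or_nilpotent[OF soliton_scaled[OF assms]]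
proof
  assume "(sqrt N *\<^sub>R a) * star (sqrt N *\<^sub>R a) = star (sqrt N *\<^sub>R a) * (sqrt N *\<^sub>R a)"
  then show ?thesis using assms(1) by simp
next
  assume *: "Re d > 0 \<and> (\<exists>k. (sqrt N *\<^sub>R a) ^ k = 0)"
  have p: "(sqrt N *\<^sub>R a) ^ k = 0 \<longleftrightarrow> a ^ k = 0" for k using assms(1) by (simp add: scaleR_power)
  have "\<exists>\<kappa> e. graded \<kappa> k a e" if "a ^ k = 0" for k
  proof -
    have "Re d > 0" "(sqrt N *\<^sub>R a) ^ k = 0" using * that p by auto
    then obtain e where "graded (2 * Re d) k (sqrt N *\<^sub>R a) e"
      using nilpotent_soliton_graded[OF soliton_scaled[OF assms]] by metis
    from graded_scale[OF this, of "1 / sqrt N"] assms(1)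
    have "graded ((1 / sqrt N)\<^sup>2 * (2 * Re d)) k a e" by simp
    then show ?thesis by blast
  qed
  then show ?thesis using * p by blast
qed

text \<open>Mixed cases do not occur: if one matrix is not normal it is nilpotent and nonzero, hence
  so is the similar one, and a nonzero nilpotent matrix is not normal. Scaling \<open>a\<close> by
  \<open>\<alpha>\<close> multiplies \<open>\<kappa>\<close> by \<open>\<alpha>\<^sup>2\<close>, so
  the square root of \<open>\<kappa>' / \<kappa>\<close> makes the two gradings comparable.\<close>

lemma soliton_unitary_equivalence:
  fixes a b E F T S :: "'n::finite cmat"
  assumes N: "N > 0" "K > 0"
    and a: "N *\<^sub>R (a * star a) = E + star E - (2 * Re d) *\<^sub>R 1" "E * a - a * E = csc d a"
    and b: "K *\<^sub>R (b * star b) = F + star F - (2 * Re c) *\<^sub>R 1" "F * b - b * F = csc c b"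
    and T: "a * T = T * b" "T * S = 1" "S * T = 1"
  obtains \<alpha> U where "\<alpha> > 0" "star U * U = 1" "U * star U = 1" "U * b = (\<alpha>::real) *\<^sub>R (a * U)"
proof (cases "a * star a = star a * a \<and> b * star b = star b * b")
  case True
  then have "star a * T = T * star b" using normal_star_intertwiner T(1) by blast
  then obtain U where "star U * U = 1" "U * star U = 1" "a * U = U * b"
    using polar_intertwiner T by metis
  then show ?thesis using that[of 1 U] by simp
next
  case False
  have nil_iff: "a ^ k = 0 \<longleftrightarrow> b ^ k = 0" for k
  proof -
    have "a ^ k = T * b ^ k * S" using intertwine_power[OF T(1), of k] T by (metis mult.assoc mult_1_right)
    moreover have "b ^ k = S * a ^ k * T" using intertwine_power[OF T(1), of k] T by (metis mult.assoc mult_1)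
    ultimately show ?thesis by auto
  qed
  obtain k where k: "a ^ k = 0" "b ^ k = 0"
    using soliton_normal_or_graded[OF N(1) a] soliton_normal_or_graded[OF N(2) b] False nil_iff by blast
  have "a = 0 \<longleftrightarrow> b = 0" using nil_iff[of 1] by simp
  then have "a \<noteq> 0" "b \<noteq> 0" using False by auto
  then have "a * star a \<noteq> star a * a" "b * star b \<noteq> star b * b"
    using normal_nilpotent_eq_0 k by blast+
  then obtain \<kappa> e \<kappa>' f where ga: "graded \<kappa> k a e" and gb: "graded \<kappa>' k b f"
    using soliton_normal_or_graded[OF N(1) a] soliton_normal_or_graded[OF N(2) b] k by blast
  define \<alpha> where "\<alpha> = sqrt (\<kappa>' / \<kappa>)"
  have \<kappa>: "\<kappa> > 0" "\<kappa>' > 0" using ga gb by (auto simp: graded_def)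
  then have \<alpha>: "\<alpha> > 0" "\<alpha>\<^sup>2 * \<kappa> = \<kappa>'" by (simp_all add: \<alpha>_def)
  define a' where "a' = \<alpha> *\<^sub>R a"
  have ga': "graded \<kappa>' k a' e" using graded_scale[OF ga \<alpha>(1)] by (simp add: \<alpha>(2) a'_def)
  obtain s s' where s: "s * s' = 1" "s' * s = 1" "s * a = \<alpha> *\<^sub>R (a * s)"
    using graded_rescale[OF ga \<alpha>(1)] by metis
  have sT: "a' * (s * T) = s * T * b"
  proof -
    have "a' * (s * T) = (s * a) * T" by (simp add: s(3) a'_def mult.assoc)
    then show ?thesis using T(1) by (simp add: mult.assoc)
  qed
  have "s * T * (S * s') = 1" using T s by (metis mult.assoc mult_1_right)
  from graded_intertwiner[OF ga' gb sT this cmat_inverse_commute[OF this]]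
  obtain T1 S1 where T1: "a' * T1 = T1 * b" "a' * star a' * T1 = T1 * (b * star b)" "T1 * S1 = 1" "S1 * T1 = 1"
    by blast
  have "a' ^ k = 0" "a' * star a' * a' - a' * (a' * star a') = \<kappa>' *\<^sub>R a'"
    and "b * star b * b - b * (b * star b) = \<kappa>' *\<^sub>R b" using ga' gb by (auto simp: graded_def)
  from nilpotent_star_intertwiner[OF this(1,2) k(2) this(3) T1]
  obtain T2 S2 where T2: "a' * T2 = T2 * b" "star a' * T2 = T2 * star b" "S2 * T2 = 1"
    by blast
  then obtain U where "star U * U = 1" "U * star U = 1" "a' * U = U * b"
    using polar_intertwiner by blast
  then show ?thesis using that[OF \<alpha>(1), of U] by (simp add: a'_def)
qed

section \<open>The matrix exponential\<close>

lemma mpow_eq: "mpow M k = mat_of (Cmat M ^ k)"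
proof (induction k)
  case (Suc k)
  have "mpow M (Suc k) = mpow M k ** M" by (simp add: mpow_def)
  then show ?case by (simp add: Suc times_cmat_def power_Suc2 del: power_Suc)
qed (simp add: mpow_def one_cmat_def)

text \<open>The two series live in different types; they are compared entry by entry, each entry
  being a bounded linear functional on \<open>cmat\<close>.\<close>

lemma mexp_eq: "mexp M = mat_of (exp (Cmat M))"
proof -
  have *: "(\<lambda>k. (1 / fact k) *\<^sub>R mpow M k) sums mat_of (exp (Cmat M))"
    unfolding sums_def
  proof (intro vec_tendstoI)
    fix i j
    have "(\<lambda>k. mat_of (Cmat M ^ k /\<^sub>R fact k) $ i $ j) sums (mat_of (exp (Cmat M)) $ i $ j)"
      by (intro bounded_linear.sums[OF bounded_linear_entry] exp_converges)
    then show "(\<lambda>n. (\<Sum>k<n. (1 / fact k) *\<^sub>R mpow M k) $ i $ j) \<longlonglongrightarrow> mat_of (exp (Cmat M)) $ i $ j"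
      unfolding sums_def by (simp add: mpow_eq scaleR_cmat_def inverse_eq_divide)
  qed
  then show ?thesis unfolding mexp_def by (simp add: sums_iff)
qed

text \<open>The source of most identities for exponentials below, each of which is first checked on
  generators.\<close>

lemma exp_intertwine:
  fixes x y z :: "'n::finite cmat"
  assumes "z * x = y * z"
  shows "z * exp x = exp y * z"
proof -
  have "z * (x ^ n /\<^sub>R fact n) = y ^ n /\<^sub>R fact n * z" for n
    using intertwine_power[of y z x n] assms by simp
  then have "(\<lambda>n. z * (x ^ n /\<^sub>R fact n)) sums (exp y * z)"
    using sums_mult2[OF exp_converges[of y], of z] by simp
  then show ?thesis using sums_mult[OF exp_converges[of x], of z] sums_unique2 by blast
qed

lemma exp_csc_add: "exp (csc (c + d) x) = exp (csc c x) * exp (csc d x)"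
  unfolding csc_add_left by (rule exp_add_commuting) (simp add: mult_ac)

lemma exp_csc_minus: "exp (csc (- c) x) * exp (csc c x) = 1" "exp (csc c x) * exp (csc (- c) x) = 1"
  using exp_csc_add[of "- c" c x] exp_csc_add[of c "- c" x] by simp_all

lemma norm_exp_remainder:
  fixes x :: "'n::finite cmat"
  assumes "norm x \<le> 1"
  shows "norm (exp x - 1 - x) \<le> (norm x)\<^sup>2"
proof -
  have s: "summable (\<lambda>n. inverse (fact (n + 2)) *\<^sub>R (norm x ^ (n + 2)))"
    by (rule summable_ignore_initial_segment, simp, rule summable_exp)
  have "exp x - 1 - x = (\<Sum>n. inverse (fact (n + 2)) *\<^sub>R (x ^ (n + 2)))"
    unfolding exp_first_two_terms[of x] by simp
  also have "norm \<dots> \<le> (\<Sum>n. inverse (fact (n + 2)) *\<^sub>R (norm x ^ (n + 2)))"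
    by (rule norm_suminf_le[OF _ s]) (simp add: norm_power_ineq mult_left_mono del: power_Suc)
  also have "\<dots> = exp (norm x) - 1 - norm x"
    unfolding exp_first_two_terms[of "norm x"] by simp
  also have "\<dots> \<le> (norm x)\<^sup>2"
    using exp_bound[OF norm_ge_zero assms] by simp
  finally show ?thesis .
qed

lemma bounded_linear_csc: "bounded_linear (\<lambda>c. csc c x)"
  by (rule bounded_linear_intro[where K = "norm x"])
    (simp_all add: csc_add_left norm_csc scaleR_conv_of_real[of _ "_::complex"] flip: csc_of_real)

text \<open>The parameter is complex and the derivative complex linear in \<open>h\<close>. At 0 it
  follows from the quadratic remainder bound, and the one-parameter law transports it to
  \<open>c\<close>.\<close>

lemma has_derivative_exp_csc:
  "((\<lambda>c. exp (csc c x)) has_derivative (\<lambda>h. csc h (x * exp (csc c x)))) (at c)"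
proof -
  have 0: "((\<lambda>c. exp (csc c x)) has_derivative (\<lambda>h. csc h x)) (at 0)"
  proof (rule has_derivativeI_sandwich[where H = "\<lambda>h. norm h * (norm x)\<^sup>2" and e = "1 / (norm x + 1)"])
    show "0 < 1 / (norm x + 1)" by (simp add: add_nonneg_pos)
    show "bounded_linear (\<lambda>h. csc h x)" by (rule bounded_linear_csc)
    show "((\<lambda>h::complex. norm h * (norm x)\<^sup>2) \<longlongrightarrow> 0) (at 0)"
      by (rule tendsto_eq_intros refl | simp)+
    fix y :: complex
    assume y: "y \<noteq> 0" "dist y 0 < 1 / (norm x + 1)"
    have "norm (csc y x) \<le> cmod y * (norm x + 1)" by (simp add: norm_csc mult_left_mono)
    also have "\<dots> \<le> 1" using y(2) by (simp add: pos_less_divide_eq add_nonneg_pos)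
    finally have "norm (exp (csc y x) - 1 - csc y x) \<le> (cmod y * norm x)\<^sup>2"
      using norm_exp_remainder[of "csc y x"] by (simp add: norm_csc)
    then show "norm (exp (csc y x) - exp (csc 0 x) - csc (y - 0) x) / norm (y - 0) \<le> norm y * (norm x)\<^sup>2"
      using y(1) by (simp add: power_mult_distrib power2_eq_square field_simps)
  qed
  have "((\<lambda>y. exp (csc (y - c) x)) has_derivative (\<lambda>h. csc h x)) (at c)"
    by (rule has_derivative_compose[of "\<lambda>y. y - c" "\<lambda>h. h" c UNIV "\<lambda>c. exp (csc c x)", simplified])
      (auto intro!: derivative_eq_intros 0)
  then have "((\<lambda>y. exp (csc (y - c) x) * exp (csc c x)) has_derivative (\<lambda>h. csc h x * exp (csc c x))) (at c)"
    by (rule has_derivative_mult_left)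
  then show ?thesis by (simp flip: exp_csc_add)
qed

lemma has_derivative_app_exp_csc:
  "((\<lambda>c. app (exp (csc c x)) v) has_derivative (\<lambda>h. h *s app (x * exp (csc c x)) v)) (at c)"
  using bounded_linear.has_derivative[OF bounded_bilinear.bounded_linear_left[OF bounded_bilinear_app] has_derivative_exp_csc]
  by (simp add: app_csc)

lemma has_field_derivative_exp_csc_entry:
  "((\<lambda>c. mat_of (exp (csc c x)) $ i $ j) has_field_derivative mat_of (x * exp (csc c x)) $ i $ j) (at c)"
  using bounded_linear.has_derivative[OF bounded_linear_entry[of i j] has_derivative_exp_csc[of x c]]
  unfolding has_field_derivative_def
  by (simp add: csc_def cmat_scale_def mult.commute[of _ "mat_of _ $ i $ j"])

section \<open>Left-invariant metrics\<close>

definition lift :: "complex^'n \<Rightarrow> complex^('n option)" where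
  "lift w = (\<chi> i. case i of None \<Rightarrow> 0 | Some a \<Rightarrow> w $ a)"

definition low :: "complex^('n option) \<Rightarrow> complex^'n" where
  "low u = (\<chi> a. u $ Some a)"

abbreviation "Z0 \<equiv> axis None (1::complex)"

lemma vec_option_eqI: "u $ None = v $ None \<Longrightarrow> low u = low v \<Longrightarrow> u = v"
  by (simp add: vec_eq_iff low_def) (metis not_Some_eq)

lemma lift_None [simp]: "lift w $ None = 0"
  and lift_Some [simp]: "lift w $ Some a = w $ a"
  and low_lift [simp]: "low (lift w) = w"
  and low_Z0 [simp]: "low Z0 = 0"
  and low_nth: "low u $ a = u $ Some a"
  by (simp_all add: lift_def low_def vec_eq_iff axis_def)

lemma low_simps: "low (u + v) = low u + low v" "low (u - v) = low u - low v" "low (c *s u) = c *s low u" "low 0 = 0"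
  by (simp_all add: low_def vec_eq_iff)

lemma lift_simps: "lift (u + v) = lift u + lift v" "lift (u - v) = lift u - lift v" "lift (c *s u) = c *s lift u" "lift 0 = 0"
  by (intro vec_option_eqI; simp add: low_simps)+

lemma sum_UNIV_option: "(\<Sum>i\<in>UNIV. f i) = f None + (\<Sum>a\<in>UNIV. f (Some (a::'n::finite)))"
  by (simp add: UNIV_option_conv sum.reindex)

text \<open>The adjoint action of \<open>Z0\<close> on the Lie algebra.\<close>

definition XA :: "complex^'n^'n \<Rightarrow> 'n option cmat" where
  "XA A = Cmat (extA A)"

text \<open>\<open>MA A (p $ None)\<close> is the differential of left translation by
  \<open>p\<close> at every point, left translations being affine in these coordinates.\<close>

definition MA :: "complex^'n^'n \<Rightarrow> complex \<Rightarrow> 'n option cmat" where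
  "MA A c = exp (csc c (XA A))"

lemma app_XA: "app (XA A) u = lift (A *v low u)"
proof (rule vec_option_eqI)
  show "app (XA A) u $ None = lift (A *v low u) $ None"
    by (simp add: app_expand XA_def extA_def)
  show "low (app (XA A) u) = low (lift (A *v low u))"
    by (simp add: vec_eq_iff low_nth app_expand XA_def extA_def sum_UNIV_option matrix_vector_mult_def)
qed

lemma muA_eq: "muA A u v = u $ None *s app (XA A) v - v $ None *s app (XA A) u"
  by (simp add: muA_def XA_def app_Cmat)

lemma muA_None [simp]: "muA A u v $ None = 0"
  by (simp add: muA_eq app_XA)

lemma MA_0 [simp]: "MA A 0 = 1"
  by (simp add: MA_def)

lemma MA_add: "MA A (c + d) = MA A c * MA A d"
  by (simp add: MA_def exp_csc_add)

lemma app_MA_inverse [simp]: "app (MA A (- c)) (app (MA A c) v) = v" "app (MA A c) (app (MA A (- c)) v) = v"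
  by (simp_all add: MA_def exp_csc_minus flip: app_mult)

text \<open>Writing the first coordinate as a matrix turns claims about it into intertwining
  relations, to which \<open>exp_intertwine\<close> applies.\<close>

lemma None_projection:
  obtains z :: "'n::finite option cmat" where "\<And>v. app z v = v $ None *s Z0"
proof -
  have "(u + v) $ None *s Z0 = u $ None *s Z0 + v $ None *s Z0" "(c *s v) $ None *s Z0 = c *s (v $ None *s Z0)"
    for u v :: "complex^('n option)" and c
    by (simp_all add: vec_eq_iff algebra_simps)
  from Cmat_of_linear[OF this] that show ?thesis by blast
qed

lemma app_MA_None [simp]: "app (MA A c) v $ None = v $ None"
proof -
  obtain z :: "'a option cmat" where z: "\<And>v. app z v = v $ None *s Z0"
    using None_projection by blast
  have "z * csc c (XA A) = 0 * z"
    by (rule cmat_eqI) (simp add: app_mult z app_csc app_XA)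
  from exp_intertwine[OF this] have "z * MA A c = z" by (simp add: MA_def)
  then have "app z (app (MA A c) v) $ None = app z v $ None" by (metis app_mult)
  then show ?thesis by (simp add: z)
qed

lemma app_MA_Z0 [simp]: "app (MA A c) Z0 = Z0"
proof -
  obtain z :: "'a option cmat" where z: "\<And>v. app z v = v $ None *s Z0"
    using None_projection by blast
  have "csc c (XA A) * z = 0"
    by (rule cmat_eqI) (simp add: app_mult z app_csc app_vscale app_XA lift_simps)
  then have "z * 0 = csc c (XA A) * z" by simp
  from exp_intertwine[OF this] have "MA A c * z = z" by (simp add: MA_def)
  then have "app (MA A c) (app z Z0) = app z Z0" by (metis app_mult)
  then show ?thesis by (simp add: z)
qed

lemma MA_XA: "MA A c * XA A = XA A * MA A c"
  unfolding MA_def by (rule exp_intertwine[symmetric]) simp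

lemma gmul_eq: "gmul A p q = p + app (MA A (p $ None)) q"
  by (simp add: gmul_def mexp_eq MA_def csc_def XA_def app_def)

lemma gmul_has_derivative: "(gmul A p has_derivative app (MA A (p $ None))) (at q)"
  unfolding gmul_eq[abs_def]
  by (auto intro!: derivative_eq_intros bounded_linear_imp_has_derivative[OF bounded_linear_app])

lemma frechet_gmul: "frechet_derivative (gmul A p) (at q) = app (MA A (p $ None))"
  by (metis frechet_derivative_at gmul_has_derivative)

lemma dL_eq: "dL A p = app (MA A (p $ None))"
  by (simp add: dL_def frechet_gmul)

lemma left_inv_metric_eq:
  assumes "left_inv_metric A g"
  shows "g p u v = g 0 (app (MA A (- p $ None)) u) (app (MA A (- p $ None)) v)"
proof -
  have "g (gmul A p 0) (app (MA A (p $ None)) x) (app (MA A (p $ None)) y) = g 0 x y" for x y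
    using assms unfolding left_inv_metric_def frechet_gmul by blast
  from this[of "app (MA A (- p $ None)) u" "app (MA A (- p $ None)) v"] show ?thesis
    by (simp add: gmul_eq)
qed

lemma left_inv_metricI:
  assumes H: "herm_form H"
  shows "left_inv_metric A (\<lambda>p u v. H (app (MA A (- p $ None)) u) (app (MA A (- p $ None)) v))"
  unfolding left_inv_metric_def frechet_gmul
proof (intro conjI allI)
  fix p :: "complex^('a option)"
  have "app (MA A (- p $ None)) u \<noteq> 0" if "u \<noteq> 0" for u
    using that by (metis app_0_right app_MA_inverse(2) vector_uminus_component)
  then show "herm_form (\<lambda>u v. H (app (MA A (- p $ None)) u) (app (MA A (- p $ None)) v))"
    using H unfolding herm_form_def app_add_right app_vscale by blast
next
  fix p q u v
  have "app (MA A (- gmul A p q $ None)) (app (MA A (p $ None)) u) = app (MA A (- q $ None)) u" for u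
    unfolding app_mult[symmetric] MA_add[symmetric] by (simp add: gmul_eq)
  then show "H (app (MA A (- gmul A p q $ None)) (app (MA A (p $ None)) u)) (app (MA A (- gmul A p q $ None)) (app (MA A (p $ None)) v))
     = H (app (MA A (- q $ None)) u) (app (MA A (- q $ None)) v)"
    by simp
qed

section \<open>Holomorphic vector fields\<close>

lemma holo_has_derivative: "holo Z \<Longrightarrow> (Z has_derivative frechet_derivative Z (at p)) (at p)"
  by (simp add: holo_def frechet_derivative_works[symmetric])

lemma holo_continuous: "holo Z \<Longrightarrow> continuous_on UNIV Z"
  by (meson continuous_at_imp_continuous_on has_derivative_continuous holo_has_derivative)

lemma frechet_vscale: "holo Z \<Longrightarrow> frechet_derivative Z (at p) (c *s v) = c *s frechet_derivative Z (at p) v"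
  by (simp add: holo_def)

lemma frechet_add: "holo Z \<Longrightarrow> frechet_derivative Z (at p) (u + v) = frechet_derivative Z (at p) u + frechet_derivative Z (at p) v"
  using has_derivative_linear[OF holo_has_derivative, of Z p] linear_add by blast

lemma bounded_linear_vscale: "bounded_linear (\<lambda>c. c *s (v::complex^'m))"
  by (rule bounded_linear_intro[where K = "norm v"])
    (simp_all add: vec_eq_iff algebra_simps norm_vscale)

lemma holo_line_derivative:
  assumes "holo Z"
  shows "((\<lambda>s. Z (p + s *s w) $ i) has_field_derivative frechet_derivative Z (at (p + s *s w)) w $ i) (at s)"
proof -
  have "((\<lambda>s. p + s *s w) has_derivative (\<lambda>h. h *s w)) (at s)"
    by (auto intro!: derivative_eq_intros bounded_linear_imp_has_derivative[OF bounded_linear_vscale])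
  then have "((\<lambda>s. Z (p + s *s w)) has_derivative (\<lambda>h. frechet_derivative Z (at (p + s *s w)) (h *s w))) (at s)"
    by (rule has_derivative_compose) (rule holo_has_derivative[OF assms])
  then have "((\<lambda>s. Z (p + s *s w) $ i) has_derivative (\<lambda>h. frechet_derivative Z (at (p + s *s w)) (h *s w) $ i)) (at s)"
    by (rule bounded_linear.has_derivative[OF bounded_linear_vec_nth])
  then show ?thesis
    unfolding has_field_derivative_def by (simp add: frechet_vscale[OF assms] mult_commute_abs)
qed

text \<open>Unit discs centred in the unit disc stay in the disc of radius 2, so Cauchy's inequality
  bounds the second derivative by \<open>2 * B\<close>; Taylor's formula does the rest. The bound
  depends on \<open>f\<close> only through \<open>B\<close>, hence is uniform in parameters.\<close>

lemma entire_difference_quotient: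
  assumes f: "f holomorphic_on UNIV" and B: "\<And>z. norm z \<le> 2 \<Longrightarrow> norm (f z) \<le> B" and h: "norm h \<le> 1"
  shows "norm (f h - f 0 - h * deriv f 0) \<le> 2 * B * (norm h)\<^sup>2"
proof -
  have "norm ((deriv ^^ 2) f z) \<le> fact 2 * B / 1 ^ 2" if "norm z \<le> 1" for z
  proof (rule Cauchy_inequality)
    show "f holomorphic_on ball z 1" using f by (rule holomorphic_on_subset) simp
    show "continuous_on (cball z 1) f" using f holomorphic_on_imp_continuous_on continuous_on_subset by blast
    show "norm (f x) \<le> B" if "norm (z - x) = 1" for x
    proof (rule B)
      have "norm x \<le> norm z + norm (z - x)" by (metis norm_minus_commute norm_triangle_sub)
      then show "norm x \<le> 2" using that \<open>norm z \<le> 1\<close> by simp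
    qed
  qed simp
  then have d2: "norm ((deriv ^^ 2) f z) \<le> 2 * B" if "z \<in> cball 0 1" for z using that by simp
  have "norm ((deriv ^^ 0) f h - (\<Sum>i\<le>1. (deriv ^^ i) f 0 * (h - 0) ^ i / fact i)) \<le> 2 * B * norm (h - 0) ^ Suc 1 / fact 1"
  proof (rule field_Taylor[where S = "cball 0 1" and f = "\<lambda>i. (deriv ^^ i) f"])
    show "((deriv ^^ i) f has_field_derivative (deriv ^^ Suc i) f x) (at x within cball 0 1)" for i x
      using holomorphic_derivI[OF holomorphic_higher_deriv[OF f open_UNIV], of x i "cball 0 1"] by simp
    show "norm ((deriv ^^ Suc 1) f x) \<le> 2 * B" if "x \<in> cball 0 1" for x
      using d2[OF that] by (simp add: numeral_2_eq_2)
  qed (use h in auto)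
  then show ?thesis by (simp add: power2_eq_square mult.commute diff_diff_eq)
qed

text \<open>Difference quotients converge locally uniformly, so Weierstrass' theorem differentiates the partial
  derivatives and exchanges their order.\<close>

lemma holo_partial_derivative:
  fixes Z :: "complex^'m \<Rightarrow> complex^'m"
  assumes Z: "holo Z"
  shows "\<exists>G. \<forall>s. ((\<lambda>s. frechet_derivative Z (at (p + s *s w)) v $ i) has_field_derivative G s) (at s) \<and>
    (\<lambda>n. (frechet_derivative Z (at (p + s *s w + (1 / of_nat (Suc n)) *s v)) w $ i
          - frechet_derivative Z (at (p + s *s w)) w $ i) / (1 / of_nat (Suc n))) \<longlonglongrightarrow> G s"
proof -
  let ?D = "\<lambda>q. frechet_derivative Z (at q)"
  define h :: "nat \<Rightarrow> complex" where "h n = 1 / of_nat (Suc n)" for n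
  have h0: "h n \<noteq> 0" for n by (simp add: h_def del: of_nat_Suc)
  have h1: "norm (h n) \<le> 1" for n by (simp add: h_def norm_divide del: of_nat_Suc)
  have hlim: "(\<lambda>n. norm (h n)) \<longlonglongrightarrow> 0"
    using LIMSEQ_inverse_real_of_nat by (simp add: h_def norm_divide inverse_eq_divide del: of_nat_Suc)
  have "\<exists>g'. \<forall>s\<in>UNIV. ((\<lambda>s. ?D (p + s *s w) v $ i) has_field_derivative g' s) (at s) \<and>
      (\<lambda>n. (?D (p + s *s w + h n *s v) w $ i - ?D (p + s *s w) w $ i) / h n) \<longlonglongrightarrow> g' s"
  proof (rule has_complex_derivative_uniform_sequence[OF open_UNIV,
        where f = "\<lambda>n s. (Z (p + s *s w + h n *s v) $ i - Z (p + s *s w) $ i) / h n"])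
    fix n s
    have "((\<lambda>s. Z ((p + h n *s v) + s *s w) $ i) has_field_derivative ?D ((p + h n *s v) + s *s w) w $ i) (at s)"
      by (rule holo_line_derivative[OF Z])
    then have "((\<lambda>s. Z (p + s *s w + h n *s v) $ i) has_field_derivative ?D (p + s *s w + h n *s v) w $ i) (at s)"
      by (simp add: add_ac)
    then show "((\<lambda>s. (Z (p + s *s w + h n *s v) $ i - Z (p + s *s w) $ i) / h n) has_field_derivative
        (?D (p + s *s w + h n *s v) w $ i - ?D (p + s *s w) w $ i) / h n) (at s)"
      by (intro DERIV_cdivide DERIV_diff holo_line_derivative[OF Z])
  next
    fix x :: complex
    have cont: "continuous_on (cball x 1 \<times> cball 0 2) (\<lambda>y. Z (p + fst y *s w + snd y *s v) $ i)"
      by (intro continuous_intros continuous_on_compose2[OF holo_continuous[OF Z]]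
          continuous_on_compose2[OF linear_continuous_on[OF bounded_linear_vscale]]) auto
    have "compact ((\<lambda>y. Z (p + fst y *s w + snd y *s v) $ i) ` (cball x 1 \<times> cball 0 2))"
      by (intro compact_continuous_image cont compact_Times compact_cball)
    then have "bounded ((\<lambda>y. Z (p + fst y *s w + snd y *s v) $ i) ` (cball x 1 \<times> cball 0 2))"
      by (rule compact_imp_bounded)
    then obtain B where "\<forall>y\<in>cball x 1 \<times> cball 0 2. norm (Z (p + fst y *s w + snd y *s v) $ i) \<le> B"
      unfolding bounded_iff by blast
    then have B: "norm (Z (p + s *s w + z *s v) $ i) \<le> B" if "s \<in> cball x 1" "z \<in> cball 0 2" for s z
      using that by force
    have est: "norm ((Z (p + s *s w + h n *s v) $ i - Z (p + s *s w) $ i) / h n - ?D (p + s *s w) v $ i) \<le> 2 * B * norm (h n)"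
      if "s \<in> cball x 1" for n s
    proof -
      define f where "f z = Z (p + s *s w + z *s v) $ i" for z
      have der: "(f has_field_derivative ?D (p + s *s w + z *s v) v $ i) (at z)" for z
        unfolding f_def by (rule holo_line_derivative[OF Z])
      then have "f holomorphic_on UNIV"
        by (auto simp: holomorphic_on_def field_differentiable_def)
      moreover have "norm (f z) \<le> B" if "norm z \<le> 2" for z
        using B[OF \<open>s \<in> cball x 1\<close>, of z] that by (simp add: f_def)
      moreover have "deriv f 0 = ?D (p + s *s w) v $ i" using DERIV_imp_deriv[OF der[of 0]] by simp
      ultimately have est: "norm (f (h n) - f 0 - h n * ?D (p + s *s w) v $ i) \<le> 2 * B * (norm (h n))\<^sup>2"
        using entire_difference_quotient[of f B "h n"] h1[of n] by simp
      have "norm ((f (h n) - f 0) / h n - ?D (p + s *s w) v $ i) = norm (f (h n) - f 0 - h n * ?D (p + s *s w) v $ i) / norm (h n)"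
        using h0[of n] by (simp add: field_simps flip: norm_divide)
      also have "\<dots> \<le> 2 * B * (norm (h n))\<^sup>2 / norm (h n)" by (rule divide_right_mono[OF est]) simp
      finally show ?thesis using h0[of n] by (simp add: f_def power2_eq_square)
    qed
    have "uniform_limit (cball x 1) (\<lambda>n s. (Z (p + s *s w + h n *s v) $ i - Z (p + s *s w) $ i) / h n)
        (\<lambda>s. ?D (p + s *s w) v $ i) sequentially"
    proof (rule uniform_limitI)
      fix e :: real assume "e > 0"
      have "(\<lambda>n. 2 * B * norm (h n)) \<longlonglongrightarrow> 0" using tendsto_mult_right_zero[OF hlim] by simp
      then have "\<forall>\<^sub>F n in sequentially. 2 * B * norm (h n) < e"
        using \<open>e > 0\<close> by (rule order_tendstoD)
      then show "\<forall>\<^sub>F n in sequentially. \<forall>s\<in>cball x 1.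
          dist ((Z (p + s *s w + h n *s v) $ i - Z (p + s *s w) $ i) / h n) (?D (p + s *s w) v $ i) < e"
      proof (rule eventually_mono, intro ballI)
        fix n s assume "2 * B * norm (h n) < e" "s \<in> cball x 1"
        then show "dist ((Z (p + s *s w + h n *s v) $ i - Z (p + s *s w) $ i) / h n) (?D (p + s *s w) v $ i) < e"
          unfolding dist_norm using est[of s n] by linarith
      qed
    qed
    then show "\<exists>d>0. cball x d \<subseteq> UNIV \<and> uniform_limit (cball x d)
        (\<lambda>n s. (Z (p + s *s w + h n *s v) $ i - Z (p + s *s w) $ i) / h n) (\<lambda>s. ?D (p + s *s w) v $ i) sequentially"
      by (intro exI[of _ 1]) simp
  qed
  then show ?thesis unfolding h_def by simp
qed

lemma holo_partial_holomorphic: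
  assumes "holo Z"
  shows "(\<lambda>s. frechet_derivative Z (at (p + s *s w)) v $ i) holomorphic_on S"
proof -
  obtain G where "\<And>s. ((\<lambda>s. frechet_derivative Z (at (p + s *s w)) v $ i) has_field_derivative G s) (at s)"
    using holo_partial_derivative[OF assms, of p w v i] by auto
  then show ?thesis
    unfolding holomorphic_on_def field_differentiable_def using has_field_derivative_at_within by blast
qed

text \<open>The function \<open>G\<close> of \<open>holo_partial_derivative\<close> takes the value
  \<open>a\<close> at 0 by uniqueness of derivatives, and the value \<open>b\<close> as a limit of
  difference quotients of the other partial derivative along \<open>1 / Suc n\<close>.\<close>

lemma holo_mixed_partials:
  assumes Z: "holo Z"
    and a: "((\<lambda>s. frechet_derivative Z (at (p + s *s w)) v $ i) has_field_derivative a) (at 0)"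
    and b: "((\<lambda>s. frechet_derivative Z (at (p + s *s v)) w $ i) has_field_derivative b) (at 0)"
  shows "a = b"
proof -
  obtain G where "\<forall>s. ((\<lambda>s. frechet_derivative Z (at (p + s *s w)) v $ i) has_field_derivative G s) (at s) \<and>
    (\<lambda>n. (frechet_derivative Z (at (p + s *s w + (1 / of_nat (Suc n)) *s v)) w $ i
          - frechet_derivative Z (at (p + s *s w)) w $ i) / (1 / of_nat (Suc n))) \<longlonglongrightarrow> G s"
    using holo_partial_derivative[OF Z, of p w v i] by (rule exE)
  then have G: "((\<lambda>s. frechet_derivative Z (at (p + s *s w)) v $ i) has_field_derivative G 0) (at 0)"
    "(\<lambda>n. (frechet_derivative Z (at (p + 0 *s w + (1 / of_nat (Suc n)) *s v)) w $ i
          - frechet_derivative Z (at (p + 0 *s w)) w $ i) / (1 / of_nat (Suc n))) \<longlonglongrightarrow> G 0"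
    by (rule allE[of _ 0], simp)+
  have aG: "a = G 0" using a G(1) by (rule DERIV_unique)
  have "(\<lambda>n. 1 / of_nat (Suc n) :: complex) \<longlonglongrightarrow> 0"
    by (rule tendsto_norm_zero_cancel)
      (use LIMSEQ_inverse_real_of_nat in \<open>simp add: norm_divide inverse_eq_divide del: of_nat_Suc\<close>)
  then have "filterlim (\<lambda>n. 1 / of_nat (Suc n) :: complex) (at 0) sequentially"
    by (rule filterlim_atI) (simp del: of_nat_Suc)
  moreover have "((\<lambda>h. (frechet_derivative Z (at (p + h *s v)) w $ i - frechet_derivative Z (at p) w $ i) / h) \<longlongrightarrow> b) (at 0)"
    using b by (simp add: DERIV_def)
  ultimately have "(\<lambda>n. (frechet_derivative Z (at (p + (1 / of_nat (Suc n)) *s v)) w $ i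
          - frechet_derivative Z (at p) w $ i) / (1 / of_nat (Suc n))) \<longlonglongrightarrow> b"
    using filterlim_compose by fast
  with G(2) have "G 0 = b" using LIMSEQ_unique by simp
  then show ?thesis using aG by simp
qed

text \<open>Liouville's theorem for \<open>exp (f z)\<close>, whose modulus is constant;
  differentiating and cancelling the exponential leaves a zero derivative of
  \<open>f\<close>.\<close>

lemma entire_constant_Re:
  assumes f: "f holomorphic_on UNIV" and c: "\<And>z. Re (f z) = c"
  shows "f z = f 0"
proof -
  have "(\<lambda>z. exp (f z)) holomorphic_on UNIV" by (intro holomorphic_intros f)
  moreover have "bounded (range (\<lambda>z. exp (f z)))" by (auto simp: bounded_iff c)
  ultimately have ec: "(\<lambda>z. exp (f z)) constant_on UNIV" using Liouville_theorem by blast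
  have "(f has_field_derivative 0) (at z)" for z
  proof -
    have d: "(f has_field_derivative deriv f z) (at z)" using f by (simp add: holomorphic_derivI)
    then have "((\<lambda>z. exp (f z)) has_field_derivative exp (f z) * deriv f z) (at z)" by (rule DERIV_fun_exp)
    moreover have "((\<lambda>z. exp (f z)) has_field_derivative 0) (at z)"
      using ec by (metis (no_types, lifting) DERIV_const UNIV_I constant_on_def ext)
    ultimately have "deriv f z = 0" using DERIV_unique by force
    then show ?thesis using d by simp
  qed
  then obtain k where "\<And>z. f z = k"
    using has_field_derivative_zero_constant[OF convex_UNIV, of f] by auto
  then show ?thesis by simp
qed

section \<open>Solitons are algebraic\<close>

lemma herm_formD:
  assumes "herm_form H"
  shows "H (u + v) w = H u w + H v w" "H w (u + v) = H w u + H w v" "H (c *s u) v = c * H u v" "H u (c *s v) = cnj c * H u v"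
    "cnj (H u v) = H v u" "H (u - v) w = H u w - H v w" "H w (u - v) = H w u - H w v" "H 0 w = 0" "H w 0 = 0"
    "u \<noteq> 0 \<Longrightarrow> Re (H u u) > 0"
proof -
  have 1: "H (u + v) w = H u w + H v w" "H (c *s u) v = c * H u v" and 2: "H u v = cnj (H v u)" for u v w c
    using assms unfolding herm_form_def by blast+
  show "H (u + v) w = H u w + H v w" "H (c *s u) v = c * H u v" by (fact 1)+
  show 3: "H w (u + v) = H w u + H w v" for w u v by (simp only: 2[of w] 1 complex_cnj_add)
  show 4: "H u (c *s v) = cnj c * H u v" for u c v by (simp only: 2[of u] 1 complex_cnj_mult)
  show "cnj (H u v) = H v u" using 2 by metis
  have m: "- v = (-1) *s v" for v :: "complex^'a" by (simp add: vec_eq_iff)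
  show "H (u - v) w = H u w - H v w" using 1(1)[of u "- v" w] 1(2)[of "-1" v w] by (simp only: m) (simp flip: m)
  show "H w (u - v) = H w u - H w v" using 3[of w u "- v"] 4[of w "-1" v] by (simp only: m) (simp flip: m)
  show "H 0 w = 0" "H w 0 = 0" using 1(2)[of 0 0 w] 4[of w 0 0] by simp_all
  show "u \<noteq> 0 \<Longrightarrow> Re (H u u) > 0" using assms unfolding herm_form_def by blast
qed

lemma herm_form_bounded_bilinear:
  assumes "herm_form H"
  shows "bounded_bilinear H"
proof -
  have "bilinear H"
    unfolding bilinear_def
    by (intro conjI allI linearI)
      (simp_all add: herm_formD[OF assms] flip: vscale_real, simp_all add: scaleR_conv_of_real)
  then show ?thesis by (simp add: bilinear_conv_bounded_bilinear)
qed

lemma herm_form_expand: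
  assumes "herm_form H"
  shows "H u v = (\<Sum>i\<in>UNIV. u $ i * H (axis i 1) v)"
proof -
  have s: "H (sum f I) v = (\<Sum>i\<in>I. H (f i) v)" for f and I :: "'a set"
    by (induction I rule: infinite_finite_induct) (simp_all add: herm_formD[OF assms])
  have "H u v = H (\<Sum>i\<in>UNIV. u $ i *s axis i 1) v" by (simp add: basis_expansion)
  then show ?thesis by (simp add: s herm_formD[OF assms])
qed

text \<open>In these coordinates a left-invariant metric depends only on the first coordinate of the
  point, so differentiating it along \<open>Z\<close> produces just the terms with
  \<open>Z p $ None\<close> and the adjoint action of \<open>Z0\<close>.\<close>

lemma lie_deriv_left_invariant:
  assumes g: "left_inv_metric A g" and Z: "holo Z"
  shows "lie_deriv Z g p (app (MA A (p $ None)) u) (app (MA A (p $ None)) v) =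
     g 0 (app (MA A (- p $ None)) (frechet_derivative Z (at p) (app (MA A (p $ None)) u)) - Z p $ None *s app (XA A) u) v
   + g 0 u (app (MA A (- p $ None)) (frechet_derivative Z (at p) (app (MA A (p $ None)) v)) - Z p $ None *s app (XA A) v)"
proof -
  define H where "H = g 0"
  have H: "herm_form H" using g by (simp add: left_inv_metric_def H_def)
  note g_eq = left_inv_metric_eq[OF g, folded H_def]
  define z where "z = Z p $ None"
  have shift: "app (MA A (- (p + t *\<^sub>R Z p) $ None)) (app (MA A (p $ None)) u) = app (MA A (of_real t * - z)) u" for t u
    unfolding app_mult[symmetric] MA_add[symmetric] by (simp add: z_def scaleR_conv_of_real[of _ "Z p $ None"])
  have vd: "((\<lambda>t. app (MA A (of_real t * - z)) u) has_vector_derivative - (z *s app (XA A) u)) (at 0)" for u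
  proof -
    have "((\<lambda>t. of_real t * - z) has_derivative (\<lambda>h. of_real h * - z)) (at 0)"
      by (auto intro!: derivative_eq_intros)
    then have "((\<lambda>t. app (exp (csc (of_real t * - z) (XA A))) u) has_derivative
        (\<lambda>h. (of_real h * - z) *s app (XA A * exp (csc (of_real 0 * - z) (XA A))) u)) (at 0)"
      by (rule has_derivative_compose[of "\<lambda>t. of_real t * - z" _ 0 UNIV "\<lambda>c. app (exp (csc c (XA A))) u"])
        (rule has_derivative_app_exp_csc)
    moreover have "(of_real h * - z) *s app (XA A) u = h *\<^sub>R - (z *s app (XA A) u)" for h
      unfolding vscale_real[symmetric] by (simp add: vec_eq_iff)
    ultimately show ?thesis
      unfolding has_vector_derivative_def MA_def by simp
  qed
  have "((\<lambda>t. H (app (MA A (of_real t * - z)) u) (app (MA A (of_real t * - z)) v)) has_vector_derivative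
     H (app (MA A (of_real 0 * - z)) u) (- (z *s app (XA A) v)) + H (- (z *s app (XA A) u)) (app (MA A (of_real 0 * - z)) v)) (at 0)"
    by (rule bounded_bilinear.has_vector_derivative[OF herm_form_bounded_bilinear[OF H] vd vd])
  then have "vector_derivative (\<lambda>t. g (p + t *\<^sub>R Z p) (app (MA A (p $ None)) u) (app (MA A (p $ None)) v)) (at 0)
     = H u (- (z *s app (XA A) v)) + H (- (z *s app (XA A) u)) v"
    unfolding g_eq[of "p + _ *\<^sub>R Z p"] shift by (intro vector_derivative_at) simp
  moreover have "H u (- x) = - H u x" "H (- x) u = - H x u" for u x
    using herm_formD(6)[OF H, of 0 x u] herm_formD(7)[OF H, of u 0 x] by (simp_all add: herm_formD(8,9)[OF H])
  ultimately show ?thesis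
    unfolding lie_deriv_def g_eq[of p] H_def[symmetric]
    by (simp add: herm_formD(6,7)[OF H] z_def)
qed

text \<open>Pulled back to the identity, the endomorphism \<open>u \<mapsto> - [Z, u]\<close> depends holomorphically on the point, while its
  Hermitian part is constant; so it is constant, and the Jacobi identity makes it a derivation.\<close>

lemma soliton_derivation:
  assumes "hcf_soliton A g"
  obtains lam :: real and D where
    "\<And>u v. ThetaE A (g 0) u v = of_real lam * g 0 u v + g 0 (app D u) v + g 0 u (app D v)"
    "\<And>u v. app D (muA A u v) = muA A (app D u) v + muA A u (app D v)"
proof -
  obtain lam Z where g: "left_inv_metric A g" and Z: "holo Z"
    and eq: "\<And>p u v. ThetaE A (g 0) u v = of_real lam * g p (dL A p u) (dL A p v) + lie_deriv Z g p (dL A p u) (dL A p v)"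
    using assms unfolding hcf_soliton_def by blast
  define H where "H = g 0"
  have H: "herm_form H" using g by (simp add: left_inv_metric_def H_def)
  define K where "K p u = app (MA A (- p $ None)) (frechet_derivative Z (at p) (app (MA A (p $ None)) u)) - Z p $ None *s app (XA A) u" for p u
  have K: "ThetaE A H u v - of_real lam * H u v = H (K p u) v + H u (K p v)" for p u v
    using eq[of u v p] unfolding dL_eq lie_deriv_left_invariant[OF g Z] left_inv_metric_eq[OF g, of p]
    by (simp add: H_def K_def)
  have fD_expand: "frechet_derivative Z (at q) y $ j = (\<Sum>k\<in>UNIV. y $ k * frechet_derivative Z (at q) (axis k 1) $ j)" for q y j
  proof -
    have s: "frechet_derivative Z (at q) (sum f I) = (\<Sum>i\<in>I. frechet_derivative Z (at q) (f i))" for f and I :: "'a option set"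
      using linear_sum[OF has_derivative_linear[OF holo_has_derivative[OF Z]]] by blast
    have "frechet_derivative Z (at q) y = frechet_derivative Z (at q) (\<Sum>k\<in>UNIV. y $ k *s axis k 1)"
      by (simp add: basis_expansion)
    then show ?thesis by (simp add: s frechet_vscale[OF Z])
  qed
  have hol: "(\<lambda>s. K (s *s w) u $ i) holomorphic_on UNIV" for w u i
  proof -
    have m: "(\<lambda>s. mat_of (MA A (s * c)) $ i $ j) holomorphic_on UNIV" for i j c
    proof -
      have "(\<lambda>c. mat_of (MA A c) $ i $ j) holomorphic_on UNIV"
        unfolding MA_def holomorphic_on_def field_differentiable_def
        using has_field_derivative_exp_csc_entry has_field_derivative_at_within by blast
      then show ?thesis
        using holomorphic_on_compose_gen[of "\<lambda>s. s * c" UNIV "\<lambda>c. mat_of (MA A c) $ i $ j" UNIV]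
        by (simp add: o_def holomorphic_intros)
    qed
    have m': "(\<lambda>s. mat_of (MA A (- (s * w $ None))) $ i $ j) holomorphic_on UNIV" for i j
      using m[of "- w $ None" i j] by simp
    have d: "(\<lambda>s. frechet_derivative Z (at (s *s w)) v $ j) holomorphic_on UNIV" for v j
      using holo_partial_holomorphic[OF Z, of 0 w v j UNIV] by simp
    have z: "(\<lambda>s. Z (s *s w) $ None) holomorphic_on UNIV"
      using holo_line_derivative[OF Z, of 0 w None] unfolding holomorphic_on_def field_differentiable_def
      by (auto intro: has_field_derivative_at_within)
    show ?thesis
      unfolding K_def vector_minus_component app_expand[of "MA A _"] fD_expand[of _ "app _ _"] vector_smult_component vector_uminus_component
      by (intro holomorphic_intros m m' d z)
  qed
  have HK: "(\<lambda>s. H (K (s *s w) u) v) holomorphic_on UNIV" for w u v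
    unfolding herm_form_expand[OF H, of "K _ _"] by (intro holomorphic_intros hol)
  \<comment> \<open>The soliton equation prescribes the real part of \<open>H (K p u) u\<close>
    independently of \<open>p\<close>, and along the complex line through 0 and \<open>p\<close>
    this is an entire function.\<close>
  have diag: "H (K p u) u = H (K 0 u) u" for p u
  proof -
    have "H (K (1 *s p) u) u = H (K (0 *s p) u) u"
    proof (rule entire_constant_Re[OF HK, where c = "Re (ThetaE A H u u - of_real lam * H u u) / 2"])
      fix s
      have "H u (K (s *s p) u) = cnj (H (K (s *s p) u) u)" by (simp add: herm_formD(5)[OF H])
      then show "Re (H (K (s *s p) u) u) = Re (ThetaE A H u u - of_real lam * H u u) / 2"
        unfolding K[of u u "s *s p"] by simp
    qed
    then show ?thesis by simp
  qed
  have Kadd: "K p (u + v) = K p u + K p v" for p u v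
    unfolding K_def app_add_right frechet_add[OF Z] by (simp add: vec_eq_iff algebra_simps)
  have Ksc: "K p (c *s u) = c *s K p u" for p c u
    unfolding K_def app_vscale frechet_vscale[OF Z] by (simp add: vec_eq_iff algebra_simps)
  \<comment> \<open>The symmetrised relation for \<open>u\<close> and for \<open>\<i> *s u\<close>
    separates the two polarisation terms.\<close>
  have polar: "H (K p u) v = H (K 0 u) v" for p u v
  proof -
    have 1: "H (K p u) v + H (K p v) u = H (K 0 u) v + H (K 0 v) u" for u v
      using diag[of p "u + v"] diag[of p u] diag[of p v] by (simp add: Kadd herm_formD[OF H] add.commute)
    have "\<i> * (H (K p u) v - H (K p v) u) = \<i> * (H (K 0 u) v - H (K 0 v) u)"
      using 1[of "\<i> *s u" v] by (simp add: Ksc herm_formD[OF H] right_diff_distrib)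
    then have "H (K p u) v - H (K p v) u = H (K 0 u) v - H (K 0 v) u" by simp
    with 1[of u v] show ?thesis by (simp add: complex_eq_iff)
  qed
  have Kconst: "K p u = K 0 u" for p u
  proof (rule ccontr)
    assume "K p u \<noteq> K 0 u"
    then have "Re (H (K p u - K 0 u) (K p u - K 0 u)) > 0" by (intro herm_formD(10)[OF H]) simp
    moreover have "H (K p u - K 0 u) v = 0" for v using polar[of p u v] by (simp add: herm_formD[OF H])
    ultimately show False by simp
  qed
  obtain D where D: "\<And>u. app D u = K 0 u"
    using Cmat_of_linear[OF Kadd[of 0] Ksc[of 0]] by blast
  have DZ: "frechet_derivative Z (at p) w = app (MA A (p $ None) * D * MA A (- p $ None)) w + Z p $ None *s app (XA A) w" for p w
  proof -
    have "app (MA A (p $ None)) (K p (app (MA A (- p $ None)) w)) =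
       frechet_derivative Z (at p) w - Z p $ None *s app (MA A (p $ None)) (app (XA A) (app (MA A (- p $ None)) w))"
      by (simp add: K_def app_diff_right app_vscale)
    also have "app (MA A (p $ None)) (app (XA A) (app (MA A (- p $ None)) w)) = app (XA A) w"
      by (metis MA_XA app_MA_inverse(2) app_mult)
    finally show ?thesis by (simp add: Kconst[of p] D[symmetric] app_mult)
  qed
  have DZ0: "frechet_derivative Z (at 0) w $ None = app D w $ None" for w
    by (simp add: DZ app_XA)
  \<comment> \<open>\<open>DZ\<close> expresses the first derivatives of \<open>Z\<close> through
    \<open>D\<close> and \<open>Z $ None\<close>. One more derivative at 0 gives a mixed second
    derivative of \<open>Z\<close>, and its symmetry in \<open>u\<close> and \<open>v\<close> is the
    derivation identity.\<close>
  have mixed: "((\<lambda>s. frechet_derivative Z (at (0 + s *s u)) v $ i) has_field_derivative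
      (u $ None *s (app (XA A) (app D v) - app D (app (XA A) v)) + app D u $ None *s app (XA A) v) $ i) (at 0)" for u v i
  proof -
    let ?X = "csc (u $ None) (XA A)"
    have MA: "MA A (s * u $ None) = exp (csc s ?X)" "MA A (- (s * u $ None)) = exp (csc s (- ?X))" for s
    proof -
      have "csc s (- ?X) = csc (- (s * u $ None)) (XA A)"
        by (rule cmat_eqI) (simp add: app_csc app_minus vec_eq_iff)
      then show "MA A (s * u $ None) = exp (csc s ?X)" "MA A (- (s * u $ None)) = exp (csc s (- ?X))"
        by (simp_all add: MA_def)
    qed
    have 1: "((\<lambda>s. exp (csc s ?X)) has_derivative (\<lambda>h. csc h (?X * exp (csc 0 ?X)))) (at 0)"
      and 2: "((\<lambda>s. exp (csc s (- ?X))) has_derivative (\<lambda>h. csc h (- ?X * exp (csc 0 (- ?X))))) (at 0)"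
      by (rule has_derivative_exp_csc)+
    have "((\<lambda>s. exp (csc s ?X) * D * exp (csc s (- ?X))) has_derivative
       (\<lambda>h. exp (csc 0 ?X) * D * csc h (- ?X * exp (csc 0 (- ?X))) + csc h (?X * exp (csc 0 ?X)) * D * exp (csc 0 (- ?X)))) (at 0)"
      by (rule has_derivative_mult[OF has_derivative_mult_left[OF 1] 2])
    then have "((\<lambda>s. exp (csc s ?X) * D * exp (csc s (- ?X))) has_derivative (\<lambda>h. csc h (?X * D - D * ?X))) (at 0)"
      by (simp add: csc_diff_right csc_minus_right algebra_simps)
    from bounded_linear.has_derivative[OF bounded_linear_compose[OF bounded_linear_vec_nth bounded_bilinear.bounded_linear_left[OF bounded_bilinear_app]] this]
    have "((\<lambda>s. app (exp (csc s ?X) * D * exp (csc s (- ?X))) v $ i) has_derivative (\<lambda>h. app (csc h (?X * D - D * ?X)) v $ i)) (at 0)" .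
    then have A: "((\<lambda>s. app (exp (csc s ?X) * D * exp (csc s (- ?X))) v $ i) has_field_derivative app (?X * D - D * ?X) v $ i) (at 0)"
      unfolding has_field_derivative_def by (simp add: app_csc mult_commute_abs)
    have B: "((\<lambda>s. Z (0 + s *s u) $ None) has_field_derivative app D u $ None) (at 0)"
      using holo_line_derivative[OF Z, of 0 u None 0] by (simp add: DZ0)
    have "((\<lambda>s. app (exp (csc s ?X) * D * exp (csc s (- ?X))) v $ i + Z (0 + s *s u) $ None * app (XA A) v $ i) has_field_derivative
       app (?X * D - D * ?X) v $ i + app D u $ None * app (XA A) v $ i) (at 0)"
      by (intro DERIV_add A DERIV_cmult_right B)
    moreover have "frechet_derivative Z (at (0 + s *s u)) v $ i = app (exp (csc s ?X) * D * exp (csc s (- ?X))) v $ i + Z (0 + s *s u) $ None * app (XA A) v $ i" for s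
      unfolding DZ by (simp add: MA)
    ultimately show ?thesis
      by (simp add: app_diff app_mult app_csc app_vscale algebra_simps)
  qed
  have der: "app D (muA A u v) = muA A (app D u) v + muA A u (app D v)" for u v
  proof -
    have "u $ None *s (app (XA A) (app D v) - app D (app (XA A) v)) + app D u $ None *s app (XA A) v
      = v $ None *s (app (XA A) (app D u) - app D (app (XA A) u)) + app D v $ None *s app (XA A) u" (is "?L = ?R")
      unfolding vec_eq_iff using holo_mixed_partials[OF Z mixed mixed] by blast
    then show ?thesis
      unfolding muA_eq app_diff_right app_vscale by (simp add: vec_eq_iff algebra_simps)
  qed
  have "ThetaE A (g 0) u v = of_real lam * g 0 u v + g 0 (app D u) v + g 0 u (app D v)" for u v
    using K[of u v 0] unfolding D[symmetric] H_def by (simp add: algebra_simps)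
  then show ?thesis using that der by blast
qed

section \<open>Adapted frames and the torsion-twisted Chern-Ricci form\<close>

definition tilde :: "'n::finite cmat \<Rightarrow> complex^'n \<Rightarrow> complex^('n option) \<Rightarrow> complex^'n" where
  "tilde q y u = app q (low u - u $ None *s y)"

text \<open>\<open>Z0 + lift y\<close> spans the orthogonal complement of the ideal and has squared
  length \<open>1 / N\<close>, while \<open>q\<close> carries the metric of the ideal to the
  standard one. The inverse length is recorded because the inverse metric enters the torsion
  form.\<close>

definition adapted :: "(complex^('n::finite option) \<Rightarrow> complex^('n option) \<Rightarrow> complex) \<Rightarrow> real \<Rightarrow> complex^'n \<Rightarrow> 'n cmat \<Rightarrow> 'n cmat \<Rightarrow> bool" where
  "adapted H N y q r \<longleftrightarrow> N > 0 \<and> q * r = 1 \<and> r * q = 1 \<and>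
     (\<forall>u v. H u v = u $ None * cnj (v $ None) / of_real N + cin (tilde q y u) (tilde q y v))"

lemma tilde_simps: "tilde q y (u + v) = tilde q y u + tilde q y v" "tilde q y (c *s u) = c *s tilde q y u"
  "tilde q y (lift w) = app q w" "tilde q y (Z0 + lift y) = 0"
  by (simp_all add: tilde_def low_simps flip: app_add_right app_vscale)
    (rule arg_cong[of _ _ "app q"], simp add: vec_eq_iff algebra_simps)+

lemma adapted_exists:
  assumes H: "herm_form H"
  obtains N y q r where "adapted H N y q r"
proof -
  note HD = herm_formD[OF H]
  define h where "h w w' = H (lift w) (lift w')" for w w'
  have expand: "H x (lift w) = (\<Sum>i\<in>UNIV. H x (lift (axis i 1)) * cnj (w $ i))" for x w
  proof -
    have s: "H x (lift (sum f I)) = (\<Sum>i\<in>I. H x (lift (f i)))" for f and I :: "'a set"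
      by (induction I rule: infinite_finite_induct) (simp_all add: lift_simps HD)
    have "H x (lift w) = H x (lift (\<Sum>i\<in>UNIV. w $ i *s axis i 1))" by (simp add: basis_expansion)
    then show ?thesis by (simp add: s lift_simps HD mult.commute)
  qed
  obtain p where p: "\<And>w. app p w = (\<chi> i. h w (axis i 1))"
    using Cmat_of_linear[of "\<lambda>w. \<chi> i. h w (axis i 1)"] by (auto simp: h_def lift_simps HD vec_eq_iff)
  have ph: "cin (app p w) w' = h w w'" for w w'
    unfolding p cin_def h_def by (simp add: expand[of "lift w" w'])
  have "star p = p"
    by (rule star_eqI) (metis HD(5) cin_commute h_def ph)
  moreover have "qf p v > 0" if "v \<noteq> 0" for v
  proof -
    have "lift v \<noteq> 0" using that by (metis low_lift low_simps(4))
    then show ?thesis unfolding qf_def ph h_def by (rule HD(10))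
  qed
  ultimately obtain q r where q: "star q = q" "q * q = p" "q * r = 1" "r * q = 1"
    using positive_sqrt by metis
  have qh: "cin (app q w) (app q w') = H (lift w) (lift w')" for w w'
    using ph[of w w'] by (simp add: q(2)[symmetric] app_mult cin_app_right q(1) h_def)
  define b where "b = (\<chi> i. cnj (H (lift (axis i 1)) Z0))"
  have bb: "cin w b = H (lift w) Z0" for w
    using expand[of Z0 w] unfolding cin_def b_def
    by (simp add: HD(5)[symmetric, of Z0] flip: cnj_sum) (metis (no_types, lifting) HD(5) complex_cnj_cnj complex_cnj_mult cnj_sum mult.commute sum.cong)
  \<comment> \<open>\<open>b\<close> represents the pairing of the ideal with \<open>Z0\<close>, and
    \<open>r * r\<close> inverts the Gram matrix \<open>p\<close>; the correction \<open>y\<close>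
    makes \<open>Z0 + lift y\<close> orthogonal to the ideal.\<close>
  define y where "y = - app (r * r) b"
  have "p * (r * r) = 1" using q by (metis mult.assoc mult_1)
  then have py: "app p y = - b" by (simp add: y_def app_minus_right flip: app_mult)
  define e where "e = Z0 + lift y"
  have orth: "H (lift w) e = 0" for w
  proof -
    have "H (lift w) (lift y) = cin w (app p y)"
      using ph[of w y] \<open>star p = p\<close> by (simp add: h_def cin_app)
    also have "\<dots> = - H (lift w) Z0" by (simp add: py flip: bb) (simp add: cin_def sum_negf)
    finally show ?thesis by (simp add: e_def HD)
  qed
  then have orth': "H e (lift w) = 0" for w by (metis HD(5) complex_cnj_zero)
  define N where "N = 1 / Re (H e e)"
  have "e $ None = 1" by (simp add: e_def)
  then have "e \<noteq> 0" by auto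
  then have N: "N > 0" unfolding N_def using HD(10) by simp
  have "cnj (H e e) = H e e" by (rule HD(5))
  then have Hee: "H e e = 1 / of_real N" by (simp add: N_def complex_eq_iff)
  have "H u v = u $ None * cnj (v $ None) / of_real N + cin (tilde q y u) (tilde q y v)" for u v
  proof -
    have dec: "u = u $ None *s e + lift (low u - u $ None *s y)" for u
      by (rule vec_option_eqI) (simp_all add: e_def low_simps)
    have "H u v = H (u $ None *s e + lift (low u - u $ None *s y)) (v $ None *s e + lift (low v - v $ None *s y))"
      using dec by metis
    also have "\<dots> = u $ None * cnj (v $ None) * H e e + H (lift (low u - u $ None *s y)) (lift (low v - v $ None *s y))"
      by (simp only: HD(1-4) orth orth' mult_zero_right add_0 add_0_right mult_ac mult_zero_left)
    finally show ?thesis by (simp add: Hee tilde_def qh)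
  qed
  then show ?thesis using that N q unfolding adapted_def by blast
qed

section \<open>The torsion-twisted form in a unitary frame\<close>

lemma muA_linear:
  "muA A (u + u') v = muA A u v + muA A u' v" "muA A (c *s u) v = c *s muA A u v"
  "muA A u (v + v') = muA A u v + muA A u v'" "muA A u (c *s v) = c *s muA A u v"
  "muA A 0 v = 0" "muA A u 0 = 0"
  by (simp_all add: muA_eq app_add_right app_vscale vec_eq_iff algebra_simps)

lemma muA_sum: "muA A (sum f I) v = (\<Sum>i\<in>I. muA A (f i) v)" "muA A v (sum f I) = (\<Sum>i\<in>I. muA A v (f i))"
  by (induction I rule: infinite_finite_induct) (simp_all add: muA_linear)

text \<open>Bookkeeping for a change of frame: \<open>g k a\<close> will be the entries of a unitary
  frame and \<open>c l a\<close> their conjugates, so that the inner sums are entries of the inverse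
  Gram matrix.\<close>

lemma sum_rearrange6:
  fixes P Q g c :: "'k::finite \<Rightarrow> 'k \<Rightarrow> complex"
  shows "(\<Sum>k\<in>UNIV. \<Sum>l\<in>UNIV. \<Sum>r\<in>UNIV. \<Sum>s\<in>UNIV. (\<Sum>a\<in>UNIV. g k a * c l a) * (\<Sum>b\<in>UNIV. g r b * c s b) * Q l s * P k r)
    = (\<Sum>a\<in>UNIV. \<Sum>b\<in>UNIV. (\<Sum>l\<in>UNIV. \<Sum>s\<in>UNIV. c l a * c s b * Q l s) * (\<Sum>k\<in>UNIV. \<Sum>r\<in>UNIV. g k a * g r b * P k r))"
proof -
  have "(\<Sum>k\<in>UNIV. \<Sum>l\<in>UNIV. \<Sum>r\<in>UNIV. \<Sum>s\<in>UNIV. (\<Sum>a\<in>UNIV. g k a * c l a) * (\<Sum>b\<in>UNIV. g r b * c s b) * Q l s * P k r)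
     = (\<Sum>k\<in>UNIV. \<Sum>l\<in>UNIV. \<Sum>r\<in>UNIV. \<Sum>s\<in>UNIV. \<Sum>a\<in>UNIV. \<Sum>b\<in>UNIV. g k a * c l a * (g r b * c s b) * Q l s * P k r)"
    unfolding sum_product by (simp only: sum_distrib_right)
  also have "\<dots> = (\<Sum>a\<in>UNIV. \<Sum>b\<in>UNIV. \<Sum>l\<in>UNIV. \<Sum>s\<in>UNIV. \<Sum>k\<in>UNIV. \<Sum>r\<in>UNIV. (c l a * c s b * Q l s) * (g k a * g r b * P k r))"
    unfolding sum.cartesian_product
    by (rule sum.reindex_bij_witness[where i = "\<lambda>(a,b,l,s,k,r). (k,l,r,s,a,b)" and j = "\<lambda>(k,l,r,s,a,b). (a,b,l,s,k,r)"])
      (auto simp: mult_ac)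
  also have "\<dots> = (\<Sum>a\<in>UNIV. \<Sum>b\<in>UNIV. (\<Sum>l\<in>UNIV. \<Sum>s\<in>UNIV. c l a * c s b * Q l s) * (\<Sum>k\<in>UNIV. \<Sum>r\<in>UNIV. g k a * g r b * P k r))"
    unfolding sum_distrib_right unfolding sum_distrib_left ..
  finally show ?thesis .
qed

lemma matrix_inv_eqI:
  fixes M :: "complex^'k^'k"
  assumes "M ** M' = mat 1" "M' ** M = mat 1"
  shows "matrix_inv M = M'"
  unfolding matrix_inv_def
  by (rule some_equality) (use assms in \<open>auto, metis matrix_mul_assoc matrix_mul_lid matrix_mul_rid\<close>)

text \<open>\<open>F\<close> pulls the standard product back to \<open>H\<close>, so the columns of
  its inverse \<open>G\<close> form a unitary frame and the inverse Gram matrix factors as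
  \<open>G * star G\<close>. Distributing the two factors removes the inverse metric.\<close>

lemma ThetaE_frame:
  assumes H: "herm_form H" and F: "\<And>u v. H u v = cin (app F u) (app F v)" and G: "F * G = 1" "G * F = 1"
  shows "ThetaE A H u v = (1/2) * (\<Sum>a\<in>UNIV. \<Sum>b\<in>UNIV.
     H u (muA A (app G (axis a 1)) (app G (axis b 1))) * H (muA A (app G (axis a 1)) (app G (axis b 1))) v)"
proof -
  note HD = herm_formD[OF H]
  have Hs: "H (sum f I) v = (\<Sum>i\<in>I. H (f i) v)" "H v (sum f I) = (\<Sum>i\<in>I. H v (f i))" for f v and I :: "'a option set"
    by (induction I rule: infinite_finite_induct) (simp_all add: HD)
  have "mat_of (star F * F) $ i $ j = H (axis j 1) (axis i 1)" for i j
    by (metis F app_axis app_mult cin_app cin_axis star_star)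
  then have "transpose (gram H) = mat_of (star F * F)"
    by (simp add: gram_def transpose_def vec_eq_iff)
  moreover have "(star F * F) * (G * star G) = 1" "(G * star G) * (star F * F) = 1"
  proof -
    have "star F * F * (G * star G) = star F * (F * G) * star G" by (simp add: mult.assoc)
    also have "\<dots> = star (G * F)" by (simp add: G(1))
    finally show "(star F * F) * (G * star G) = 1" by (simp add: G(2))
    then show "(G * star G) * (star F * F) = 1" by (rule cmat_inverse_commute)
  qed
  then have "mat_of (star F * F) ** mat_of (G * star G) = mat 1" "mat_of (G * star G) ** mat_of (star F * F) = mat 1"
    by (metis mat_of_Cmat one_cmat_def times_cmat_def)+
  ultimately have "gram_inv H = mat_of (G * star G)"
    unfolding gram_inv_def by (simp add: matrix_inv_eqI)
  then have gi: "gram_inv H $ k $ l = (\<Sum>a\<in>UNIV. mat_of G $ k $ a * cnj (mat_of G $ l $ a))" for k l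
    by (simp add: times_cmat_def matrix_matrix_mult_def star_def)
  define e where "e a = app G (axis a 1)" for a
  have e: "e a = (\<Sum>k\<in>UNIV. mat_of G $ k $ a *s axis k 1)" for a
    using basis_expansion[of "e a"] by (simp add: e_def app_axis)
  have m: "muA A (e a) (e b) = (\<Sum>k\<in>UNIV. \<Sum>r\<in>UNIV. (mat_of G $ k $ a * mat_of G $ r $ b) *s muA A (axis k 1) (axis r 1))" for a b
    unfolding e muA_sum(1) unfolding muA_sum(2) by (simp add: muA_linear vec_eq_iff mult_ac)
  have fr: "ThetaE_frame A H i j = (1/2) * (\<Sum>a\<in>UNIV. \<Sum>b\<in>UNIV. H (axis i 1) (muA A (e a) (e b)) * H (muA A (e a) (e b)) (axis j 1))" for i j
  proof -
    have "H (axis i 1) (muA A (e a) (e b)) = (\<Sum>l\<in>UNIV. \<Sum>s\<in>UNIV. cnj (mat_of G $ l $ a) * cnj (mat_of G $ s $ b) * H (axis i 1) (muA A (axis l 1) (axis s 1)))" for a b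
      unfolding m Hs HD(4) by simp
    moreover have "H (muA A (e a) (e b)) (axis j 1) = (\<Sum>k\<in>UNIV. \<Sum>r\<in>UNIV. mat_of G $ k $ a * mat_of G $ r $ b * H (muA A (axis k 1) (axis r 1)) (axis j 1))" for a b
      unfolding m Hs HD(3) by simp
    ultimately show ?thesis
      unfolding ThetaE_frame_def gi
      using sum_rearrange6[of "\<lambda>k a. mat_of G $ k $ a" "\<lambda>l a. cnj (mat_of G $ l $ a)"
          "\<lambda>l s. H (axis i 1) (muA A (axis l 1) (axis s 1))" "\<lambda>k r. H (muA A (axis k 1) (axis r 1)) (axis j 1)"]
      by (simp only:)
  qed
  have eu: "H u x = (\<Sum>i\<in>UNIV. u $ i * H (axis i 1) x)" for x by (rule herm_form_expand[OF H])
  have ev: "H x v = (\<Sum>j\<in>UNIV. cnj (v $ j) * H x (axis j 1))" for x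
  proof -
    have "H x v = H x (\<Sum>j\<in>UNIV. v $ j *s axis j 1)" by (simp add: basis_expansion)
    then show ?thesis by (simp add: Hs HD)
  qed
  have "ThetaE A H u v = (\<Sum>i\<in>UNIV. \<Sum>j\<in>UNIV. \<Sum>a\<in>UNIV. \<Sum>b\<in>UNIV.
      (1/2) * ((u $ i * H (axis i 1) (muA A (e a) (e b))) * (cnj (v $ j) * H (muA A (e a) (e b)) (axis j 1))))"
    unfolding ThetaE_def fr by (simp add: sum_distrib_left mult_ac)
  also have "\<dots> = (\<Sum>a\<in>UNIV. \<Sum>b\<in>UNIV. \<Sum>i\<in>UNIV. \<Sum>j\<in>UNIV.
      (1/2) * ((u $ i * H (axis i 1) (muA A (e a) (e b))) * (cnj (v $ j) * H (muA A (e a) (e b)) (axis j 1))))"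
    unfolding sum.cartesian_product
    by (rule sum.reindex_bij_witness[where i = "\<lambda>(a,b,i,j). (i,j,a,b)" and j = "\<lambda>(i,j,a,b). (a,b,i,j)"]) auto
  also have "\<dots> = (1/2) * (\<Sum>a\<in>UNIV. \<Sum>b\<in>UNIV. H u (muA A (e a) (e b)) * H (muA A (e a) (e b)) v)"
    unfolding eu ev sum_product by (simp only: sum_distrib_left)
  finally show ?thesis unfolding e_def .
qed

text \<open>Only brackets with the normal frame vector, which is \<open>sqrt N\<close> times
  \<open>Z0 + lift y\<close>, survive. Each occurs in both orders, which cancels the factor 1/2; the
  two square roots give \<open>N\<close>.\<close>

lemma ThetaE_adapted:
  assumes H: "herm_form H" and ad: "adapted H N y q r"
  shows "ThetaE A H u v = of_real N * cin (app (star (q * Cmat A * r)) (tilde q y u)) (app (star (q * Cmat A * r)) (tilde q y v))"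
proof -
  have N: "N > 0" and qr: "q * r = 1" "r * q = 1"
    and Heq: "\<And>u v. H u v = u $ None * cnj (v $ None) / of_real N + cin (tilde q y u) (tilde q y v)"
    using ad by (auto simp: adapted_def)
  define t where "t = sqrt N"
  have t: "t > 0" "of_real t * of_real t = complex_of_real N" using N by (simp_all add: t_def flip: of_real_mult)
  define f where "f u = (u $ None / of_real t) *s Z0 + lift (tilde q y u)" for u
  have lin: "f (u + v) = f u + f v" "f (c *s u) = c *s f u" for u v c
    by (simp_all add: f_def tilde_simps lift_simps vec_eq_iff add_divide_distrib algebra_simps)
  obtain F where F: "\<And>u. app F u = (u $ None / of_real t) *s Z0 + lift (tilde q y u)"
    using Cmat_of_linear[OF lin] unfolding f_def by blast
  define f where "f x = (x $ None * of_real t) *s (Z0 + lift y) + lift (app r (low x))" for x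
  have lin: "f (u + v) = f u + f v" "f (c *s u) = c *s f u" for u v c
    by (simp_all add: f_def lift_simps low_simps app_add_right app_vscale vec_eq_iff algebra_simps)
  obtain G where G: "\<And>x. app G x = (x $ None * of_real t) *s (Z0 + lift y) + lift (app r (low x))"
    using Cmat_of_linear[OF lin] unfolding f_def by blast
  have rq: "app r (app q w) = w" "app q (app r w) = w" for w using qr by (metis app_1 app_mult)+
  have "G * F = 1"
  proof (rule cmat_eqI)
    fix u
    show "app (G * F) u = app 1 u"
      by (rule vec_option_eqI)
        (use t in \<open>simp_all add: app_mult F G low_simps tilde_def rq vec_eq_iff\<close>)
  qed
  then have FG: "F * G = 1" by (rule cmat_inverse_commute)
  have cinl: "cin (c *s Z0 + lift w) (d *s Z0 + lift w') = c * cnj d + cin w w'" for c d w w'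
    by (simp add: cin_def sum_UNIV_option axis_def)
  have FH: "H u v = cin (app F u) (app F v)" for u v
    unfolding F cinl Heq using t by (simp add: mult.commute)
  define a where "a = q * Cmat A * r"
  have eN: "app G (axis None 1) = of_real t *s (Z0 + lift y)" by (simp add: G low_simps lift_simps)
  have eS: "app G (axis (Some \<beta>) 1) = lift (app r (axis \<beta> 1))" for \<beta>
  proof -
    have "low (axis (Some \<beta>) 1) = axis \<beta> 1" by (simp add: low_def axis_def vec_eq_iff)
    then show ?thesis by (simp add: G axis_def)
  qed
  have mNS: "muA A (app G (axis None 1)) (app G (axis (Some \<beta>) 1)) = of_real t *s lift (A *v app r (axis \<beta> 1))" for \<beta>
    unfolding eN eS by (simp add: muA_eq app_XA)
  have mSN: "muA A (app G (axis (Some \<beta>) 1)) (app G (axis None 1)) = - of_real t *s lift (A *v app r (axis \<beta> 1))" for \<beta>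
    unfolding eN eS by (simp add: muA_eq app_XA vec_eq_iff)
  have mSS: "muA A (app G (axis (Some \<alpha>) 1)) (app G (axis (Some \<beta>) 1)) = 0" for \<alpha> \<beta>
    unfolding eS by (simp add: muA_eq)
  have mNN: "muA A (app G (axis None 1)) (app G (axis None 1)) = 0" by (simp add: muA_eq)
  note HD = herm_formD[OF H]
  have hm: "H u (- x) = - H u x" "H (- x) u = - H x u" for u x
    using HD(6)[of 0 x u] HD(7)[of u 0 x] by (simp_all add: HD(8,9))
  have lw: "H u (lift w) = cin (tilde q y u) (app q w)" "H (lift w) u = cin (app q w) (tilde q y u)" for u w
    by (simp_all add: Heq tilde_simps)
  have qA: "app q (A *v app r w) = app a w" for w by (simp add: a_def app_mult app_Cmat)
  have "ThetaE A H u v = of_real N * (\<Sum>\<beta>\<in>UNIV. cin (tilde q y u) (app a (axis \<beta> 1)) * cin (app a (axis \<beta> 1)) (tilde q y v))"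
    unfolding ThetaE_frame[OF H FH FG \<open>G * F = 1\<close>] sum_UNIV_option mNS mSN mSS mNN
    by (simp add: HD hm lw qA sum_distrib_left flip: t(2)) (simp add: mult_ac)
  also have "\<dots> = of_real N * cin (app (star a) (tilde q y u)) (app (star a) (tilde q y v))"
  proof -
    have "cin (tilde q y u) (app a (axis \<beta> 1)) = app (star a) (tilde q y u) $ \<beta>" for \<beta>
      by (simp add: cin_app_right cin_axis)
    moreover have "cin (app a (axis \<beta> 1)) (tilde q y v) = cnj (app (star a) (tilde q y v) $ \<beta>)" for \<beta>
      by (metis cin_app_right cin_axis cin_commute)
    ultimately show ?thesis by (simp add: cin_def[of "app _ _"])
  qed
  finally show ?thesis unfolding a_def .
qed

lemma soliton_algebra:
  assumes sol: "hcf_soliton A g"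
  obtains N y q r E d where "adapted (g 0) N y q r"
    "N *\<^sub>R ((q * Cmat A * r) * star (q * Cmat A * r)) = E + star E - (2 * Re d) *\<^sub>R 1"
    "E * (q * Cmat A * r) - (q * Cmat A * r) * E = csc d (q * Cmat A * r)"
proof -
  define H where "H = g 0"
  have H: "herm_form H" using sol by (simp add: hcf_soliton_def left_inv_metric_def H_def)
  obtain lam :: real and D where
    Th: "\<And>u v. ThetaE A H u v = of_real lam * H u v + H (app D u) v + H u (app D v)" and
    der: "\<And>u v. app D (muA A u v) = muA A (app D u) v + muA A u (app D v)"
    using soliton_derivation[OF sol] unfolding H_def by blast
  obtain N y q r where ad: "adapted H N y q r" using adapted_exists[OF H] by blast
  have N: "N > 0" and qr: "q * r = 1" "r * q = 1"
    and Heq: "\<And>u v. H u v = u $ None * cnj (v $ None) / of_real N + cin (tilde q y u) (tilde q y v)"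
    using ad by (auto simp: adapted_def)
  have rq: "app r (app q w) = w" "app q (app r w) = w" for w using qr by (metis app_1 app_mult)+
  define a where "a = q * Cmat A * r"
  have Theq: "ThetaE A H u v = of_real N * cin (app (star a) (tilde q y u)) (app (star a) (tilde q y v))" for u v
    unfolding a_def by (rule ThetaE_adapted[OF H ad])
  define e where "e = Z0 + lift y"
  have e0: "e $ None = 1" "tilde q y e = 0" unfolding e_def by (simp, rule tilde_simps(4))
  define d where "d = app D e $ None"
  \<comment> \<open>Brackets lie in the ideal, so the torsion form vanishes on the normal vector
    \<open>e\<close>; the equation there fixes \<open>lam\<close>.\<close>
  have "lam + 2 * Re d = 0"
  proof -
    have "0 = (of_real lam + d + cnj d) / of_real N"
      using Th[of e e] unfolding Theq Heq e0 by (simp add: d_def add_divide_distrib)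
    then have "of_real lam + d + cnj d = 0" using N by simp
    then show ?thesis by (simp add: complex_eq_iff)
  qed
  then have lam: "lam = - 2 * Re d" by simp
  \<comment> \<open>\<open>D\<close> is not assumed to preserve the ideal, so its values are
    projected to the ideal along \<open>e\<close>.\<close>
  define f where "f w = low (app D (lift w)) - app D (lift w) $ None *s y" for w
  have lin: "f (u + v) = f u + f v" "f (c *s u) = c *s f u" for u v c
    by (simp_all add: f_def lift_simps low_simps app_add_right app_vscale vec_eq_iff algebra_simps)
  obtain E0 where E0: "\<And>w. app E0 w = low (app D (lift w)) - app D (lift w) $ None *s y"
    using Cmat_of_linear[OF lin] unfolding f_def by blast
  define E where "E = q * E0 * r"
  have tD: "tilde q y (app D (lift w)) = app E (app q w)" for w
    by (simp add: tilde_def E0 E_def app_mult rq)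
  have main: "N *\<^sub>R (a * star a) = E + star E - (2 * Re d) *\<^sub>R 1"
  proof (rule cmat_eqI, rule cin_ext)
    fix x x'
    define w where "w = app r x"
    define w' where "w' = app r x'"
    have x: "x = app q w" "x' = app q w'" by (simp_all add: w_def w'_def rq)
    have "of_real N * cin (app (star a) x) (app (star a) x') = of_real lam * cin x x' + cin (app E x) x' + cin x (app E x')"
      using Th[of "lift w" "lift w'"] unfolding Theq Heq tilde_simps tD x by simp
    then show "cin (app (N *\<^sub>R (a * star a)) x) x' = cin (app (E + star E - (2 * Re d) *\<^sub>R 1) x) x'"
      by (simp add: app_scaleR app_add app_diff app_mult cin_scaleR_left cin_add_left cin_diff_left cin_app[of a]
          cin_app[of "star E"] lam)
  qed
  have E0A: "app E0 (A *v w) = d *s (A *v w) + A *v (app E0 w)" for w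
  proof -
    have m: "muA A e (lift w) = lift (A *v w)" by (simp add: muA_eq app_XA e0)
    have "app D (lift (A *v w)) = muA A (app D e) (lift w) + muA A e (app D (lift w))"
      using der[of e "lift w"] by (simp add: m)
    also have "\<dots> = d *s lift (A *v w) + (lift (A *v low (app D (lift w))) - app D (lift w) $ None *s lift (A *v y))"
      by (simp add: muA_eq app_XA e0 d_def) (simp add: e_def low_simps)
    finally have D: "app D (lift (A *v w)) = d *s lift (A *v w) + (lift (A *v low (app D (lift w))) - app D (lift w) $ None *s lift (A *v y))" .
    \<comment> \<open>A derivation maps brackets to sums of brackets, so on vectors
      \<open>A *v w\<close> the correction term in \<open>E0\<close> disappears.\<close>
    then have "app D (lift (A *v w)) $ None = 0" by simp
    moreover have "low (app D (lift (A *v w))) = d *s (A *v w) + (A *v low (app D (lift w)) - app D (lift w) $ None *s (A *v y))"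
      unfolding D by (simp add: low_simps)
    moreover have "A *v (low (app D (lift w)) - app D (lift w) $ None *s y) = A *v low (app D (lift w)) - app D (lift w) $ None *s (A *v y)"
      by (simp add: app_diff_right app_vscale flip: app_Cmat)
    ultimately show ?thesis by (simp add: E0)
  qed
  have "E0 * Cmat A = csc d (Cmat A) + Cmat A * E0"
    by (rule cmat_eqI) (simp add: app_mult app_add app_csc app_Cmat E0A)
  then have "q * (E0 * Cmat A) * r = csc d a + q * (Cmat A * E0) * r"
    by (simp add: a_def algebra_simps)
  moreover have "E * a = q * (E0 * Cmat A) * r" "a * E = q * (Cmat A * E0) * r"
    unfolding E_def a_def using qr by (metis mult.assoc mult_1_left)+
  ultimately have "E * a - a * E = csc d a" by simp
  then show ?thesis using that[of N y q r E d] ad main unfolding a_def H_def by blast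
qed

section \<open>Existence of solitons\<close>

text \<open>The conjugate of \<open>D\<close> has derivative \<open>d\<close> times
  \<open>X\<close>, because \<open>X\<close> commutes with its own exponentials; subtracting this
  linear term leaves a function with zero derivative.\<close>

lemma exp_csc_conjugate:
  fixes D X :: "'n::finite cmat"
  assumes "D * X - X * D = csc d X"
  shows "exp (csc (- c) X) * D * exp (csc c X) = D + csc (c * d) X"
proof -
  define f where "f c = exp (csc c (- X)) * D * exp (csc c X) - csc (c * d) X" for c
  have m: "csc c (- X) = csc (- c) X" for c by (rule cmat_eqI) (simp add: app_csc app_minus vec_eq_iff)
  have "(f has_derivative (\<lambda>h. 0)) (at c)" for c
  proof -
    define P where "P = exp (csc c (- X))"
    define Q where "Q = exp (csc c X)"
    have 1: "((\<lambda>c. exp (csc c (- X))) has_derivative (\<lambda>h. csc h (- X * P))) (at c)"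
      and 2: "((\<lambda>c. exp (csc c X)) has_derivative (\<lambda>h. csc h (X * Q))) (at c)"
      unfolding P_def Q_def by (rule has_derivative_exp_csc)+
    have "((\<lambda>c. c * d) has_derivative (\<lambda>h. h * d)) (at c)" by (auto intro!: derivative_eq_intros)
    then have 3: "((\<lambda>c. csc (c * d) X) has_derivative (\<lambda>h. csc (h * d) X)) (at c)"
      by (rule bounded_linear.has_derivative[OF bounded_linear_csc])
    have "(f has_derivative (\<lambda>h. P * D * csc h (X * Q) + csc h (- X * P) * D * Q - csc (h * d) X)) (at c)"
      using 1 2 3 unfolding f_def P_def Q_def by (intro has_derivative_diff has_derivative_mult has_derivative_mult_left)
    moreover have "P * D * csc h (X * Q) + csc h (- X * P) * D * Q - csc (h * d) X = 0" for h
    proof -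
      have PX: "X * P = P * X" unfolding P_def by (rule exp_intertwine) (simp add: m)
      have PQ: "P * Q = 1" unfolding P_def Q_def by (simp add: m exp_csc_minus)
      have XQ: "X * Q = Q * X" unfolding Q_def by (rule exp_intertwine) simp
      have "P * D * csc h (X * Q) + csc h (- X * P) * D * Q = csc h (P * (D * X - X * D) * Q)"
      proof -
        have "- X * P = - (P * X)" by (simp add: PX)
        then show ?thesis
          by (simp only:) (simp add: csc_minus_right csc_diff_right right_diff_distrib left_diff_distrib mult.assoc)
      qed
      also have "\<dots> = csc (h * d) (P * Q * X)"
        unfolding assms by (simp add: XQ mult.assoc)
      finally show ?thesis by (simp add: PQ)
    qed
    ultimately show ?thesis by simp
  qed
  then have "f c = f 0"
    using has_derivative_zero_constant[of UNIV f] by (metis UNIV_I convex_UNIV has_derivative_at_withinI)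
  then show ?thesis by (simp add: f_def m diff_eq_eq)
qed

text \<open>\<open>Z0\<close> is declared a unit vector orthogonal to the ideal and the columns of
  \<open>r\<close> an orthonormal basis of the ideal. The vector field is the linear field of the
  derivation \<open>D\<close> that is \<open>d\<close> on \<open>Z0\<close> and conjugate to
  \<open>E\<close> on the ideal; vanishing of the torsion form at \<open>Z0\<close> dictates the
  soliton constant \<open>- 2 * Re d\<close>.\<close>

lemma hcf_soliton_exists:
  fixes A :: "complex^'n^'n"
  assumes qr: "q * r = 1" "r * q = 1" and a: "a = q * Cmat A * r"
    and eq: "a * star a = E + star E - (2 * Re d) *\<^sub>R 1" and comm: "E * a - a * E = csc d a"
  shows "\<exists>g. hcf_soliton A g"
proof -
  define H where "H u v = u $ None * cnj (v $ None) + cin (app q (low u)) (app q (low v))" for u v :: "complex^('n option)"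
  have rq: "app r (app q w) = w" "app q (app r w) = w" for w using qr by (metis app_1 app_mult)+
  have H: "herm_form H"
    unfolding herm_form_def
  proof (intro conjI allI impI)
    fix u :: "complex^('n option)" assume "u \<noteq> 0"
    then have "u $ None \<noteq> 0 \<or> low u \<noteq> 0" by (metis low_simps(4) vec_option_eqI zero_index)
    moreover have "app q (low u) \<noteq> 0" if "low u \<noteq> 0" using that by (metis app_0_right rq(1))
    ultimately have "(cmod (u $ None))\<^sup>2 + (norm (app q (low u)))\<^sup>2 > 0"
      by (metis add_nonneg_pos add_pos_nonneg zero_le_power2 zero_less_norm_iff zero_less_power)
    then show "Re (H u u) > 0"
      by (simp add: H_def cin_self complex_mult_cnj cmod_power2)
  next
    fix u v
    show "H v u = cnj (H u v)" by (simp add: H_def cin_commute mult.commute)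
  qed (simp_all add: H_def low_simps app_add_right app_vscale cin_add_left cin_vscale_left algebra_simps)
  have ad: "adapted H 1 0 q r"
    using qr by (simp add: adapted_def H_def tilde_def)
  define g where "g p u v = H (app (MA A (- p $ None)) u) (app (MA A (- p $ None)) v)" for p u v :: "complex^('n option)"
  have g: "left_inv_metric A g" unfolding g_def by (rule left_inv_metricI[OF H])
  have g0: "g 0 = H" by (intro ext) (simp add: g_def)
  define E0 where "E0 = r * E * q"
  define f where "f u = (d * u $ None) *s Z0 + lift (app E0 (low u))" for u
  have lin: "f (u + v) = f u + f v" "f (c *s u) = c *s f u" for u v c
    by (simp_all add: f_def lift_simps low_simps app_add_right app_vscale vec_eq_iff algebra_simps)
  obtain D where D: "\<And>u. app D u = (d * u $ None) *s Z0 + lift (app E0 (low u))"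
    using Cmat_of_linear[OF lin] unfolding f_def by blast
  have "E0 * Cmat A - Cmat A * E0 = csc d (Cmat A)"
  proof -
    have 1: "E0 * Cmat A = r * (E * a) * q"
      unfolding E0_def a using qr by (simp add: mult.assoc)
    have 2: "Cmat A * E0 = r * (a * E) * q"
      unfolding E0_def a using qr by (simp add: mult.assoc[symmetric])
    have 3: "Cmat A = r * a * q"
      unfolding a using qr by (metis mult.assoc mult_1 mult_1_right)
    have "E0 * Cmat A - Cmat A * E0 = r * (E * a - a * E) * q"
      by (simp add: 1 2 right_diff_distrib left_diff_distrib)
    then show ?thesis unfolding comm by (simp add: 3[symmetric])
  qed
  then have "app E0 (A *v w) - A *v app E0 w = d *s (A *v w)" for w
    by (metis app_Cmat app_csc app_diff app_mult)
  then have DX: "D * XA A - XA A * D = csc d (XA A)"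
    by (intro cmat_eqI) (simp add: app_diff app_mult D app_XA app_csc low_simps flip: lift_simps)
  have Zd: "(app D has_derivative app D) (at p)" for p
    by (rule bounded_linear_imp_has_derivative[OF bounded_linear_app])
  then have fZ: "frechet_derivative (app D) (at p) = app D" for p
    by (metis frechet_derivative_at)
  have Z: "holo (app D)"
    unfolding holo_def fZ using Zd by (auto simp: differentiable_def app_vscale)
  \<comment> \<open>Conjugating \<open>D\<close> by left translation adds
    \<open>p $ None * d\<close> times \<open>XA A\<close>, exactly the term that the Lie derivative
    subtracts; the equation at the identity therefore holds everywhere.\<close>
  have K: "app (MA A (- p $ None)) (app D (app (MA A (p $ None)) u)) - app D p $ None *s app (XA A) u = app D u" for p u
  proof -
    have "app (MA A (- p $ None) * D * MA A (p $ None)) u = app (D + csc (p $ None * d) (XA A)) u"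
      unfolding MA_def using exp_csc_conjugate[OF DX, of "p $ None"] by simp
    then show ?thesis by (simp add: app_mult app_add app_csc) (simp add: D mult.commute)
  qed
  have Th: "ThetaE A H u v = of_real (- 2 * Re d) * H u v + H (app D u) v + H u (app D v)" for u v
  proof -
    define x where "x = app q (low u)"
    define x' where "x' = app q (low v)"
    have qE: "app q (app E0 w) = app E (app q w)" for w by (simp add: E0_def app_mult rq)
    have "ThetaE A H u v = cin (app (a * star a) x) x'"
      by (simp add: ThetaE_adapted[OF H ad] tilde_def a[symmetric] app_mult cin_app[of a] x_def x'_def)
    also have "\<dots> = cin (app E x) x' + cin x (app E x') - of_real (2 * Re d) * cin x x'"
      unfolding eq by (simp add: app_add app_diff app_scaleR cin_add_left cin_diff_left cin_scaleR_left cin_app[of "star E"])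
    finally have 1: "ThetaE A H u v = cin (app E x) x' + cin x (app E x') - of_real (2 * Re d) * cin x x'" .
    have "H (app D u) v = d * (u $ None * cnj (v $ None)) + cin (app E x) x'"
      "H u (app D v) = cnj d * (u $ None * cnj (v $ None)) + cin x (app E x')"
      by (simp_all add: H_def D low_simps qE x_def x'_def)
    moreover have "of_real (- 2 * Re d) + d + cnj d = 0" by (simp add: complex_eq_iff)
    then have "of_real (- 2 * Re d) * (u $ None * cnj (v $ None)) + d * (u $ None * cnj (v $ None)) + cnj d * (u $ None * cnj (v $ None)) = 0"
      by (metis distrib_right mult_zero_left)
    ultimately show ?thesis unfolding 1
      by (simp add: H_def x_def x'_def algebra_simps)
  qed
  have "ThetaE A (g 0) u v = of_real (- 2 * Re d) * g p (dL A p u) (dL A p v) + lie_deriv (app D) g p (dL A p u) (dL A p v)" for p u v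
    unfolding dL_eq lie_deriv_left_invariant[OF g Z] fZ K g0 Th by (simp add: g_def)
  then show ?thesis
    unfolding hcf_soliton_def using g Z by blast
qed

lemma semisimple_imp_soliton:
  fixes A :: "complex^'n^'n"
  assumes "semisimple_mat A"
  shows "\<exists>g. hcf_soliton A g"
proof -
  obtain P D :: "complex^'n^'n" where P: "invertible P" and D: "\<And>i j. i \<noteq> j \<Longrightarrow> D $ i $ j = 0" and A: "A = P ** D ** matrix_inv P"
    using assms unfolding semisimple_mat_def by blast
  obtain P' where P': "P ** P' = mat 1" "P' ** P = mat 1" using P unfolding invertible_def by blast
  then have mi: "matrix_inv P = P'" by (rule matrix_inv_eqI)
  define q where "q = Cmat P'"
  define r where "r = Cmat P"
  have qr: "q * r = 1" "r * q = 1" using P' by (simp_all add: q_def r_def times_cmat_def one_cmat_def)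
  define a where "a = Cmat D"
  have "Cmat A = r * a * q" by (simp add: A mi times_cmat_def r_def a_def q_def)
  then have a: "a = q * Cmat A * r" using qr by (metis mult.assoc mult_1 mult_1_right)
  have normal: "a * star a = star a * a"
  proof -
    have "(\<Sum>k\<in>UNIV. D $ i $ k * cnj (D $ j $ k)) = (\<Sum>k\<in>UNIV. cnj (D $ k $ i) * D $ k $ j)" for i j
    proof -
      have "D $ i $ k * cnj (D $ j $ k) = cnj (D $ k $ i) * D $ k $ j" for k
        using D[of i k] D[of j k] D[of k i] D[of k j] by (cases "k = i"; cases "k = j") auto
      then show ?thesis by simp
    qed
    then show ?thesis
      by (simp add: times_cmat_def a_def star_def matrix_matrix_mult_def)
  qed
  \<comment> \<open>With \<open>d = 0\<close> half of \<open>a * star a\<close> satisfies the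
    equation, and it commutes with \<open>a\<close> by normality.\<close>
  define E where "E = (1/2) *\<^sub>R (a * star a)"
  have "a * star a = E + star E - (2 * Re 0) *\<^sub>R 1" by (simp add: E_def flip: scaleR_add_left)
  moreover have "E * a - a * E = csc 0 a"
  proof -
    have "a * star a * a = a * (a * star a)" by (metis mult.assoc normal)
    then show ?thesis by (simp add: E_def)
  qed
  ultimately show ?thesis using hcf_soliton_exists[OF qr a] by blast
qed

subsection \<open>Chain bases of nilpotent matrices\<close>

text \<open>A Jordan basis without block labels: \<open>j\<close> is the position of a vector in its
  chain, counted from the generator. The last clause prevents two chains from merging.\<close>

definition chain_basis :: "'n::finite cmat \<Rightarrow> (complex^'n) set \<Rightarrow> (complex^'n) set \<Rightarrow> (complex^'n \<Rightarrow> nat) \<Rightarrow> bool" where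
  "chain_basis a S B j \<longleftrightarrow> vec.independent B \<and> vec.span B = S \<and>
     (\<forall>b\<in>B. app a b = 0 \<or> app a b \<in> B \<and> j (app a b) = Suc (j b)) \<and>
     (\<forall>b\<in>B. j b > 0 \<longrightarrow> (\<exists>c\<in>B. app a c = b)) \<and>
     (\<forall>b\<in>B. \<forall>c\<in>B. app a b = app a c \<longrightarrow> app a b \<noteq> 0 \<longrightarrow> b = c)"

text \<open>Split off a longest chain \<open>X 0, ..., X m\<close>. A functional
  \<open>\<phi>\<close> that detects its last vector provides an invariant complement, to which
  induction on the dimension applies.\<close>

lemma chain_basis_exists:
  fixes a :: "'n::finite cmat"
  assumes nil: "a ^ k = 0"
  shows "vec.subspace S \<Longrightarrow> (\<And>v. v \<in> S \<Longrightarrow> app a v \<in> S) \<Longrightarrow> \<exists>B j. chain_basis a S B j"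
proof (induction "vec.dim S" arbitrary: S rule: less_induct)
  case less
  note sub = less.prems(1) and inv = less.prems(2)
  have invp: "app (a ^ i) v \<in> S" if "v \<in> S" for i v
    using that by (induction i) (auto simp: app_mult inv)
  have Ssum: "u + v \<in> S" "c *s v \<in> S" "u - v \<in> S" if "u \<in> S" "v \<in> S" for u v c
    using that sub vec.subspace_add vec.subspace_scale vec.subspace_diff by blast+
  have ap: "app (a ^ i) (app (a ^ l) v) = app (a ^ (i + l)) v" for i l v
    by (simp add: power_add app_mult)
  show ?case
  proof (cases "S \<subseteq> {0}")
    case True
    then have "S = {0}" using sub vec.subspace_0 by blast
    then have "chain_basis a S {} (\<lambda>_. 0)" by (simp add: chain_basis_def vec.independent_empty)
    then show ?thesis by blast
  next
    case False
    then obtain s where s: "s \<in> S" "s \<noteq> 0" by blast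
    define M where "M = (LEAST m. \<forall>v\<in>S. app (a ^ m) v = 0)"
    have M: "\<forall>v\<in>S. app (a ^ M) v = 0"
      unfolding M_def by (rule LeastI[of _ k]) (simp add: nil)
    have "M > 0" using M s by (cases M) auto
    then obtain m where m: "M = Suc m" by (cases M) auto
    have "\<not> (\<forall>v\<in>S. app (a ^ m) v = 0)"
      using not_less_Least[of m "\<lambda>m. \<forall>v\<in>S. app (a ^ m) v = 0"] m by (simp add: M_def)
    then obtain x where x: "x \<in> S" "app (a ^ m) x \<noteq> 0" by blast
    have zero: "app (a ^ i) v = 0" if "i > m" "v \<in> S" for i v
    proof -
      have "app (a ^ i) v = app (a ^ (i - M)) (app (a ^ M) v)" using that m by (simp add: ap del: power_Suc)
      then show ?thesis using M that by simp
    qed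
    define y where "y = app (a ^ m) x"
    define \<phi> where "\<phi> v = cin v y" for v
    have \<phi>y: "\<phi> y \<noteq> 0" using x by (simp add: \<phi>_def y_def cin_self)
    have \<phi>lin: "\<phi> (u + v) = \<phi> u + \<phi> v" "\<phi> (u - v) = \<phi> u - \<phi> v" "\<phi> (c *s v) = c * \<phi> v" "\<phi> 0 = 0" for u v c
      by (simp_all add: \<phi>_def cin_add_left cin_diff_left cin_vscale_left)
    \<comment> \<open>The largest invariant subspace of \<open>S\<close> in the kernel of
      \<open>\<phi>\<close>.\<close>
    define S' where "S' = {v \<in> S. \<forall>i. \<phi> (app (a ^ i) v) = 0}"
    have sub': "vec.subspace S'"
      unfolding vec.subspace_def using sub vec.subspace_0[OF sub]
      by (auto simp: S'_def app_add_right app_vscale \<phi>lin Ssum)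
    have inv': "app a v \<in> S'" if "v \<in> S'" for v
    proof -
      have v: "v \<in> S" "\<phi> (app (a ^ i) v) = 0" for i using that by (auto simp: S'_def)
      have "\<phi> (app (a ^ i) (app a v)) = 0" for i using ap[of i 1 v] v(2)[of "i + 1"] by simp
      then show ?thesis using inv[OF v(1)] by (simp add: S'_def)
    qed
    define X where "X l = app (a ^ l) x" for l
    have XS: "X l \<in> S" for l unfolding X_def by (rule invp[OF x(1)])
    have Xnot: "X l \<notin> S'" if "l \<le> m" for l
    proof
      assume "X l \<in> S'"
      then have "\<phi> (app (a ^ (m - l)) (X l)) = 0" by (simp add: S'_def)
      then show False using that \<phi>y by (simp add: X_def ap y_def)
    qed
    have aX: "app a (X l) = X (Suc l)" for l by (simp add: X_def app_mult)
    have X0: "X l = 0" if "l > m" for l using zero[OF that x(1)] by (simp add: X_def)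
    have Xinj: "l = l'" if "X l = X l'" "l \<le> m" "l' \<le> m" for l l'
    proof (rule ccontr)
      assume "l \<noteq> l'"
      have *: False if "X l = X l'" "l < l'" "l' \<le> m" for l l'
      proof -
        have "app (a ^ (m - l)) (X l) = y" using that(2,3) by (simp add: X_def ap y_def)
        moreover have "app (a ^ (m - l)) (X l') = 0" using that(2,3) zero[OF _ x(1), of "m - l + l'"] by (simp add: X_def ap)
        ultimately show False using that \<phi>y \<phi>lin(4) by metis
      qed
      show False using *[of l l'] *[of l' l] that \<open>l \<noteq> l'\<close> by (cases "l < l'") auto
    qed
    have "S' \<subset> S" using Xnot[of 0] XS[of 0] by (auto simp: S'_def)
    then have "vec.dim S' < vec.dim S"
      using vec.dim_psubset[of S' S] sub sub' by (simp add: vec.span_eq_iff[THEN iffD2])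
    from less.hyps[OF this sub' inv'] obtain B' j' where B': "chain_basis a S' B' j'" by blast
    then have ind': "vec.independent B'" and span': "vec.span B' = S'" by (auto simp: chain_basis_def)
    have BS: "B' \<subseteq> S'" using span' vec.span_superset by blast
    define C where "C i = B' \<union> X ` {i..m}" for i
    \<comment> \<open>Chain vectors are adjoined from the end: applying \<open>a ^ (m - i)\<close>
      and then \<open>\<phi>\<close> detects \<open>X i\<close> but annihilates all later chain
      vectors and all of \<open>S'\<close>.\<close>
    have indC: "vec.independent (C i)" if "i \<le> Suc m" for i
      using that
    proof (induction rule: inc_induct)
      case base
      then show ?case using ind' by (simp add: C_def)
    next
      case (step i)
      have "{i..m} = insert i {Suc i..m}" using step by auto
      then have C: "C i = insert (X i) (C (Suc i))" by (simp add: C_def)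
      define Q where "Q = {v. \<phi> (app (a ^ (m - i)) v) = 0}"
      have "vec.subspace Q" unfolding vec.subspace_def Q_def by (auto simp: app_add_right app_vscale \<phi>lin)
      moreover have "C (Suc i) \<subseteq> Q"
      proof -
        have "X l \<in> Q" if "l \<in> {Suc i..m}" for l
        proof -
          have "app (a ^ (m - i + l)) x = 0" by (rule zero[OF _ x(1)]) (use that step in auto)
          then show ?thesis by (simp add: Q_def X_def ap \<phi>lin)
        qed
        then show ?thesis using BS by (auto simp: C_def Q_def S'_def)
      qed
      ultimately have "vec.span (C (Suc i)) \<subseteq> Q" by (rule vec.span_minimal[rotated])
      moreover have "X i \<notin> Q" using step \<phi>y by (simp add: Q_def X_def ap y_def)
      ultimately have "X i \<notin> vec.span (C (Suc i))" by blast
      then show ?case unfolding C using step.IH by (simp add: vec.independent_insert)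
    qed
    define B where "B = C 0"
    have B: "B = B' \<union> X ` {..m}" by (simp add: B_def C_def atMost_atLeast0)
    have "vec.independent B" using indC[of 0] by (simp add: B_def)
    moreover have "vec.span B = S"
    proof
      show "vec.span B \<subseteq> S"
        using BS XS by (intro vec.span_minimal[OF _ sub]) (auto simp: B S'_def)
      show "S \<subseteq> vec.span B"
      proof
        fix v assume v: "v \<in> S"
        \<comment> \<open>A triangular system: the coefficient of \<open>X n\<close> is chosen to
          cancel the value of \<open>\<phi>\<close> at exponent \<open>m - n\<close> and leaves the
          higher exponents unchanged. After \<open>Suc m\<close> corrections the remainder lies in
          \<open>S'\<close>.\<close>
        have "\<exists>u. u \<in> vec.span B \<and> u \<in> S \<and> (\<forall>i. Suc m \<le> i + n \<longrightarrow> \<phi> (app (a ^ i) (v - u)) = 0)" if "n \<le> Suc m" for n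
          using that
        proof (induction n)
          case 0
          have "\<phi> (app (a ^ i) (v - 0)) = 0" if "Suc m \<le> i" for i using zero[of i v] that v by (simp add: \<phi>lin)
          then show ?case using vec.span_zero vec.subspace_0[OF sub] by (intro exI[of _ 0]) auto
        next
          case (Suc n)
          then obtain u where u: "u \<in> vec.span B" "u \<in> S" "\<And>i. Suc m \<le> i + n \<Longrightarrow> \<phi> (app (a ^ i) (v - u)) = 0" by auto
          define c where "c = \<phi> (app (a ^ (m - n)) (v - u)) / \<phi> y"
          define u' where "u' = u + c *s X n"
          have "X n \<in> B" using Suc.prems by (auto simp: B)
          then have "u' \<in> vec.span B" unfolding u'_def using u(1) vec.span_add vec.span_scale vec.span_base by blast
          moreover have "u' \<in> S" unfolding u'_def using u(2) XS Ssum by blast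
          moreover have "\<phi> (app (a ^ i) (v - u')) = 0" if "Suc m \<le> i + Suc n" for i
          proof -
            have e: "\<phi> (app (a ^ i) (v - u')) = \<phi> (app (a ^ i) (v - u)) - c * \<phi> (app (a ^ (i + n)) x)"
              by (simp add: u'_def app_diff_right app_add_right app_vscale \<phi>lin X_def ap)
            show ?thesis
            proof (cases "Suc m \<le> i + n")
              case True
              then show ?thesis using u(3)[OF True] zero[OF _ x(1), of "i + n"] by (simp add: e \<phi>lin)
            next
              case False
              then have "i = m - n" "i + n = m" using that Suc.prems by auto
              then show ?thesis using \<phi>y unfolding e by (simp add: c_def flip: y_def)
            qed
          qed
          ultimately show ?case by blast
        qed
        from this[of "Suc m"] obtain u where u: "u \<in> vec.span B" "u \<in> S" "\<And>i. \<phi> (app (a ^ i) (v - u)) = 0" by auto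
        then have "v - u \<in> vec.span B'" unfolding span' S'_def using v Ssum by blast
        then have "v - u \<in> vec.span B" using vec.span_mono[of B' B] B by blast
        then show "v \<in> vec.span B" using vec.span_add[OF _ u(1), of "v - u"] by simp
      qed
    qed
    moreover
    define j where "j b = (if b \<in> S' then j' b else (THE l. l \<le> m \<and> b = X l))" for b
    have jX: "j (X l) = l" if "l \<le> m" for l
      unfolding j_def using Xnot[OF that] by (simp, intro the_equality) (use that Xinj in auto)
    have jB: "j b = j' b" if "b \<in> B'" for b using that BS by (auto simp: j_def)
    have B'D: "app a b = 0 \<or> app a b \<in> B' \<and> j' (app a b) = Suc (j' b)" "j' b > 0 \<longrightarrow> (\<exists>c\<in>B'. app a c = b)"
      "\<And>c. c \<in> B' \<Longrightarrow> app a b = app a c \<Longrightarrow> app a b \<noteq> 0 \<Longrightarrow> b = c" if "b \<in> B'" for b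
      using B' that unfolding chain_basis_def by blast+
    have "app a b = 0 \<or> app a b \<in> B \<and> j (app a b) = Suc (j b)" if "b \<in> B" for b
    proof -
      from that consider "b \<in> B'" | l where "l \<le> m" "b = X l" by (auto simp: B)
      then show ?thesis
      proof cases
        case 1
        then show ?thesis using B'D(1)[OF 1] jB by (auto simp: B)
      next
        case 2
        then show ?thesis using X0[of "Suc l"] jX[of "Suc l"] jX[of l] by (cases "Suc l \<le> m") (auto simp: aX B)
      qed
    qed
    moreover have "\<exists>c\<in>B. app a c = b" if "b \<in> B" "j b > 0" for b
    proof -
      from that consider "b \<in> B'" | l where "l \<le> m" "b = X l" by (auto simp: B)
      then show ?thesis
      proof cases
        case 1
        then show ?thesis using B'D(2)[OF 1] jB[OF 1] that by (auto simp: B)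
      next
        case 2
        then obtain l' where "l = Suc l'" using jX[of l] \<open>j b > 0\<close> by (cases l) auto
        then show ?thesis using 2 aX[of l'] by (intro bexI[of _ "X l'"]) (auto simp: B)
      qed
    qed
    moreover have "b = c" if "b \<in> B" "c \<in> B" "app a b = app a c" "app a b \<noteq> 0" for b c
    proof -
      have mixed: False if "b \<in> B'" "l \<le> m" "app a b = app a (X l)" "app a b \<noteq> 0" for b l
      proof -
        have "app a b \<in> S'" using that(1) BS inv' by blast
        moreover have "Suc l \<le> m" using that X0[of "Suc l"] by (force simp: aX)
        ultimately show False using that Xnot[of "Suc l"] by (simp add: aX)
      qed
      have B1: "b \<in> B' \<or> (\<exists>l\<le>m. b = X l)" and B2: "c \<in> B' \<or> (\<exists>l\<le>m. c = X l)" using that by (auto simp: B)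
      show ?thesis
      proof (cases "b \<in> B'")
        case True
        then show ?thesis using B2 mixed[OF True, of] B'D(3)[OF True] that by metis
      next
        case False
        then obtain l where l: "l \<le> m" "b = X l" using B1 by blast
        show ?thesis
        proof (cases "c \<in> B'")
          case True
          then show ?thesis using mixed[OF True l(1)] l that by metis
        next
          case False
          then obtain l' where l': "l' \<le> m" "c = X l'" using B2 by blast
          have "X (Suc l) = X (Suc l')" using that l l' by (simp add: aX)
          moreover have "Suc l \<le> m" "Suc l' \<le> m" using that l l' X0[of "Suc l"] X0[of "Suc l'"] by (force simp: aX)+
          ultimately show ?thesis using Xinj[of "Suc l" "Suc l'"] l l' by simp
        qed
      qed
    qed
    ultimately have "chain_basis a S B j" unfolding chain_basis_def by blast
    then show ?thesis by blast
  qed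
qed

subsection \<open>Nilpotent matrices\<close>

lemma basis_matrix:
  fixes B :: "(complex^'n) set"
  assumes "vec.independent B" "vec.span B = UNIV"
  obtains f :: "'n \<Rightarrow> complex^'n" and p p' where "bij_betw f UNIV B" "\<And>i. app p (axis i 1) = f i" "p * p' = 1" "p' * p = 1"
proof -
  have "card B = vec.dim (UNIV :: (complex^'n) set)"
    using vec.dim_span_eq_card_independent[OF assms(1)] assms(2) by simp
  also have "\<dots> = CARD('n)" by (simp add: card_cart_basis)
  finally obtain f :: "'n \<Rightarrow> complex^'n" where f: "bij_betw f UNIV B"
    using vec.finiteI_independent[OF assms(1)] by (metis finite_class.finite_UNIV finite_same_card_bij)
  define M :: "complex^'n^'n" where "M = (\<chi> i j. f j $ i)"
  have col: "column i M = f i" for i by (simp add: M_def column_def vec_eq_iff)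
  then have "columns M = B" using f by (auto simp: columns_def bij_betw_def)
  then obtain M' where "M ** M' = mat 1"
    using matrix_right_invertible_span_columns[of M] assms(2) by auto
  then have "Cmat M * Cmat M' = 1" by (simp add: times_cmat_def one_cmat_def)
  moreover have "app (Cmat M) (axis i 1) = f i" for i
    by (simp add: vec_eq_iff app_axis M_def)
  ultimately show ?thesis using that[of f "Cmat M" "Cmat M'"] f cmat_inverse_commute by blast
qed

text \<open>Declaring the chain basis orthogonal with \<open>\<parallel>b\<parallel>\<^sup>2 = (j b)!\<close> makes \<open>a\<close> a truncated creation operator with
  \<open>a a\<^sup>* b = j b \<cdot> b\<close>.\<close>

lemma nilpotent_imp_soliton:
  fixes A :: "complex^'n^'n"
  assumes "nilpotent_mat A"
  shows "\<exists>g. hcf_soliton A g"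
proof -
  obtain k where "mpow A k = 0" using assms unfolding nilpotent_mat_def by blast
  then have "Cmat A ^ k = 0" by (metis Cmat_mat_of mpow_eq zero_cmat_def)
  then obtain B j where cb: "chain_basis (Cmat A) UNIV B j"
    using chain_basis_exists[of "Cmat A" k UNIV] vec.subspace_UNIV by blast
  then have B: "vec.independent B" "vec.span B = UNIV" by (auto simp: chain_basis_def)
  have next_b: "A *v b = 0 \<or> A *v b \<in> B \<and> j (A *v b) = Suc (j b)" if "b \<in> B" for b
    using cb that unfolding chain_basis_def app_Cmat by blast
  have pred: "\<exists>c\<in>B. A *v c = b" if "b \<in> B" "j b > 0" for b
    using cb that unfolding chain_basis_def app_Cmat by blast
  have inj: "b = c" if "b \<in> B" "c \<in> B" "A *v b = A *v c" "A *v b \<noteq> 0" for b c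
    using cb that unfolding chain_basis_def app_Cmat by blast
  obtain f :: "'n \<Rightarrow> complex^'n" and p p' where f: "bij_betw f UNIV B" and p: "\<And>i. app p (axis i 1) = f i" "p * p' = 1" "p' * p = 1"
    using basis_matrix[OF B] by blast
  have fB: "f i \<in> B" for i using f by (auto simp: bij_betw_def)
  have finj: "f i = f i' \<longleftrightarrow> i = i'" for i i' using f by (auto simp: bij_betw_def inj_def)
  have fsurj: "\<exists>i. b = f i" if "b \<in> B" for b using f that by (auto simp: bij_betw_def)
  have f0: "f i \<noteq> 0" for i using B(1) fB vec.dependent_zero by metis
  define n where "n i = j (f i)" for i
  define w :: "'n \<Rightarrow> real" where "w i = sqrt (fact (n i))" for i
  have w: "w i > 0" for i by (simp add: w_def)
  define dg where "dg c = Cmat (\<chi> i i'. if i = i' then complex_of_real (c i) else 0)" for c :: "'n \<Rightarrow> real"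
  have dg_app: "app (dg c) v $ i = of_real (c i) * v $ i" for c v i
    by (simp add: dg_def app_expand if_distrib if_distribR cong: if_cong)
  have dg_axis: "app (dg c) (axis i 1) = of_real (c i) *s axis i 1" for c i
    by (simp add: vec_eq_iff dg_app axis_def)
  define r where "r = p * dg (\<lambda>i. 1 / w i)"
  define q where "q = dg w * p'"
  have dw: "dg w * dg (\<lambda>i. 1 / w i) = 1"
    by (rule cmat_eqI) (use w in \<open>simp add: app_mult vec_eq_iff dg_app less_imp_neq[symmetric]\<close>)
  have "q * r = dg w * (p' * p) * dg (\<lambda>i. 1 / w i)" by (simp add: q_def r_def mult.assoc)
  then have qr: "q * r = 1" by (simp add: p dw)
  then have rq: "r * q = 1" by (rule cmat_inverse_commute)
  have r_axis: "app r (axis i 1) = of_real (1 / w i) *s f i" for i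
    by (simp only: r_def app_mult dg_axis app_vscale p)
  \<comment> \<open>The matrix of \<open>A\<close> in the normalised chain basis: a step to position
    \<open>n k\<close> multiplies the squared norm by \<open>n k\<close>, whence the square
    root.\<close>
  define a where "a = Cmat (\<chi> k i. if A *v f i = f k then complex_of_real (sqrt (real (n k))) else 0)"
  have n_next: "n k = Suc (n i)" if "A *v f i = f k" for i k
    using next_b[OF fB[of i]] f0[of k] that by (auto simp: n_def)
  have "r * a = Cmat A * r"
  proof (rule app_cong_axis)
    fix i l
    have "app (r * a) (axis i 1) = app (Cmat A * r) (axis i 1)"
    proof -
      have "app (r * a) (axis i 1) = app r (\<Sum>k\<in>UNIV. app a (axis i 1) $ k *s axis k 1)"
        by (simp only: app_mult basis_expansion)
      also have "\<dots> = (\<Sum>k\<in>UNIV. mat_of a $ k $ i *s (of_real (1 / w k) *s f k))"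
        by (simp only: app_sum_right app_vscale r_axis app_axis)
      also have "\<dots> = of_real (1 / w i) *s (A *v f i)"
      proof (cases "A *v f i = 0")
        case True
        then show ?thesis using f0 by (simp add: a_def)
      next
        case False
        then obtain k where k: "A *v f i = f k" using next_b[OF fB[of i]] fsurj by blast
        have "(\<Sum>k'\<in>UNIV. mat_of a $ k' $ i *s (of_real (1 / w k') *s f k')) = (\<Sum>k'\<in>UNIV. if k' = k then of_real (sqrt (real (n k)) / w k) *s f k else 0)"
          by (rule sum.cong) (auto simp: a_def k finj)
        also have "\<dots> = of_real (sqrt (real (n k)) / w k) *s f k" by simp
        also have "sqrt (real (n k)) / w k = 1 / w i"
          unfolding w_def n_next[OF k] by (simp add: real_sqrt_mult del: of_nat_Suc)
        finally show ?thesis by (simp add: k)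
      qed
      also have "\<dots> = app (Cmat A * r) (axis i 1)"
        by (simp only: app_mult r_axis app_vscale app_Cmat)
      finally show ?thesis .
    qed
    then show "app (r * a) (axis i 1) $ l = app (Cmat A * r) (axis i 1) $ l" by simp
  qed
  then have a: "a = q * Cmat A * r" using qr by (metis mult.assoc mult_1)
  \<comment> \<open>Half of the position operator plus 1. Thus \<open>E + star E\<close> is the
    position plus 1, which exceeds \<open>a * star a\<close> by the identity, and raising the
    position by one gives \<open>d = 1/2\<close>.\<close>
  define E where "E = dg (\<lambda>i. (real (n i) + 1) / 2)"
  have Es: "star E = E"
    unfolding E_def dg_def star_def by (rule arg_cong[of _ _ Cmat]) (auto simp: vec_eq_iff)
  \<comment> \<open>Off-diagonal entries vanish because a vector has one image; a diagonal entry has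
    at most one summand because chains do not merge, and none at position 0.\<close>
  have aa: "mat_of (a * star a) $ k $ l = (if k = l then of_nat (n k) else 0)" for k l
  proof -
    have e: "mat_of (a * star a) $ k $ l = (\<Sum>i\<in>UNIV. if A *v f i = f k \<and> A *v f i = f l then of_real (sqrt (real (n k)) * sqrt (real (n l))) else 0)"
      unfolding times_cmat_def star_def a_def matrix_matrix_mult_def 
      by (simp only: mat_of_Cmat vec_lambda_beta, intro sum.cong refl, auto)
    show ?thesis
    proof (cases "k = l")
      case False
      then have "\<not> (A *v f i = f k \<and> A *v f i = f l)" for i using finj by metis
      then show ?thesis unfolding e using False by (simp only: if_False sum.neutral_const)
    next
      case True
      show ?thesis
      proof (cases "n k = 0")
        case True
        then have "A *v f i \<noteq> f k" for i using n_next[of i k] by auto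
        then show ?thesis unfolding e using \<open>k = l\<close> True by simp
      next
        case False
        then obtain i0 where i0: "A *v f i0 = f k" using pred[OF fB[of k]] fsurj by (auto simp: n_def)
        have "A *v f i = f k \<longleftrightarrow> i = i0" for i
          using inj[OF fB[of i] fB[of i0]] i0 f0[of k] finj by auto
        then have "mat_of (a * star a) $ k $ l = of_real (sqrt (real (n k)) * sqrt (real (n k)))"
          unfolding e using \<open>k = l\<close> by simp
        then show ?thesis using \<open>k = l\<close> by simp
      qed
    qed
  qed
  have "a * star a = E + star E - (2 * Re (1/2)) *\<^sub>R 1"
  proof (rule app_cong_axis)
    fix i l
    show "app (a * star a) (axis l 1) $ i = app (E + star E - (2 * Re (1/2)) *\<^sub>R 1) (axis l 1) $ i"
      unfolding Es app_axis[of "a * star a"] aa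
      by (simp add: E_def app_add app_diff dg_app) (simp add: axis_def field_simps)
  qed
  moreover have "E * a - a * E = csc (1/2) a"
  proof (rule app_cong_axis)
    fix k i
    have "app (E * a - a * E) (axis i 1) $ k = (of_nat (n k) + 1) / 2 * mat_of a $ k $ i - (of_nat (n i) + 1) / 2 * mat_of a $ k $ i"
      by (simp add: E_def app_diff app_mult dg_app dg_axis app_vscale app_axis)
    also have "\<dots> = (1/2) * mat_of a $ k $ i"
    proof (cases "A *v f i = f k")
      case True
      then show ?thesis using n_next[OF True] by (simp add: field_simps)
    qed (simp add: a_def)
    finally show "app (E * a - a * E) (axis i 1) $ k = app (csc (1/2) a) (axis i 1) $ k"
      by (simp add: app_csc app_axis)
  qed
  ultimately show ?thesis using hcf_soliton_exists[OF qr rq a] by blast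
qed

section \<open>Normal matrices are diagonalizable\<close>

text \<open>Minimise the quadratic form on the unit sphere of \<open>W\<close>: \<open>h\<close>
  minus the minimum is positive semidefinite on \<open>W\<close> and has the minimiser as a null
  vector.\<close>

lemma hermitian_eigenvector:
  fixes h :: "'n::finite cmat"
  assumes h: "star h = h" and W: "subspace W" "\<And>v. v \<in> W \<Longrightarrow> app h v \<in> W" and w: "w \<in> W" "w \<noteq> 0"
  obtains u \<mu> where "u \<in> W" "u \<noteq> 0" "app h u = (\<mu>::real) *\<^sub>R u"
proof -
  have "compact (sphere 0 1 \<inter> W)" using closed_subspace[OF W(1)] by (simp add: compact_Int_closed)
  moreover have "(1 / norm w) *\<^sub>R w \<in> sphere 0 1 \<inter> W" using w W(1) by (simp add: subspace_scale)
  then have "sphere 0 1 \<inter> W \<noteq> {}" by blast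
  moreover have "continuous_on (sphere 0 1 \<inter> W) (qf h)"
    unfolding qf_def Re_cin by (intro continuous_intros linear_continuous_on bounded_linear_app)
  ultimately obtain u where u: "u \<in> sphere 0 1 \<inter> W" "\<And>v. v \<in> sphere 0 1 \<inter> W \<Longrightarrow> qf h u \<le> qf h v"
    by (metis continuous_attains_inf)
  define s where "s = qf h u"
  have "app (h - s *\<^sub>R 1) u = 0"
  proof (rule qf_psd_null_on[OF _ W(1)])
    show "star (h - s *\<^sub>R 1) = h - s *\<^sub>R 1" by (simp add: h)
    show "app (h - s *\<^sub>R 1) v \<in> W" if "v \<in> W" for v
      using that W by (simp add: app_diff app_scaleR subspace_diff subspace_scale)
    show "qf (h - s *\<^sub>R 1) v \<ge> 0" if "v \<in> W" for v
    proof (cases "v = 0")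
      case False
      have "qf h u \<le> qf h ((1 / norm v) *\<^sub>R v)"
        by (rule u(2)) (use that False W(1) in \<open>simp add: subspace_scale\<close>)
      then show ?thesis using False by (simp add: qf_simps s_def power_divide field_simps)
    qed (simp add: qf_def)
    show "u \<in> W" "qf (h - s *\<^sub>R 1) u = 0" using u(1) by (simp_all add: qf_simps s_def)
  qed
  then have "app h u = s *\<^sub>R u" by (simp add: app_diff app_scaleR)
  moreover have "u \<noteq> 0" using u(1) by auto
  ultimately show ?thesis using that[of u s] u(1) by blast
qed

text \<open>\<open>a\<close> is a combination of the commuting Hermitian matrices \<open>h\<close>
  and \<open>k\<close>. Find an eigenvector of \<open>k\<close> inside an eigenspace of
  \<open>h\<close>; real subspaces suffice since both eigenvalues are real.\<close>

lemma normal_eigenvector: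
  fixes a :: "'n::finite cmat"
  assumes n: "a * star a = star a * a" and W: "subspace W" "\<And>c v. v \<in> W \<Longrightarrow> c *s v \<in> W"
    "\<And>v. v \<in> W \<Longrightarrow> app a v \<in> W" "\<And>v. v \<in> W \<Longrightarrow> app (star a) v \<in> W" and w: "w \<in> W" "w \<noteq> 0"
  obtains u \<mu> where "u \<in> W" "u \<noteq> 0" "app a u = \<mu> *s u"
proof -
  define h where "h = a + star a"
  define k where "k = csc \<i> (a - star a)"
  have hs: "star h = h" "star k = k"
    by (simp_all add: h_def k_def) (rule cmat_eqI, simp add: app_csc app_diff vec_eq_iff algebra_simps)
  obtain u \<mu> where u: "u \<in> W" "u \<noteq> 0" "app h u = (\<mu>::real) *\<^sub>R u"
    using hermitian_eigenvector[OF hs(1) W(1) _ w] W by (metis app_add h_def subspace_add)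
  define W' where "W' = W \<inter> {v. app h v = \<mu> *\<^sub>R v}"
  have "subspace {v. app h v = \<mu> *\<^sub>R v}"
    by (auto simp: subspace_def app_add_right app_scaleR_right scaleR_add_right)
  then have W': "subspace W'" unfolding W'_def by (rule subspace_inter[OF W(1)])
  have hk: "h * k = k * h"
    unfolding h_def k_def using n by (simp add: algebra_simps flip: csc_add_right)
  have "app k v \<in> W'" if "v \<in> W'" for v
  proof -
    have v: "v \<in> W" "app h v = \<mu> *\<^sub>R v" using that by (auto simp: W'_def)
    have "app k v \<in> W" unfolding k_def app_csc app_diff using v(1) W by (simp add: subspace_diff)
    moreover have "app h (app k v) = \<mu> *\<^sub>R app k v" by (metis app_mult app_scaleR_right hk v(2))
    ultimately show ?thesis by (simp add: W'_def)
  qed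
  moreover have "u \<in> W'" using u by (simp add: W'_def)
  ultimately obtain v \<nu> where v: "v \<in> W'" "v \<noteq> 0" "app k v = (\<nu>::real) *\<^sub>R v"
    using hermitian_eigenvector[OF hs(2) W'] u(2) by metis
  have "app h v = \<mu> *\<^sub>R v" using v by (simp add: W'_def)
  then have 1: "app a v + app (star a) v = of_real \<mu> *s v" by (simp add: h_def app_add vscale_real)
  have 2: "\<i> *s (app a v - app (star a) v) = of_real \<nu> *s v" using v(3) by (simp add: k_def app_csc app_diff vscale_real)
  have "app a v = ((of_real \<mu> - \<i> * of_real \<nu>) / 2) *s v"
    unfolding vec_eq_iff
  proof
    fix i
    have "app a v $ i + app (star a) v $ i = of_real \<mu> * v $ i" using 1 by (metis vector_add_component vector_smult_component)
    moreover have "\<i> * (app a v $ i - app (star a) v $ i) = of_real \<nu> * v $ i" using 2 by (metis vector_minus_component vector_smult_component)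
    then have "app a v $ i - app (star a) v $ i = - \<i> * of_real \<nu> * v $ i"
      by (metis (no_types, lifting) complex_i_mult_minus minus_mult_left minus_minus mult.assoc)
    moreover have "2 * app a v $ i = (app a v $ i + app (star a) v $ i) + (app a v $ i - app (star a) v $ i)" by simp
    ultimately have "2 * app a v $ i = of_real \<mu> * v $ i - \<i> * of_real \<nu> * v $ i" by (simp only:) simp
    then show "app a v $ i = (((of_real \<mu> - \<i> * of_real \<nu>) / 2) *s v) $ i" by (simp add: field_simps)
  qed
  then show ?thesis using that v(1,2) by (auto simp: W'_def)
qed

text \<open>By normality eigenvectors of \<open>a\<close> are eigenvectors of \<open>star a\<close>,
  so the orthogonal complement of all eigenvectors is invariant under both. If it were nonzero it
  would contain an eigenvector orthogonal to itself.\<close>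

lemma normal_diagonalizable:
  fixes a :: "'n::finite cmat"
  assumes n: "a * star a = star a * a"
  obtains p p' and \<mu> :: "'n \<Rightarrow> complex" where "p * p' = 1" "p' * p = 1" "\<And>i. app a (app p (axis i 1)) = \<mu> i *s app p (axis i 1)"
proof -
  define Eg where "Eg = {v. \<exists>\<mu>. app a v = \<mu> *s v}"
  have star_eig: "app (star a) v = cnj \<mu> *s v" if "app a v = \<mu> *s v" for v \<mu>
  proof -
    define b where "b = a - csc \<mu> 1"
    have "b * star b = star b * b" using n by (simp add: b_def algebra_simps csc_diff_right)
    then have "cin (app (star b) v) (app (star b) v) = cin (app b v) (app b v)"
      by (metis app_mult cin_app star_star)
    moreover have "app b v = 0" using that by (simp add: b_def app_diff app_csc)
    ultimately have "app (star b) v = 0" by (simp add: cin_self)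
    then show ?thesis by (simp add: b_def app_diff app_csc)
  qed
  define W where "W = {w. \<forall>v\<in>Eg. cin v w = 0}"
  have Ws: "subspace W" by (auto simp: subspace_def W_def cin_add_right cin_scaleR_right)
  have Wc: "c *s v \<in> W" if "v \<in> W" for c v using that by (simp add: W_def cin_vscale_right)
  have Wa: "app a w \<in> W" if "w \<in> W" for w
    unfolding W_def
  proof (safe)
    fix v assume "v \<in> Eg"
    then obtain \<mu> where "app a v = \<mu> *s v" by (auto simp: Eg_def)
    then have "app (star a) v = cnj \<mu> *s v" by (rule star_eig)
    then have "cin v (app a w) = cnj \<mu> * cin v w" by (simp add: cin_app_right cin_vscale_left)
    then show "cin v (app a w) = 0" using that \<open>v \<in> Eg\<close> by (simp add: W_def)
  qed
  have Wsa: "app (star a) w \<in> W" if "w \<in> W" for w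
    unfolding W_def
  proof (safe)
    fix v assume "v \<in> Eg"
    then obtain \<mu> where "app a v = \<mu> *s v" by (auto simp: Eg_def)
    then have "cin v (app (star a) w) = \<mu> * cin v w" by (simp add: cin_app_right cin_vscale_left)
    then show "cin v (app (star a) w) = 0" using that \<open>v \<in> Eg\<close> by (simp add: W_def)
  qed
  have W0: "w = 0" if wW: "w \<in> W" for w
  proof (rule ccontr)
    assume "w \<noteq> 0"
    then obtain u \<mu> where u: "u \<in> W" "u \<noteq> 0" "app a u = \<mu> *s u"
      using normal_eigenvector[OF n Ws Wc Wa Wsa wW] by metis
    then have "cin u u = 0" by (auto simp: W_def Eg_def)
    then show False using u(2) by (simp add: cin_self)
  qed
  have spanU: "span Eg = UNIV"
  proof -
    have "x \<in> span Eg" for x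
    proof -
      obtain y z where yz: "y \<in> span Eg" "\<And>w. w \<in> span Eg \<Longrightarrow> orthogonal z w" "x = y + z"
        using orthogonal_subspace_decomp_exists by blast
      have "z \<in> W"
        unfolding W_def
      proof safe
        fix v assume "v \<in> Eg"
        then have "c *s v \<in> Eg" for c by (auto simp: Eg_def app_vscale mult.commute)
        then have "inner z (c *s v) = 0" for c using yz(2) span_base by (metis orthogonal_def)
        then have "cin z v = 0" by (rule cin_eq_0_of_inner)
        then show "cin v z = 0" by (metis cin_commute complex_cnj_zero)
      qed
      then have "z = 0" by (rule W0)
      then show ?thesis using yz by simp
    qed
    then show ?thesis by blast
  qed
  have vspan: "vec.span Eg = UNIV"
  proof -
    have "subspace (vec.span Eg)"
      unfolding subspace_def using vec.span_zero vec.span_add vec.span_scale by (metis vscale_real)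
    then have "span Eg \<subseteq> vec.span Eg" by (rule span_minimal[OF vec.span_superset])
    then show ?thesis using spanU by blast
  qed
  obtain B where B: "B \<subseteq> Eg" "vec.independent B" "Eg \<subseteq> vec.span B"
    by (rule vec.basis_exists[of Eg])
  have "vec.span Eg \<subseteq> vec.span B" by (rule vec.span_minimal[OF B(3) vec.subspace_span])
  then have "vec.span B = UNIV" unfolding vspan by blast
  from basis_matrix[OF B(2) this] obtain f :: "'n \<Rightarrow> complex^'n" and p p'
    where f: "bij_betw f UNIV B" and p: "\<And>i. app p (axis i 1) = f i" "p * p' = 1" "p' * p = 1" by blast
  have "\<exists>\<mu>. app a (f i) = \<mu> *s f i" for i using f B(1) by (auto simp: bij_betw_def Eg_def)
  then obtain \<mu> where "\<And>i. app a (f i) = \<mu> i *s f i" by metis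
  then show ?thesis using that[of p p' \<mu>] p by simp
qed

lemma normal_imp_semisimple:
  fixes A :: "complex^'n^'n"
  assumes qr: "q * r = 1" "r * q = 1" and n: "(q * Cmat A * r) * star (q * Cmat A * r) = star (q * Cmat A * r) * (q * Cmat A * r)"
  shows "semisimple_mat A"
proof -
  define a where "a = q * Cmat A * r"
  obtain p p' \<mu> where p: "p * p' = 1" "p' * p = 1" "\<And>i. app a (app p (axis i 1)) = \<mu> i *s app p (axis i 1)"
    using normal_diagonalizable[OF n] unfolding a_def by blast
  define D where "D = (\<chi> i j. if i = j then \<mu> i else 0)"
  have Dax: "app (Cmat D) (axis i 1) = \<mu> i *s axis i 1" for i
    by (simp add: vec_eq_iff app_axis) (simp add: D_def axis_def)
  have "a * p = p * Cmat D"
    by (rule app_cong_axis) (simp add: app_mult p(3) Dax app_vscale)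
  then have "Cmat A * (r * p) = r * p * Cmat D"
    unfolding a_def using qr by (metis mult.assoc mult_1)
  then have A: "Cmat A = r * p * Cmat D * (p' * q)"
    using qr p by (metis mult.assoc mult_1_right)
  have inv: "r * p * (p' * q) = 1" using qr p by (metis mult.assoc mult_1_right)
  then have inv': "p' * q * (r * p) = 1" by (rule cmat_inverse_commute)
  define P where "P = mat_of (r * p)"
  define P' where "P' = mat_of (p' * q)"
  have PP: "P ** P' = mat 1" "P' ** P = mat 1"
    using inv inv' unfolding P_def P'_def by (metis mat_of_Cmat one_cmat_def times_cmat_def)+
  have "A = mat_of (Cmat A)" by simp
  also have "\<dots> = P ** D ** P'" unfolding A by (simp add: times_cmat_def P_def P'_def)
  also have "P' = matrix_inv P" using matrix_inv_eqI[OF PP] by simp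
  finally have "A = P ** D ** matrix_inv P" .
  moreover have "invertible P" using PP by (auto simp: invertible_def)
  moreover have "\<forall>i j. i \<noteq> j \<longrightarrow> D $ i $ j = 0" by (simp add: D_def)
  ultimately show ?thesis unfolding semisimple_mat_def by blast
qed

lemma soliton_imp_semisimple_or_nilpotent:
  assumes "hcf_soliton A g"
  shows "semisimple_mat A \<or> nilpotent_mat A"
proof -
  obtain N y q r E d where ad: "adapted (g 0) N y q r"
    and eq: "N *\<^sub>R ((q * Cmat A * r) * star (q * Cmat A * r)) = E + star E - (2 * Re d) *\<^sub>R 1"
      "E * (q * Cmat A * r) - (q * Cmat A * r) * E = csc d (q * Cmat A * r)"
    using soliton_algebra[OF assms] by blast
  have N: "N > 0" and qr: "q * r = 1" "r * q = 1" using ad by (auto simp: adapted_def)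
  from soliton_normal_or_graded[OF N eq] show ?thesis
  proof
    assume "(q * Cmat A * r) * star (q * Cmat A * r) = star (q * Cmat A * r) * (q * Cmat A * r)"
    then show ?thesis using normal_imp_semisimple[OF qr] by blast
  next
    assume "(\<exists>k. (q * Cmat A * r) ^ k = 0) \<and> (\<forall>k. (q * Cmat A * r) ^ k = 0 \<longrightarrow> (\<exists>\<kappa> e. graded \<kappa> k (q * Cmat A * r) e))"
    then obtain k where k: "(q * Cmat A * r) ^ k = 0" by blast
    have "(q * Cmat A * r) * q = q * Cmat A" using qr by (simp add: mult.assoc)
    then have "(q * Cmat A * r) ^ k * q = q * Cmat A ^ k" by (rule intertwine_power)
    then have "r * (q * Cmat A ^ k) = 0" using k by simp
    then have "Cmat A ^ k = 0" using qr by (simp add: mult.assoc[symmetric])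
    then have "mpow A k = 0" by (simp add: mpow_eq zero_cmat_def)
    then show ?thesis unfolding nilpotent_mat_def by blast
  qed
qed

section \<open>Automorphisms of the group\<close>

lemma holo_of_has_derivative:
  assumes d: "\<And>p. (\<phi> has_derivative \<phi>' p) (at p)" and c: "\<And>p c u. \<phi>' p (c *s u) = c *s \<phi>' p u"
  shows "holo \<phi>" and "frechet_derivative \<phi> (at p) = \<phi>' p"
proof -
  show *: "frechet_derivative \<phi> (at p) = \<phi>' p" for p
    using d by (metis frechet_derivative_at)
  show "holo \<phi>" unfolding holo_def * using d c by (auto simp: differentiable_def)
qed

text \<open>The Lie algebra automorphism \<open>Z\<^sub>0 \<mapsto> \<alpha> Z\<^sub>0 + y\<close>, \<open>w \<mapsto> B w\<close> integrates to
  \<open>(s, w) \<mapsto> (\<alpha> s, B w + \<psi> s)\<close>, where \<open>s \<mapsto> (\<alpha> s, \<psi> s)\<close> is the one-parameter subgroup through \<open>\<alpha> Z\<^sub>0 + y\<close>;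
  \<open>\<psi> s\<close> is read off the \<open>Z\<^sub>0\<close> column of \<open>exp (s L)\<close> for the block matrix \<open>L\<close>.\<close>

lemma group_automorphism:
  fixes A :: "complex^'n^'n"
  assumes \<alpha>: "\<alpha> \<noteq> 0" and B: "B * B' = 1" "B' * B = 1" "B * Cmat A = csc \<alpha> (Cmat A * B)"
  obtains \<phi> where "biholo_aut A \<phi>" "\<And>p. \<phi> p $ None = \<alpha> * p $ None"
    "\<And>p u. app (MA A (- (\<alpha> * p $ None))) (frechet_derivative \<phi> (at p) u) =
       (let x = app (MA A (- p $ None)) u in (\<alpha> * x $ None) *s Z0 + lift (x $ None *s y + app B (low x)))"
proof -
  define f where "f u = \<alpha> *s app (XA A) u + u $ None *s lift y" for u
  have lin: "f (u + v) = f u + f v" "f (c *s u) = c *s f u" for u v c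
    by (simp_all add: f_def app_add_right app_vscale vec_eq_iff algebra_simps)
  obtain L where L: "\<And>u. app L u = \<alpha> *s app (XA A) u + u $ None *s lift y"
    using Cmat_of_linear[OF lin] unfolding f_def by blast
  define f where "f u = lift (app B (low u))" for u
  have lin: "f (u + v) = f u + f v" "f (c *s u) = c *s f u" for u v c
    by (simp_all add: f_def app_add_right app_vscale low_simps lift_simps)
  obtain Bl where Bl: "\<And>u. app Bl u = lift (app B (low u))"
    using Cmat_of_linear[OF lin] unfolding f_def by blast
  define f where "f u = lift (app B' (low u))" for u
  have lin: "f (u + v) = f u + f v" "f (c *s u) = c *s f u" for u v c
    by (simp_all add: f_def app_add_right app_vscale low_simps lift_simps)
  obtain Bl' where Bl': "\<And>u. app Bl' u = lift (app B' (low u))"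
    using Cmat_of_linear[OF lin] unfolding f_def by blast
  obtain z :: "'n option cmat" where z: "\<And>v. app z v = v $ None *s Z0"
    using None_projection by blast
  have BB: "app B (app B' w) = w" "app B' (app B w) = w" for w using B by (metis app_1 app_mult)+
  have LNone: "app (exp (csc s L)) v $ None = v $ None" for s v
  proof -
    have "z * csc s L = 0 * z" by (rule cmat_eqI) (simp add: app_mult z app_csc L app_XA)
    from exp_intertwine[OF this] have "z * exp (csc s L) = z" by simp
    then have "app z (app (exp (csc s L)) v) $ None = app z v $ None" by (metis app_mult)
    then show ?thesis by (simp add: z)
  qed
  \<comment> \<open>On the ideal \<open>L\<close> agrees with \<open>\<alpha>\<close> times
    \<open>XA A\<close>, since its \<open>y\<close> term sees only the first coordinate;
    \<open>1 - z\<close> projects to the ideal.\<close>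
  have Lw: "app (exp (csc s L)) w = app (MA A (\<alpha> * s)) w" if "w $ None = 0" for s w
  proof -
    have "(1 - z) * csc (\<alpha> * s) (XA A) = csc s L * (1 - z)"
      by (rule cmat_eqI)
        (simp add: app_mult app_diff z app_csc L app_XA app_diff_right app_vscale low_simps lift_simps vec_eq_iff algebra_simps)
    from exp_intertwine[OF this] have "(1 - z) * MA A (\<alpha> * s) = exp (csc s L) * (1 - z)" by (simp add: MA_def)
    from arg_cong[OF this, of "\<lambda>x. app x w"] show ?thesis
      using that by (simp add: app_mult app_diff z app_diff_right app_vscale)
  qed
  have BlM: "app Bl (app (MA A s) v) = app (MA A (\<alpha> * s)) (app Bl v)" for s v
  proof -
    have "app B (A *v w) = \<alpha> *s (A *v app B w)" for w
      using arg_cong[OF B(3), of "\<lambda>x. app x w"] by (simp add: app_mult app_csc app_Cmat)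
    then have "Bl * csc s (XA A) = csc (\<alpha> * s) (XA A) * Bl"
      by (intro cmat_eqI) (simp add: app_mult Bl app_csc app_vscale app_XA low_simps lift_simps mult.commute)
    from exp_intertwine[OF this] have "Bl * MA A s = MA A (\<alpha> * s) * Bl" by (simp add: MA_def)
    then show ?thesis by (metis app_mult)
  qed
  define \<psi> where "\<psi> s = app (exp (csc s L)) Z0 - Z0" for s
  have \<psi>0: "\<psi> s $ None = 0" for s by (simp add: \<psi>_def LNone)
  \<comment> \<open>This cocycle identity is what makes \<open>\<phi>\<close> multiplicative in the
    ideal component.\<close>
  have \<psi>add: "\<psi> (s + t) = \<psi> s + app (MA A (\<alpha> * s)) (\<psi> t)" for s t
  proof -
    have "\<psi> (s + t) = app (exp (csc s L)) (Z0 + \<psi> t) - Z0"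
      by (simp add: \<psi>_def exp_csc_add app_mult)
    then show ?thesis by (simp add: app_add_right Lw[OF \<psi>0]) (simp add: \<psi>_def)
  qed
  have \<psi>d: "(\<psi> has_derivative (\<lambda>h. h *s app (MA A (\<alpha> * s)) (lift y))) (at s)" for s
  proof -
    have "(\<psi> has_derivative (\<lambda>h. h *s app (L * exp (csc s L)) Z0 - 0)) (at s)"
      unfolding \<psi>_def by (intro has_derivative_diff has_derivative_app_exp_csc has_derivative_const)
    moreover have "L * exp (csc s L) = exp (csc s L) * L" by (rule exp_intertwine) simp
    then have "app (L * exp (csc s L)) Z0 = app (exp (csc s L)) (app L Z0)" by (simp add: app_mult)
    moreover have "app L Z0 = lift y" by (simp add: L app_XA lift_simps)
    ultimately show ?thesis by (simp add: Lw)
  qed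
  have coord: "((\<lambda>p. c * p $ None) has_derivative (\<lambda>u. c * u $ None)) (at p)" for c and p :: "complex^('n option)"
    by (auto intro!: derivative_eq_intros bounded_linear_imp_has_derivative[OF bounded_linear_vec_nth])
  have \<psi>c: "((\<lambda>p. \<psi> (c * p $ None)) has_derivative (\<lambda>u. (c * u $ None) *s app (MA A (\<alpha> * (c * p $ None))) (lift y))) (at p)"
    for c and p :: "complex^('n option)"
    by (rule has_derivative_compose[OF coord \<psi>d])
  have Z0c: "((\<lambda>p. (c * p $ None) *s Z0) has_derivative (\<lambda>u. (c * u $ None) *s Z0)) (at p)" for c and p :: "complex^('n option)"
    by (rule bounded_linear.has_derivative[OF bounded_linear_vscale coord])
  \<comment> \<open>The factor 1 fits the shape of \<open>\<psi>c\<close>, which serves the inverse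
    map with \<open>1 / \<alpha>\<close> in its place.\<close>
  define \<phi> where "\<phi> p = (\<alpha> * p $ None) *s Z0 + app Bl p + \<psi> (1 * p $ None)" for p
  define \<phi>' where "\<phi>' p u = (\<alpha> * u $ None) *s Z0 + app Bl u + (1 * u $ None) *s app (MA A (\<alpha> * (1 * p $ None))) (lift y)" for p u :: "complex^('n option)"
  have d\<phi>: "(\<phi> has_derivative \<phi>' p) (at p)" for p
    unfolding \<phi>_def \<phi>'_def
    by (intro has_derivative_add Z0c \<psi>c bounded_linear_imp_has_derivative[OF bounded_linear_app])
  have c\<phi>: "\<phi>' p (c *s u) = c *s \<phi>' p u" for p c u
    by (simp add: \<phi>'_def app_vscale vec_eq_iff algebra_simps)
  note holo\<phi> = holo_of_has_derivative[of \<phi> \<phi>', OF d\<phi> c\<phi>]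
  define \<chi>1 where "\<chi>1 p = (1 / \<alpha> * p $ None) *s Z0 + app Bl' (p - \<psi> (1 / \<alpha> * p $ None))" for p
  define \<chi>' where "\<chi>' p u = (1 / \<alpha> * u $ None) *s Z0 + app Bl' (u - (1 / \<alpha> * u $ None) *s app (MA A (\<alpha> * (1 / \<alpha> * p $ None))) (lift y))"
    for p u :: "complex^('n option)"
  have d\<chi>: "(\<chi>1 has_derivative \<chi>' p) (at p)" for p
    unfolding \<chi>1_def \<chi>'_def
    by (intro has_derivative_add Z0c bounded_linear.has_derivative[OF bounded_linear_app] has_derivative_diff \<psi>c has_derivative_ident)
  have c\<chi>: "\<chi>' p (c *s u) = c *s \<chi>' p u" for p c u
    by (simp add: \<chi>'_def app_diff_right app_vscale vec_eq_iff algebra_simps)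
  have \<phi>None: "\<phi> p $ None = \<alpha> * p $ None" for p by (simp add: \<phi>_def Bl \<psi>0)
  have \<phi>low: "low (\<phi> p) = app B (low p) + low (\<psi> (p $ None))" for p
    by (simp add: \<phi>_def low_simps Bl)
  have \<chi>None: "\<chi>1 p $ None = p $ None / \<alpha>" for p by (simp add: \<chi>1_def Bl')
  have \<chi>low: "low (\<chi>1 p) = app B' (low p - low (\<psi> (p $ None / \<alpha>)))" for p
    by (simp add: \<chi>1_def low_simps Bl')
  have inv1: "\<chi>1 (\<phi> p) = p" for p
    by (rule vec_option_eqI) (use \<alpha> in \<open>simp_all add: \<chi>None \<phi>None \<chi>low \<phi>low BB\<close>)
  have inv2: "\<phi> (\<chi>1 p) = p" for p
    by (rule vec_option_eqI) (use \<alpha> in \<open>simp_all add: \<chi>None \<phi>None \<chi>low \<phi>low BB\<close>)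
  have bij: "bij \<phi>" by (rule o_bij[of \<chi>1]) (auto simp: inv1 inv2 o_def)
  have "inv \<phi> = \<chi>1" by (rule inv_equality) (simp_all add: inv1 inv2)
  then have "holo (inv \<phi>)" using holo_of_has_derivative(1)[of \<chi>1 \<chi>', OF d\<chi> c\<chi>] by simp
  moreover have "\<phi> (gmul A p q) = gmul A (\<phi> p) (\<phi> q)" for p q
  proof -
    have "\<phi> (gmul A p q) = (\<alpha> * p $ None) *s Z0 + (\<alpha> * q $ None) *s Z0 + app Bl p + app (MA A (\<alpha> * p $ None)) (app Bl q)
        + \<psi> (p $ None) + app (MA A (\<alpha> * p $ None)) (\<psi> (q $ None))"
      unfolding \<phi>_def gmul_eq by (simp add: app_add_right BlM \<psi>add) (simp add: vec_eq_iff algebra_simps)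
    also have "\<dots> = gmul A (\<phi> p) (\<phi> q)"
      unfolding gmul_eq \<phi>None by (simp add: \<phi>_def app_add_right app_vscale)
    finally show ?thesis .
  qed
  ultimately have "biholo_aut A \<phi>" unfolding biholo_aut_def using bij holo\<phi>(1) by blast
  moreover have "app (MA A (- (\<alpha> * p $ None))) (frechet_derivative \<phi> (at p) u) =
       (let x = app (MA A (- p $ None)) u in (\<alpha> * x $ None) *s Z0 + lift (x $ None *s y + app B (low x)))" for p u
  proof -
    have "app (MA A (- (\<alpha> * p $ None))) (\<phi>' p u) = (\<alpha> * u $ None) *s Z0 + app Bl (app (MA A (- p $ None)) u) + u $ None *s lift y"
      using BlM[of "- p $ None" u] by (simp add: \<phi>'_def app_add_right app_vscale)
    then show ?thesis by (simp add: holo\<phi>(2) Let_def Bl lift_simps)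
  qed
  ultimately show ?thesis using that \<phi>None by blast
qed

section \<open>Uniqueness\<close>

lemma soliton_unique:
  fixes A :: "complex^'n^'n"
  assumes s1: "hcf_soliton A g1" and s2: "hcf_soliton A g2"
  shows "\<exists>c::real. c > 0 \<and> (\<exists>\<phi>. biholo_aut A \<phi> \<and>
     (\<forall>p u v. g2 p u v = of_real c * g1 (\<phi> p) (frechet_derivative \<phi> (at p) u) (frechet_derivative \<phi> (at p) v)))"
proof -
  obtain N y q r E d where ad1: "adapted (g1 0) N y q r"
    and e1: "N *\<^sub>R ((q * Cmat A * r) * star (q * Cmat A * r)) = E + star E - (2 * Re d) *\<^sub>R 1"
      "E * (q * Cmat A * r) - (q * Cmat A * r) * E = csc d (q * Cmat A * r)"
    using soliton_algebra[OF s1] by blast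
  obtain K x k l F c where ad2: "adapted (g2 0) K x k l"
    and e2: "K *\<^sub>R ((k * Cmat A * l) * star (k * Cmat A * l)) = F + star F - (2 * Re c) *\<^sub>R 1"
      "F * (k * Cmat A * l) - (k * Cmat A * l) * F = csc c (k * Cmat A * l)"
    using soliton_algebra[OF s2] by blast
  have N: "N > 0" "q * r = 1" "r * q = 1"
    and H1: "\<And>u v. g1 0 u v = u $ None * cnj (v $ None) / of_real N + cin (tilde q y u) (tilde q y v)"
    using ad1 unfolding adapted_def by blast+
  have K: "K > 0" "k * l = 1" "l * k = 1"
    and H2: "\<And>u v. g2 0 u v = u $ None * cnj (v $ None) / of_real K + cin (tilde k x u) (tilde k x v)"
    using ad2 unfolding adapted_def by blast+
  define a where "a = q * Cmat A * r"
  define b where "b = k * Cmat A * l"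
  have aq: "a * q = q * Cmat A" using N by (simp add: a_def mult.assoc)
  have ra: "r * a = Cmat A * r" using N by (simp add: a_def mult.assoc[symmetric])
  have bk: "b * k = k * Cmat A" using K by (simp add: b_def mult.assoc)
  have lb: "l * b = Cmat A * l" using K by (simp add: b_def mult.assoc[symmetric])
  have T: "a * (q * l) = (q * l) * b" by (metis aq lb mult.assoc)
  have TS: "(q * l) * (k * r) = 1" using N K by (metis mult.assoc mult_1_right)
  obtain \<alpha> U where U: "\<alpha> > 0" "star U * U = 1" "U * star U = 1" "U * b = (\<alpha>::real) *\<^sub>R (a * U)"
    using soliton_unitary_equivalence[OF N(1) K(1) e1 e2, folded a_def b_def, OF T TS cmat_inverse_commute[OF TS]] by blast
  \<comment> \<open>The homothety factor is dictated by the normal direction, where the pullback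
    contributes \<open>m * \<alpha>\<^sup>2 / N\<close> and \<open>1 / K\<close> is required;
    dividing \<open>B\<close> by \<open>sqrt m\<close> restores the isometry on the ideal.\<close>
  define m where "m = N / (K * \<alpha>\<^sup>2)"
  have m: "m > 0" using N K U by (simp add: m_def)
  define B where "B = (1 / sqrt m) *\<^sub>R (r * U * k)"
  define B' where "B' = sqrt m *\<^sub>R (l * star U * q)"
  have "r * U * k * (l * star U * q) = 1"
  proof -
    have "r * U * k * (l * star U * q) = r * U * (k * l) * star U * q" by (simp add: mult.assoc)
    also have "\<dots> = r * (U * star U) * q" by (simp add: K mult.assoc)
    finally show ?thesis by (simp add: U N)
  qed
  then have BB: "B * B' = 1" using m by (simp add: B_def B'_def)
  have BA: "B * Cmat A = csc (of_real \<alpha>) (Cmat A * B)"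
  proof -
    have "r * U * k * Cmat A = r * (U * b) * k" using bk by (simp add: mult.assoc)
    also have "\<dots> = \<alpha> *\<^sub>R (Cmat A * (r * U * k))" unfolding U(4) using ra by (simp add: mult.assoc[symmetric])
    finally show ?thesis by (simp add: B_def csc_of_real)
  qed
  \<comment> \<open>With this choice the automorphism carries \<open>Z0 + lift x\<close>, normal for
    the second metric, to \<open>\<alpha>\<close> times \<open>Z0 + lift y\<close>, normal for the
    first.\<close>
  define y' where "y' = of_real \<alpha> *s y - app B x"
  have \<alpha>0: "complex_of_real \<alpha> \<noteq> 0" using U(1) by simp
  obtain \<phi> where \<phi>: "biholo_aut A \<phi>" "\<And>p. \<phi> p $ None = of_real \<alpha> * p $ None"
    "\<And>p u. app (MA A (- (of_real \<alpha> * p $ None))) (frechet_derivative \<phi> (at p) u) =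
       (let w = app (MA A (- p $ None)) u in (of_real \<alpha> * w $ None) *s Z0 + lift (w $ None *s y' + app B (low w)))"
    using group_automorphism[OF \<alpha>0 BB cmat_inverse_commute[OF BB] BA, of y'] by blast
  have pull: "g2 0 u v = of_real m * g1 0 ((of_real \<alpha> * u $ None) *s Z0 + lift (u $ None *s y' + app B (low u)))
      ((of_real \<alpha> * v $ None) *s Z0 + lift (v $ None *s y' + app B (low v)))" for u v
  proof -
    have t: "tilde q y ((of_real \<alpha> * u $ None) *s Z0 + lift (u $ None *s y' + app B (low u))) = (1 / sqrt m) *\<^sub>R app U (tilde k x u)" for u
    proof -
      have "tilde q y ((of_real \<alpha> * u $ None) *s Z0 + lift (u $ None *s y' + app B (low u))) = app q (app B (low u - u $ None *s x))"
        unfolding tilde_def by (rule arg_cong[of _ _ "app q"])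
          (simp add: low_simps y'_def app_diff_right app_vscale vec_eq_iff algebra_simps)
      also have "\<dots> = (1 / sqrt m) *\<^sub>R app (q * r) (app U (tilde k x u))"
        by (simp add: B_def app_scaleR app_scaleR_right app_mult tilde_def)
      finally show ?thesis by (simp add: N)
    qed
    have Uc: "cin (app U w) (app U w') = cin w w'" for w w'
      by (simp add: cin_app U flip: app_mult)
    have r1: "m * (1 / sqrt m * (1 / sqrt m)) = 1" using m by simp
    have r2: "m * (\<alpha> * \<alpha> / N) = 1 / K" using N K U(1) by (simp add: m_def power2_eq_square)
    define Q where "Q = cin (tilde k x u) (tilde k x v)"
    have "of_real m * (of_real \<alpha> * u $ None * cnj (of_real \<alpha> * v $ None) / of_real N + of_real (1 / sqrt m) * (of_real (1 / sqrt m) * Q))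
      = of_real (m * (\<alpha> * \<alpha> / N)) * (u $ None * cnj (v $ None)) + of_real (m * (1 / sqrt m * (1 / sqrt m))) * Q"
      unfolding of_real_mult of_real_divide complex_cnj_mult complex_cnj_complex_of_real by (simp add: distrib_left mult_ac)
    also have "\<dots> = u $ None * cnj (v $ None) / of_real K + Q" unfolding r1 r2 by simp
    finally show ?thesis
      unfolding H1 H2 t cin_scaleR_left cin_scaleR_right Uc Q_def by simp
  qed
  have "g2 p u v = of_real m * g1 (\<phi> p) (frechet_derivative \<phi> (at p) u) (frechet_derivative \<phi> (at p) v)" for p u v
  proof -
    have L1: "left_inv_metric A g1" and L2: "left_inv_metric A g2" using s1 s2 by (auto simp: hcf_soliton_def)
    show ?thesis
      unfolding left_inv_metric_eq[OF L2, of p] left_inv_metric_eq[OF L1, of "\<phi> p"] pull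
      by (simp add: \<phi>(2,3) Let_def)
  qed
  then show ?thesis using m \<phi>(1) by blast
qed

theorem theorem1p3:
  fixes A :: "complex^'n^'n"
  shows "(\<forall>g1 g2. hcf_soliton A g1 \<and> hcf_soliton A g2 \<longrightarrow>
            (\<exists>c::real. c > 0 \<and> (\<exists>\<phi>. biholo_aut A \<phi> \<and>
               (\<forall>p u v. g2 p u v = of_real c * g1 (\<phi> p) (frechet_derivative \<phi> (at p) u)
                                                     (frechet_derivative \<phi> (at p) v)))))
         \<and> ((\<exists>g. hcf_soliton A g) \<longleftrightarrow> semisimple_mat A \<or> nilpotent_mat A)"
  using soliton_unique soliton_imp_semisimple_or_nilpotent semisimple_imp_soliton nilpotent_imp_soliton
  by metis

end
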